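(* Let $q$ be a prime power and let $n\ge r\ge1$ be integers with $r$ odd. Define the Charney-Davis quantity of $A(M_r(\mathbb{F}_q^n))$ to be $(-1)^{\frac{r-1}{2}}H\big(A(M_r(\mathbb{F}_q^n)),-1\big)$. Then: (a) it equals $(-1)^{\frac{r-1}{2}}\sum_{k=0}^{\frac{r-1}{2}}\genfrac{[}{]}{0pt}{}{n}{2k}_qE_{2k,q}$; (b) it equals $(-1)^{\frac{r-1}{2}}\Big(1+[n]_q!\sum_{a=1}^{\frac{r-1}{2}}\frac{(-1)^a}{[n-2a]_q!}\Delta_{a,q}\Big)$, where $\Delta_{a,q}$ is the determinant of the $a\times a$ matrix whose $(i,j)$ entry is $\frac{1}{[2(i-j+1)]_q!}$ if $i\ge j-1$ (so the superdiagonal entries are $\frac{1}{[0]_q!}=1$) and $0$ if $i<j-1$, i.e. \[ \Delta_{a,q}=\det\begin{pmatrix}\frac{1}{[2]_q!}&1&0&\cdots&0\\ \frac{1}{[4]_q!}&\frac{1}{[2]_q!}&1&\cdots&0\\ \vdots&\vdots&\vdots&\ddots&\vdots\\ \frac{1}{[2a-2]_q!}&\frac{1}{[2a-4]_q!}&\frac{1}{[2a-6]_q!}&\cdots&1\\ \frac{1}{[2a]_q!}&\frac{1}{[2a-2]_q!}&\frac{1}{[2a-4]_q!}&\cdots&\frac{1}{[2]_q!}\end{pmatrix}. \]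
   Context: Chow ring of a lattice: for a finite ranked lattice $L$ with minimum $\bot$, $A(L)=\mathbb{Z}[x_F : F\in L\setminus\{\bot\}]/I$, where $I$ is generated by $x_Fx_G$ for incomparable $F,G$ and, for each atom $a$, by $\sum_{F\ge a}x_F$; graded by degree with free graded pieces, Hilbert series $H(A(L),t)=\sum_d\operatorname{rank}_{\mathbb{Z}}A(L)_d\,t^d$. $M_r(\mathbb{F}_q^n)$ is the matroid whose independent sets are linearly independent subsets of $\mathbb{F}_q^n$ of size at most $r$; its lattice of flats consists of all subspaces of dimension at most $r-1$ together with $\mathbb{F}_q^n$ (rank = dimension, $\mathbb{F}_q^n$ has rank $r$), and $A(M_r(\mathbb{F}_q^n))$ is the Chow ring of that lattice. Notation: $[k]_q=1+q+\dots+q^{k-1}$, $[k]_q!=[1]_q\cdots[k]_q$ ($[0]_q!=1$), $\genfrac{[}{]}{0pt}{}{n}{k}_q=\frac{[n]_q!}{[k]_q![n-k]_q!}$, $(a;q)_m=(1-a)(1-aq)\cdots(1-aq^{m-1})$. Let $\cosh_q(t)=\sum_{m\ge0}\frac{t^{2m}}{(q;q)_{2m}}$, $\sinh_q(t)=\sum_{m\ge0}\frac{t^{2m+1}}{(q;q)_{2m+1}}$, $\operatorname{sech}_q=1/\cosh_q$, $\tanh_q=\sinh_q/\cosh_q$; the $q$-tangent-secant numbers $E_{m,q}$ are defined by $\operatorname{sech}_q(t)+\tanh_q(t)=\sum_{m\ge0}E_{m,q}\frac{t^m}{(q;q)_m}$. *)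

theory Defs
  imports "HOL-Library.Poly_Mapping" "HOL-Computational_Algebra.Formal_Power_Series"
          "Jordan_Normal_Form.Determinant"
begin

text \<open>Integer polynomials in variables x_F indexed by elements F of type 'b:
  monomials are finitely supported exponent vectors, polynomials are finitely
  supported integer coefficient functions on monomials.\<close>
type_synonym 'b zpoly = "('b \<Rightarrow>\<^sub>0 nat) \<Rightarrow>\<^sub>0 int"

definition pvar :: "'b \<Rightarrow> 'b zpoly" where
  "pvar F = Poly_Mapping.single (Poly_Mapping.single F 1) 1"

definition mon_deg :: "('b \<Rightarrow>\<^sub>0 nat) \<Rightarrow> nat" where
  "mon_deg m = (\<Sum>v\<in>Poly_Mapping.keys m. Poly_Mapping.lookup m v)"

definition polys_in :: "'b set \<Rightarrow> 'b zpoly set" where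
  "polys_in V = {p. \<forall>m\<in>Poly_Mapping.keys p. Poly_Mapping.keys m \<subseteq> V}"

definition homog_in :: "'b set \<Rightarrow> nat \<Rightarrow> 'b zpoly set" where
  "homog_in V d = {p. \<forall>m\<in>Poly_Mapping.keys p. Poly_Mapping.keys m \<subseteq> V \<and> mon_deg m = d}"

inductive_set ideal_gen :: "'c::comm_ring_1 set \<Rightarrow> 'c set \<Rightarrow> 'c set"
  for R G where
  zero: "0 \<in> ideal_gen R G"
| gen: "g \<in> G \<Longrightarrow> p \<in> R \<Longrightarrow> p * g \<in> ideal_gen R G"
| add: "a \<in> ideal_gen R G \<Longrightarrow> b \<in> ideal_gen R G \<Longrightarrow> a + b \<in> ideal_gen R G"

definition atoms :: "'b::order set \<Rightarrow> 'b \<Rightarrow> 'b set" where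
  "atoms L b0 = {a \<in> L. a \<noteq> b0 \<and> (\<forall>c\<in>L. c \<le> a \<longrightarrow> c = b0 \<or> c = a)}"

definition chow_ideal :: "'b::order set \<Rightarrow> 'b \<Rightarrow> 'b zpoly set" where
  "chow_ideal L b0 = ideal_gen (polys_in (L - {b0}))
     ({pvar F * pvar G | F G. F \<in> L - {b0} \<and> G \<in> L - {b0} \<and> \<not> F \<le> G \<and> \<not> G \<le> F}
      \<union> {(\<Sum>F\<in>{F\<in>L. a \<le> F}. pvar F) | a. a \<in> atoms L b0})"

text \<open>Rank over Z of the degree-d piece A(L)_d = P_d / (I \<inter> P_d): the maximal size of a
  Z-linearly independent family of elements of A(L)_d (represented by polynomials).\<close>
definition chow_rank :: "'b::order set \<Rightarrow> 'b \<Rightarrow> nat \<Rightarrow> nat" where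
  "chow_rank L b0 d = Sup (card ` {S. finite S \<and> S \<subseteq> homog_in (L - {b0}) d \<and>
      (\<forall>c :: 'b zpoly \<Rightarrow> int. (\<Sum>s\<in>S. of_int (c s) * s) \<in> chow_ideal L b0
          \<longrightarrow> (\<forall>s\<in>S. c s = 0))})"

definition chow_hilbert :: "'b::order set \<Rightarrow> 'b \<Rightarrow> real \<Rightarrow> real" where
  "chow_hilbert L b0 t = suminf (\<lambda>d. real (chow_rank L b0 d) * t ^ d)"

definition fvecs :: "nat \<Rightarrow> (nat \<Rightarrow> 'a::field) set" where
  "fvecs n = {v. \<forall>i\<ge>n. v i = 0}"

definition lin_indep :: "(nat \<Rightarrow> 'a::field) set \<Rightarrow> bool" where
  "lin_indep B \<longleftrightarrow> finite B \<and>
     (\<forall>c. (\<forall>i. (\<Sum>v\<in>B. c v * v i) = 0) \<longrightarrow> (\<forall>v\<in>B. c v = 0))"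

definition lin_span :: "(nat \<Rightarrow> 'a::field) set \<Rightarrow> (nat \<Rightarrow> 'a) set" where
  "lin_span B = {(\<lambda>i. \<Sum>v\<in>B. c v * v i) | c. True}"

definition subspaces_dim :: "nat \<Rightarrow> nat \<Rightarrow> (nat \<Rightarrow> 'a::field) set set" where
  "subspaces_dim n k = {lin_span B | B. B \<subseteq> fvecs n \<and> lin_indep B \<and> card B = k}"

definition flats_Mr :: "nat \<Rightarrow> nat \<Rightarrow> (nat \<Rightarrow> 'a::field) set set" where
  "flats_Mr r n = (\<Union>k<r. subspaces_dim n k) \<union> {fvecs n}"

definition zero_subspace :: "(nat \<Rightarrow> 'a::field) set" where
  "zero_subspace = {\<lambda>i. 0}"

definition qint :: "real \<Rightarrow> nat \<Rightarrow> real" where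
  "qint q k = (\<Sum>i<k. q ^ i)"

definition qfact :: "real \<Rightarrow> nat \<Rightarrow> real" where
  "qfact q k = (\<Prod>j\<in>{1..k}. qint q j)"

definition qbinom :: "real \<Rightarrow> nat \<Rightarrow> nat \<Rightarrow> real" where
  "qbinom q n k = qfact q n / (qfact q k * qfact q (n - k))"

definition qpoch :: "real \<Rightarrow> nat \<Rightarrow> real" where
  "qpoch q m = (\<Prod>i<m. 1 - q ^ (i + 1))"

definition cosh_q :: "real \<Rightarrow> real fps" where
  "cosh_q q = Abs_fps (\<lambda>k. if even k then 1 / qpoch q k else 0)"

definition sinh_q :: "real \<Rightarrow> real fps" where
  "sinh_q q = Abs_fps (\<lambda>k. if odd k then 1 / qpoch q k else 0)"

text \<open>q-tangent-secant numbers: sech_q + tanh_q = sum_m E_{m,q} t^m / (q;q)_m.\<close>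
definition qEuler :: "real \<Rightarrow> nat \<Rightarrow> real" where
  "qEuler q m = qpoch q m * fps_nth (inverse (cosh_q q) + sinh_q q * inverse (cosh_q q)) m"

definition qDelta :: "real \<Rightarrow> nat \<Rightarrow> real" where
  "qDelta q a = det (mat a a (\<lambda>(i, j). if j \<le> i + 1 then 1 / qfact q (2 * (i + 1 - j)) else 0))"

end

(* Put h_F = sum_{G >= F} x_G.  For a geometric lattice, the Feichtner-Yuzvinsky exponents (chains
   F_1 < ... < F_k with exponents 1 <= d_i < rk F_i - rk F_(i-1)) index a basis of the Chow ring
   tensored with Q: the relations x_G h_F^(rk F - rk G) = 0 for G < F let one push exponents upwards,
   so the corresponding x-monomials span; and the h-monomials are independent, because for each
   such exponent vector there is an explicit 0/1-valued functional on h-monomials, of dragon-Hall-Rado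
   type, which vanishes on the Chow ideal and is unitriangular on the basis.

   At t = -1 the exponents of a single step of rank rho contribute sum_{1 <= d < rho} (-1)^d, which is
   -1 for even rho and 0 for odd rho, so only flats of even rank survive and the contributions
   satisfy the recursion over intervals that, after counting subspaces by q-binomials, defines the
   even q-Euler numbers.  The determinants obey the same recursion by expansion along the first
   row. *)
theory Submission
  imports Defs "HOL-Library.Function_Algebras"
begin

section \<open>Polynomials and substitution\<close>

text \<open>The \<open>x\<close>-monomials and the \<open>h\<close>-monomials share an index set,
  and each family does the half that suits it. \<open>chow_rank\<close> is a supremum of sizes of
  independent sets, so spanning by N elements and independence of N possibly different elements
  already determine it; no change of basis and no freeness statement is required. The obstacle in
  the independence half is that the ideal is given in the \<open>x\<close>-variables while the
  functionals are described on \<open>h\<close>-monomials, where a product of two incomparable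
  \<open>x\<close>-variables has no short form. It is reached through (h_F - h_J)(h_G - h_J) with J
  the join of F and G: this expands into x_F x_G plus products of incomparable pairs of larger total
  rank, so a descending induction on rank applies. On the quadratic expression itself a 0/1 rule can
  be tested one monomial at a time, by uncrossing tight flats. A functional carries a chain with
  prescribed counts because the degree alone cannot tell exponent vectors apart. Oddness of
  \<open>r\<close> enters through the top flat: it is the only flat whose rank can differ from its
  dimension, and at t = -1 its odd rank removes it.\<close>

text \<open>The target is an arbitrary commutative ring so that integer functionals and substitution
  homomorphisms are both instances.\<close>

definition lin_ext :: "(('b \<Rightarrow>\<^sub>0 nat) \<Rightarrow> 'c::comm_ring_1) \<Rightarrow> 'b zpoly \<Rightarrow> 'c" where
  "lin_ext f p = (\<Sum>m\<in>Poly_Mapping.keys p. of_int (Poly_Mapping.lookup p m) * f m)"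

lemma lin_ext_superset:
  assumes "finite A" "Poly_Mapping.keys p \<subseteq> A"
  shows "lin_ext f p = (\<Sum>m\<in>A. of_int (Poly_Mapping.lookup p m) * f m)"
  unfolding lin_ext_def using assms
  by (intro sum.mono_neutral_left) (auto simp: in_keys_iff)

lemma lin_ext_add: "lin_ext f (p + p') = lin_ext f p + lin_ext f p'"
proof -
  let ?A = "Poly_Mapping.keys p \<union> Poly_Mapping.keys p'"
  have "Poly_Mapping.keys (p + p') \<subseteq> ?A" by (rule keys_add)
  then show ?thesis
    by (simp add: lin_ext_superset[of ?A] lookup_add ring_distribs sum.distrib)
qed

lemma lin_ext_zero [simp]: "lin_ext f 0 = 0"
  by (simp add: lin_ext_def)

lemma lin_ext_uminus: "lin_ext f (- p) = - lin_ext f p"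
  using lin_ext_add[of f p "- p"] by (simp add: eq_neg_iff_add_eq_0 add.commute)

lemma lin_ext_diff: "lin_ext f (p - p') = lin_ext f p - lin_ext f p'"
  using lin_ext_add[of f p "- p'"] by (simp add: lin_ext_uminus)

lemma lin_ext_sum: "lin_ext f (\<Sum>i\<in>A. g i) = (\<Sum>i\<in>A. lin_ext f (g i))"
  by (induction A rule: infinite_finite_induct) (auto simp: lin_ext_add)

lemma lin_ext_single: "lin_ext f (Poly_Mapping.single m c) = of_int c * f m"
  by (simp add: lin_ext_def)

lemma poly_mapping_as_sum:
  "p = (\<Sum>m\<in>Poly_Mapping.keys p. Poly_Mapping.single m (Poly_Mapping.lookup p m))"
proof (rule poly_mapping_eqI)
  fix k
  show "Poly_Mapping.lookup p k
      = Poly_Mapping.lookup (\<Sum>m\<in>Poly_Mapping.keys p. Poly_Mapping.single m (Poly_Mapping.lookup p m)) k"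
    by (auto simp: lookup_sum lookup_single when_def sum.delta' in_keys_iff)
qed

lemma lin_ext_mult:
  assumes "\<And>m m'. f (m + m') = f m * f m'"
  shows "lin_ext f (p * p') = lin_ext f p * lin_ext f p'"
proof -
  have "lin_ext f (Poly_Mapping.single m c * Poly_Mapping.single m' c')
      = lin_ext f (Poly_Mapping.single m c) * lin_ext f (Poly_Mapping.single m' c')" for m m' c c'
    by (simp add: mult_single lin_ext_single assms algebra_simps)
  note single = this
  let ?s = "\<lambda>p m. Poly_Mapping.single m (Poly_Mapping.lookup p m)"
  have "lin_ext f (p * p')
      = lin_ext f ((\<Sum>m\<in>Poly_Mapping.keys p. ?s p m) * (\<Sum>m\<in>Poly_Mapping.keys p'. ?s p' m))"
    by (simp flip: poly_mapping_as_sum)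
  also have "\<dots> = lin_ext f (\<Sum>m\<in>Poly_Mapping.keys p. ?s p m) * lin_ext f (\<Sum>m\<in>Poly_Mapping.keys p'. ?s p' m)"
    by (simp only: sum_product lin_ext_sum single)
  finally show ?thesis by (simp flip: poly_mapping_as_sum)
qed

text \<open>Multiplying by a monomial only shifts the argument of \<open>f\<close>. Vanishing of a
  functional on all multiples of a polynomial therefore follows from a pointwise identity between
  shifted values of \<open>f\<close>.\<close>

lemma lin_ext_mult_single:
  "lin_ext f (p * Poly_Mapping.single k 1) = lin_ext (\<lambda>m. f (m + k)) p"
proof -
  have "lin_ext f (p * Poly_Mapping.single k 1)
      = lin_ext f ((\<Sum>m\<in>Poly_Mapping.keys p. Poly_Mapping.single m (Poly_Mapping.lookup p m))
          * Poly_Mapping.single k 1)"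
    by (simp flip: poly_mapping_as_sum)
  also have "\<dots> = lin_ext (\<lambda>m. f (m + k)) p"
    by (simp only: sum_distrib_right lin_ext_sum mult_single lin_ext_single mult_1_right)
      (simp add: lin_ext_def)
  finally show ?thesis .
qed

lemma of_int_mult_single:
  "of_int c * Poly_Mapping.single m d = (Poly_Mapping.single m (c * d) :: 'b zpoly)"
  using mult_single[of 0 c m d] single_of_int[of c, where 'a = "'b \<Rightarrow>\<^sub>0 nat" and 'b = int] by simp

lemma lin_ext_of_int_mult: "lin_ext f (of_int c * p) = of_int c * lin_ext f p"
proof -
  have "of_int c * p
     = of_int c * (\<Sum>m\<in>Poly_Mapping.keys p. Poly_Mapping.single m (Poly_Mapping.lookup p m))"
    by (simp flip: poly_mapping_as_sum)
  also have "\<dots>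
     = (\<Sum>m\<in>Poly_Mapping.keys p. Poly_Mapping.single m (c * Poly_Mapping.lookup p m))"
    by (simp only: sum_distrib_left of_int_mult_single)
  finally show ?thesis
    by (simp add: lin_ext_sum lin_ext_single) (simp add: lin_ext_def sum_distrib_left mult.assoc)
qed

definition pmono :: "('b \<Rightarrow> 'c::comm_ring_1) \<Rightarrow> ('b \<Rightarrow>\<^sub>0 nat) \<Rightarrow> 'c" where
  "pmono X m = (\<Prod>v\<in>Poly_Mapping.keys m. X v ^ Poly_Mapping.lookup m v)"

lemma pmono_superset:
  assumes "finite A" "Poly_Mapping.keys m \<subseteq> A"
  shows "pmono X m = (\<Prod>v\<in>A. X v ^ Poly_Mapping.lookup m v)"
  unfolding pmono_def using assms
  by (intro prod.mono_neutral_left) (auto simp: in_keys_iff)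

lemma pmono_add: "pmono X (m + m') = pmono X m * pmono X m'"
proof -
  let ?A = "Poly_Mapping.keys m \<union> Poly_Mapping.keys m'"
  have "Poly_Mapping.keys (m + m') \<subseteq> ?A" by (rule keys_add)
  then show ?thesis
    by (simp add: pmono_superset[of ?A] lookup_add power_add prod.distrib)
qed

lemma pmono_zero [simp]: "pmono X 0 = 1"
  by (simp add: pmono_def)

lemma pmono_single [simp]: "pmono X (Poly_Mapping.single v k) = X v ^ k"
  by (simp add: pmono_def)

lemma pvar_power: "pvar v ^ k = Poly_Mapping.single (Poly_Mapping.single v k) 1"
  by (induction k) (auto simp: pvar_def mult_single single_add[symmetric])

lemma prod_single:
  "(\<Prod>i\<in>A. Poly_Mapping.single (f i) (1::int)) = Poly_Mapping.single (\<Sum>i\<in>A. f i) 1"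
  by (induction A rule: infinite_finite_induct) (auto simp: mult_single)

lemma sum_single_keys:
  "(\<Sum>v\<in>Poly_Mapping.keys m. Poly_Mapping.single v (Poly_Mapping.lookup m v)) = m"
  for m :: "'b \<Rightarrow>\<^sub>0 nat"
proof (rule poly_mapping_eqI)
  fix k
  show "Poly_Mapping.lookup (\<Sum>v\<in>Poly_Mapping.keys m. Poly_Mapping.single v (Poly_Mapping.lookup m v)) k
      = Poly_Mapping.lookup m k"
    by (auto simp: lookup_sum lookup_single when_def sum.delta' in_keys_iff)
qed

lemma pmono_pvar: "pmono pvar m = Poly_Mapping.single m 1"
  by (simp add: pmono_def pvar_power prod_single sum_single_keys)

definition psubst :: "('b \<Rightarrow> 'c::comm_ring_1) \<Rightarrow> 'b zpoly \<Rightarrow> 'c" where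
  "psubst X = lin_ext (pmono X)"

lemma psubst_mult: "psubst X (p * p') = psubst X p * psubst X p'"
  unfolding psubst_def by (rule lin_ext_mult) (rule pmono_add)

lemma psubst_pvar [simp]: "psubst X (pvar v) = X v"
  by (simp add: psubst_def pvar_def lin_ext_single)

lemma psubst_one [simp]: "psubst X 1 = 1"
  using lin_ext_single[of "pmono X" 0 1] by (simp add: psubst_def)

lemma psubst_power: "psubst X (p ^ k) = psubst X p ^ k"
  by (induction k) (auto simp: psubst_mult)

lemma psubst_sum: "psubst X (\<Sum>i\<in>A. f i) = (\<Sum>i\<in>A. psubst X (f i))"
  by (simp add: psubst_def lin_ext_sum)

lemma psubst_pmono:
  fixes Y :: "'a \<Rightarrow> 'b zpoly"
  shows "psubst X (pmono Y m) = pmono (\<lambda>v. psubst X (Y v)) m"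
proof -
  have "psubst X (\<Prod>i\<in>A. f i) = (\<Prod>i\<in>A. psubst X (f i))" for f and A :: "'a set"
    by (induction A rule: infinite_finite_induct) (auto simp: psubst_mult)
  then show ?thesis by (simp add: pmono_def psubst_power)
qed

lemma polys_in_zero [simp]: "0 \<in> polys_in V"
  and polys_in_one [simp]: "1 \<in> polys_in V"
  by (auto simp: polys_in_def)

lemma polys_in_pvar: "v \<in> V \<Longrightarrow> pvar v \<in> polys_in V"
  by (auto simp: polys_in_def pvar_def split: if_splits)

lemma polys_in_single: "Poly_Mapping.keys m \<subseteq> V \<Longrightarrow> Poly_Mapping.single m c \<in> polys_in V"
  by (auto simp: polys_in_def split: if_splits)

lemma polys_in_add: "p \<in> polys_in V \<Longrightarrow> p' \<in> polys_in V \<Longrightarrow> p + p' \<in> polys_in V"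
  using keys_add[of p p'] by (fastforce simp: polys_in_def)

lemma polys_in_uminus: "p \<in> polys_in V \<Longrightarrow> - p \<in> polys_in V"
  by (simp add: polys_in_def)

lemma polys_in_mult: "p \<in> polys_in V \<Longrightarrow> p' \<in> polys_in V \<Longrightarrow> p * p' \<in> polys_in V"
proof -
  assume *: "p \<in> polys_in V" "p' \<in> polys_in V"
  have "Poly_Mapping.keys m \<subseteq> V" if m: "m \<in> Poly_Mapping.keys (p * p')" for m
  proof -
    obtain a b where ab: "m = a + b" "a \<in> Poly_Mapping.keys p" "b \<in> Poly_Mapping.keys p'"
      using subsetD[OF keys_mult m] by blast
    then have "Poly_Mapping.keys a \<subseteq> V" "Poly_Mapping.keys b \<subseteq> V"
      using * by (auto simp: polys_in_def)
    then show ?thesis using keys_add[of a b] ab by blast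
  qed
  then show ?thesis by (simp add: polys_in_def)
qed

lemma polys_in_power: "p \<in> polys_in V \<Longrightarrow> p ^ k \<in> polys_in V"
  by (induction k) (auto intro: polys_in_mult)

lemma polys_in_sum: "(\<And>i. i \<in> A \<Longrightarrow> f i \<in> polys_in V) \<Longrightarrow> (\<Sum>i\<in>A. f i) \<in> polys_in V"
  by (induction A rule: infinite_finite_induct) (auto intro: polys_in_add)

lemma polys_in_of_int: "of_int c \<in> polys_in V"
  using polys_in_single[of 0 V c] by (simp flip: single_of_int)

section \<open>Generated ideals, degrees of monomials, integer linear dependence\<close>

lemma ideal_gen_mult:
  assumes "\<And>p p'. p \<in> R \<Longrightarrow> p' \<in> R \<Longrightarrow> p * p' \<in> R"
    and "z \<in> ideal_gen R G" and "p \<in> R"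
  shows "p * z \<in> ideal_gen R G"
  using assms(2)
proof induction
  case zero
  then show ?case by (simp add: ideal_gen.zero)
next
  case (gen g p')
  then show ?case
    using ideal_gen.gen[of g G "p * p'" R] assms by (simp add: mult.assoc)
next
  case (add a b)
  then show ?case by (simp add: ring_distribs ideal_gen.add)
qed

lemma ideal_gen_sum:
  "(\<And>i. i \<in> A \<Longrightarrow> f i \<in> ideal_gen R G) \<Longrightarrow> (\<Sum>i\<in>A. f i) \<in> ideal_gen R G"
  by (induction A rule: infinite_finite_induct) (auto intro: ideal_gen.intros)

lemma mon_deg_superset:
  assumes "finite A" "Poly_Mapping.keys m \<subseteq> A"
  shows "mon_deg m = (\<Sum>v\<in>A. Poly_Mapping.lookup m v)"
  unfolding mon_deg_def using assms
  by (intro sum.mono_neutral_left) (auto simp: in_keys_iff)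

lemma mon_deg_add: "mon_deg (m + m') = mon_deg m + mon_deg m'"
proof -
  let ?A = "Poly_Mapping.keys m \<union> Poly_Mapping.keys m'"
  have "Poly_Mapping.keys (m + m') \<subseteq> ?A" by (rule keys_add)
  then show ?thesis
    by (simp add: mon_deg_superset[of ?A] lookup_add sum.distrib)
qed

lemma mon_deg_zero [simp]: "mon_deg 0 = 0"
  and mon_deg_single [simp]: "mon_deg (Poly_Mapping.single v k) = k"
  by (simp_all add: mon_deg_def)

text \<open>Fraction-free elimination: with a pivot \<open>a t b\<close> that is nonzero, row
  \<open>s\<close> is replaced by \<open>a t b\<close> times row \<open>s\<close> minus
  \<open>a s b\<close> times row \<open>t\<close>, which clears column \<open>b\<close> without
  leaving the integers. It later bounds the size of independent families by the size of a spanning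
  one.\<close>

lemma int_linear_dependence:
  fixes a :: "'s \<Rightarrow> 't \<Rightarrow> int"
  assumes "finite B" "finite S" "card B < card S"
  shows "\<exists>c. (\<exists>s\<in>S. c s \<noteq> 0) \<and> (\<forall>b\<in>B. (\<Sum>s\<in>S. c s * a s b) = 0)"
  using assms
proof (induction B arbitrary: S a rule: finite_induct)
  case empty
  then have "S \<noteq> {}" by auto
  then show ?case by (intro exI[of _ "\<lambda>_. 1"]) auto
next
  case (insert b B)
  show ?case
  proof (cases "\<forall>s\<in>S. a s b = 0")
    case True
    have "card B < card S" using insert by auto
    from insert.IH[OF insert.prems(1) this, of a] True show ?thesis by auto
  next
    case False
    then obtain t where t: "t \<in> S" "a t b \<noteq> 0" by auto
    let ?S = "S - {t}"
    have fin: "finite ?S" and "card B < card ?S" using insert t by auto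
    from insert.IH[OF this, of "\<lambda>s x. a t b * a s x - a s b * a t x"]
    obtain c where c: "\<exists>s\<in>?S. c s \<noteq> 0"
      "\<And>x. x \<in> B \<Longrightarrow> (\<Sum>s\<in>?S. c s * (a t b * a s x - a s b * a t x)) = 0"
      by blast
    \<comment> \<open>The relation among the reduced rows is rewritten in the original rows. It
      stays nontrivial because the old coefficients are scaled by the nonzero pivot.\<close>
    define c' where "c' s = (if s = t then - (\<Sum>s\<in>?S. c s * a s b) else a t b * c s)" for s
    have sum: "(\<Sum>s\<in>S. c' s * a s x) = (\<Sum>s\<in>?S. c s * (a t b * a s x - a s b * a t x))" for x
    proof -
      have "(\<Sum>s\<in>S. c' s * a s x) = c' t * a t x + (\<Sum>s\<in>?S. c' s * a s x)"
        using t insert.prems by (simp add: sum.remove)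
      also have "(\<Sum>s\<in>?S. c' s * a s x) = (\<Sum>s\<in>?S. a t b * c s * a s x)"
        by (rule sum.cong) (auto simp: c'_def)
      finally show ?thesis
        by (simp add: c'_def sum_distrib_left sum_distrib_right sum_subtractf algebra_simps)
    qed
    have "(\<Sum>s\<in>S. c' s * a s x) = 0" if "x \<in> insert b B" for x
      using that c(2) by (cases "x = b") (auto simp: sum mult.commute)
    moreover have "\<exists>s\<in>S. c' s \<noteq> 0"
      using c(1) t by (auto simp: c'_def)
    ultimately show ?thesis by blast
  qed
qed

section \<open>Geometric lattices and counting functionals\<close>

text \<open>Moebius inversion in existence form. A minimal element \<open>a\<close> lies in no upper
  set but its own, so the system for the remaining elements is solved first and the value at
  \<open>a\<close> is then forced.\<close>

lemma ex_upper_sum_inverse: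
  fixes f :: "'b::order \<Rightarrow> 'c::ab_group_add"
  assumes "finite V"
  shows "\<exists>g. \<forall>F\<in>V. (\<Sum>G\<in>{G\<in>V. F \<le> G}. g G) = f F"
  using assms
proof (induction "card V" arbitrary: V)
  case 0
  then show ?case by auto
next
  case (Suc k)
  then have "V \<noteq> {}" by auto
  with Suc.prems obtain a where a: "a \<in> V" "\<And>x. x \<in> V \<Longrightarrow> x \<le> a \<Longrightarrow> a = x"
    by (meson finite_has_minimal)
  have "k = card (V - {a})" "finite (V - {a})" using Suc a by auto
  from Suc.hyps(1)[OF this]
  obtain g where g: "\<And>F. F \<in> V - {a} \<Longrightarrow> (\<Sum>G\<in>{G\<in>V - {a}. F \<le> G}. g G) = f F"
    by blast
  define g' where "g' F = (if F = a then f a - (\<Sum>G\<in>{G\<in>V - {a}. a \<le> G}. g G) else g F)" for F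
  have "(\<Sum>G\<in>{G\<in>V. F \<le> G}. g' G) = f F" if "F \<in> V" for F
  proof (cases "F = a")
    case True
    have "{G\<in>V. a \<le> G} = insert a {G\<in>V - {a}. a \<le> G}" using a by auto
    moreover have "(\<Sum>G\<in>{G\<in>V - {a}. a \<le> G}. g' G) = (\<Sum>G\<in>{G\<in>V - {a}. a \<le> G}. g G)"
      by (rule sum.cong) (auto simp: g'_def)
    ultimately show ?thesis using True Suc.prems by (simp add: g'_def)
  next
    case False
    then have "{G\<in>V. F \<le> G} = {G\<in>V - {a}. F \<le> G}" using a that by auto
    moreover have "(\<Sum>G\<in>{G\<in>V - {a}. F \<le> G}. g' G) = (\<Sum>G\<in>{G\<in>V - {a}. F \<le> G}. g G)"
      by (rule sum.cong) (auto simp: g'_def)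
    ultimately show ?thesis using g[of F] that False by simp
  qed
  then show ?case by blast
qed

text \<open>\<open>L\<close> is a finite subset of an ordered type, so joins and meets are taken
  relative to \<open>L\<close>; they are asserted in one axiom together with the submodular
  inequality, which refers to both. \<open>atom_below\<close> is the form in which atomicity is
  used: an atom that separates \<open>G\<close> from a smaller \<open>F\<close>.\<close>

locale geometric_lattice =
  fixes L :: "'b::order set" and b0 :: 'b and rk :: "'b \<Rightarrow> nat"
  assumes finite_L: "finite L"
    and bot_in: "b0 \<in> L"
    and bot_le: "F \<in> L \<Longrightarrow> b0 \<le> F"
    and rk_bot: "rk b0 = 0"
    and rk_less: "F \<in> L \<Longrightarrow> G \<in> L \<Longrightarrow> F < G \<Longrightarrow> rk F < rk G"
    and join_meet: "F \<in> L \<Longrightarrow> G \<in> L \<Longrightarrow> \<exists>J\<in>L. \<exists>M\<in>L.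
        F \<le> J \<and> G \<le> J \<and> (\<forall>H\<in>L. F \<le> H \<longrightarrow> G \<le> H \<longrightarrow> J \<le> H) \<and>
        M \<le> F \<and> M \<le> G \<and> (\<forall>H\<in>L. H \<le> F \<longrightarrow> H \<le> G \<longrightarrow> H \<le> M) \<and>
        rk J + rk M \<le> rk F + rk G"
    and rk_atom: "a \<in> atoms L b0 \<Longrightarrow> rk a = 1"
    and atom_below: "F \<in> L \<Longrightarrow> G \<in> L \<Longrightarrow> F < G \<Longrightarrow> \<exists>a\<in>atoms L b0. a \<le> G \<and> \<not> a \<le> F"
begin

abbreviation V :: "'b set" where "V \<equiv> L - {b0}"

lemma finite_V: "finite V"
  using finite_L by simp

lemma obtain_join_meet:
  assumes "F \<in> L" "G \<in> L"
  obtains J M where "J \<in> L" "M \<in> L" "F \<le> J" "G \<le> J" "\<And>H. H \<in> L \<Longrightarrow> F \<le> H \<Longrightarrow> G \<le> H \<Longrightarrow> J \<le> H"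
    "M \<le> F" "M \<le> G" "\<And>H. H \<in> L \<Longrightarrow> H \<le> F \<Longrightarrow> H \<le> G \<Longrightarrow> H \<le> M" "rk J + rk M \<le> rk F + rk G"
  using join_meet[OF assms] by (elim bexE conjE) blast

lemma upper_in_V: "F \<in> V \<Longrightarrow> G \<in> L \<Longrightarrow> F \<le> G \<Longrightarrow> G \<in> V"
  using bot_le[of F] by auto

lemma atom_in_V: "a \<in> atoms L b0 \<Longrightarrow> a \<in> V"
  by (auto simp: atoms_def)

definition cnt :: "('b \<Rightarrow>\<^sub>0 nat) \<Rightarrow> 'b \<Rightarrow> nat" where
  "cnt m W = (\<Sum>G\<in>{G\<in>V. G \<le> W}. Poly_Mapping.lookup m G)"

lemma cnt_add: "cnt (m + m') W = cnt m W + cnt m' W"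
  by (simp add: cnt_def lookup_add sum.distrib)

lemma cnt_single: "F \<in> V \<Longrightarrow> cnt (Poly_Mapping.single F k) W = (if F \<le> W then k else 0)"
  using finite_V by (auto simp: cnt_def lookup_single when_def sum.delta')

lemma cnt_bot [simp]: "cnt m b0 = 0"
proof -
  have "{G\<in>V. G \<le> b0} = {}" using bot_le by (auto dest: antisym)
  then show ?thesis unfolding cnt_def by (simp only: sum.empty)
qed

text \<open>Inclusion-exclusion for two down-sets: their union lies below \<open>J\<close>, possibly
  properly, and their intersection lies below \<open>M\<close>. The inequality runs opposite to
  submodularity of \<open>rk\<close>, which is what makes uncrossing work.\<close>

lemma cnt_supermodular:
  assumes "W \<le> J" "W' \<le> J" and "\<And>H. H \<in> L \<Longrightarrow> H \<le> W \<Longrightarrow> H \<le> W' \<Longrightarrow> H \<le> M"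
  shows "cnt m W + cnt m W' \<le> cnt m J + cnt m M"
proof -
  let ?S = "\<lambda>W. {G\<in>V. G \<le> W}" let ?s = "sum (Poly_Mapping.lookup m)"
  have "cnt m W + cnt m W' = ?s (?S W \<union> ?S W') + ?s (?S W \<inter> ?S W')"
    using finite_V by (simp add: cnt_def sum.union_inter)
  also have "?s (?S W \<union> ?S W') \<le> cnt m J"
    unfolding cnt_def using assms finite_V by (intro sum_mono2) auto
  also have "?s (?S W \<inter> ?S W') \<le> cnt m M"
    unfolding cnt_def using assms finite_V by (intro sum_mono2) auto
  finally show ?thesis by simp
qed

lemma cnt_mono: "W \<le> W' \<Longrightarrow> cnt m W \<le> cnt m W'"
  unfolding cnt_def using finite_V by (intro sum_mono2) auto

text \<open>The functionals separating the basis monomials: for a chain \<open>C\<close> and prescribed counts \<open>S\<close> on it, the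
  functional takes the value 1 on admissible monomials and 0 on all others. The strict inequality is
  the dragon Hall-Rado condition in the interval above each \<open>P\<close>.\<close>
definition admissible :: "'b set \<Rightarrow> ('b \<Rightarrow> nat) \<Rightarrow> ('b \<Rightarrow>\<^sub>0 nat) \<Rightarrow> bool" where
  "admissible C S m \<longleftrightarrow> (\<forall>P\<in>C. cnt m P = S P \<and> (\<forall>W\<in>L. P < W \<longrightarrow> cnt m W + rk P < S P + rk W))"

definition chain_of :: "'b set \<Rightarrow> bool" where
  "chain_of C \<longleftrightarrow> C \<subseteq> L \<and> (\<forall>F\<in>C. \<forall>G\<in>C. F \<le> G \<or> G \<le> F)"

text \<open>At \<open>P = b0\<close> the prescribed count is 0, and the condition at
  \<open>W = a\<close> becomes \<open>cnt a < 1\<close>, which a factor \<open>a\<close>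
  violates.\<close>

lemma not_admissible_atom:
  assumes "b0 \<in> C" "a \<in> atoms L b0"
  shows "\<not> admissible C S (m + Poly_Mapping.single a 1)"
proof
  assume ad: "admissible C S (m + Poly_Mapping.single a 1)"
  have a: "a \<in> V" "a \<in> L" "b0 < a" "rk a = 1"
    using assms atom_in_V bot_le rk_atom by (auto simp: order_less_le)
  have "S b0 = 0" using ad assms by (auto simp: admissible_def)
  moreover have "cnt (m + Poly_Mapping.single a 1) a + rk b0 < S b0 + rk a"
    using ad assms(1) a unfolding admissible_def by blast
  ultimately have "cnt (m + Poly_Mapping.single a 1) a < 1"
    using a rk_bot by simp
  then show False using a by (simp add: cnt_add cnt_single)
qed

text \<open>Moving a factor upwards without crossing an element of the chain keeps the prescribed
  counts and can only lower the others.\<close>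

lemma admissible_mono:
  assumes "admissible C S (m + Poly_Mapping.single G 1)"
    and "G \<in> V" "J \<in> V" "G \<le> J" "\<And>P. P \<in> C \<Longrightarrow> G \<le> P \<longleftrightarrow> J \<le> P"
  shows "admissible C S (m + Poly_Mapping.single J 1)"
  unfolding admissible_def
proof (intro ballI conjI impI)
  fix P assume P: "P \<in> C"
  then show "cnt (m + Poly_Mapping.single J 1) P = S P"
    using assms by (auto simp: admissible_def cnt_add cnt_single)
  fix W assume W: "W \<in> L" "P < W"
  then have "cnt (m + Poly_Mapping.single G 1) W + rk P < S P + rk W"
    using assms(1) P by (auto simp: admissible_def)
  moreover have "cnt (m + Poly_Mapping.single J 1) W \<le> cnt (m + Poly_Mapping.single G 1) W"
    using assms by (auto simp: cnt_add cnt_single)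
  ultimately show "cnt (m + Poly_Mapping.single J 1) W + rk P < S P + rk W" by linarith
qed

text \<open>If \<open>Q\<close> in the chain separates \<open>F\<close> from \<open>G\<close>,
  replacing the factor \<open>G\<close> by the join \<open>J\<close> crosses no chain element. For
  the converse direction, a violation at \<open>P < W\<close> must have \<open>G <= W\<close> but
  not \<open>J <= W\<close>, which forces \<open>P <= Q\<close>. Uncross \<open>W\<close> with
  \<open>Q\<close>: the join \<open>J'\<close> is bounded through \<open>Q\<close>, the meet
  \<open>M'\<close> through \<open>P\<close>. The factor \<open>G\<close> counted at
  \<open>W\<close> is balanced by the factor \<open>J\<close> counted at \<open>J'\<close>, and the
  sum of the bounds contradicts submodularity.\<close>

lemma admissible_shift:
  assumes C: "chain_of C" and Q: "Q \<in> C" "F \<le> Q" "\<not> G \<le> Q"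
    and V: "F \<in> V" "G \<in> V" "J \<in> V"
    and J: "F \<le> J" "G \<le> J" "\<And>H. H \<in> L \<Longrightarrow> F \<le> H \<Longrightarrow> G \<le> H \<Longrightarrow> J \<le> H"
  shows "admissible C S (m + Poly_Mapping.single G 1) \<longleftrightarrow> admissible C S (m + Poly_Mapping.single J 1)"
proof
  have same: "G \<le> P \<longleftrightarrow> J \<le> P" if "P \<in> C" for P
  proof -
    have "P \<le> Q \<or> Q \<le> P" "P \<in> L" using C Q that by (auto simp: chain_of_def)
    then show ?thesis using Q J by (metis order_trans)
  qed
  {
    assume "admissible C S (m + Poly_Mapping.single G 1)"
    then show "admissible C S (m + Poly_Mapping.single J 1)"
      by (rule admissible_mono) (use V J same in auto)
  }
  assume ad: "admissible C S (m + Poly_Mapping.single J 1)"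
  show "admissible C S (m + Poly_Mapping.single G 1)"
    unfolding admissible_def
  proof (intro ballI conjI impI)
    fix P assume P: "P \<in> C"
    then show "cnt (m + Poly_Mapping.single G 1) P = S P"
      using ad V same by (auto simp: admissible_def cnt_add cnt_single)
    fix W assume W: "W \<in> L" "P < W"
    show "cnt (m + Poly_Mapping.single G 1) W + rk P < S P + rk W"
    proof (rule ccontr)
      assume viol: "\<not> ?thesis"
      have adW: "cnt (m + Poly_Mapping.single J 1) W + rk P < S P + rk W"
        using ad P W by (auto simp: admissible_def)
      have GW: "G \<le> W" and JW: "\<not> J \<le> W"
        using viol adW V J by (auto simp: cnt_add cnt_single split: if_splits)
      then have "\<not> F \<le> W" using J W by blast
      then have "\<not> Q \<le> P" using Q W by (meson less_imp_le order_trans)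
      then have PQ: "P \<le> Q" using C Q P by (auto simp: chain_of_def)
      have QL: "Q \<in> L" "P \<in> L" using C Q P by (auto simp: chain_of_def)
      obtain J' M' where J'M': "J' \<in> L" "M' \<in> L" "W \<le> J'" "Q \<le> J'"
        "M' \<le> W" "M' \<le> Q" "\<And>H. H \<in> L \<Longrightarrow> H \<le> W \<Longrightarrow> H \<le> Q \<Longrightarrow> H \<le> M'"
        "rk J' + rk M' \<le> rk W + rk Q"
        using obtain_join_meet[OF W(1) QL(1)] by metis
      have "Q < J'" using J'M' Q GW by (metis order_less_le order_trans)
      then have 1: "cnt (m + Poly_Mapping.single J 1) J' + rk Q < S Q + rk J'"
        using ad Q J'M' by (auto simp: admissible_def)
      \<comment> \<open>\<open>M'\<close> may equal \<open>P\<close>, where admissibility gives an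
        equality, so this bound is only weak. The strictness of the final contradiction comes from
        \<open>J'\<close>, which is properly above \<open>Q\<close>.\<close>
      have "P \<le> M'" using J'M' QL PQ W by auto
      then have "P < M' \<or> P = M'" by (auto simp: order_less_le)
      then have 2: "cnt (m + Poly_Mapping.single J 1) M' + rk P \<le> S P + rk M'"
        using ad P J'M' by (auto simp: admissible_def less_imp_le)
      have "J \<le> J'" using J J'M' GW Q by (meson order_trans)
      then have 3: "cnt (m + Poly_Mapping.single J 1) J' = cnt m J' + 1"
        using V by (simp add: cnt_add cnt_single)
      have 4: "cnt m Q = S Q"
        using ad Q V same[of Q] by (auto simp: admissible_def cnt_add cnt_single split: if_splits)
      have 5: "cnt m W + cnt m Q \<le> cnt m J' + cnt m M'"
        by (rule cnt_supermodular) (use J'M' in auto)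
      have 6: "cnt (m + Poly_Mapping.single G 1) W = cnt m W + 1"
        using V GW by (simp add: cnt_add cnt_single)
      have 7: "cnt m M' \<le> cnt (m + Poly_Mapping.single J 1) M'"
        by (simp add: cnt_add)
      show False using viol 1 2 3 4 5 6 7 J'M'(8) by linarith
    qed
  qed
qed

text \<open>Submodularity of \<open>rk\<close> against supermodularity of \<open>cnt\<close> makes the functionals vanish on
  \<open>(h\<^sub>F - h\<^sub>J) (h\<^sub>G - h\<^sub>J)\<close> with \<open>J = F \<or> G\<close>; together with the \<open>h\<^sub>a\<close> for atoms \<open>a\<close> these generate
  the Chow ideal.\<close>
lemma admissible_quadratic:
  fixes m :: "'b \<Rightarrow>\<^sub>0 nat"
  assumes C: "chain_of C"
    and V: "F \<in> V" "G \<in> V" "J \<in> V"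
    and J: "F \<le> J" "G \<le> J" "\<And>H. H \<in> L \<Longrightarrow> F \<le> H \<Longrightarrow> G \<le> H \<Longrightarrow> J \<le> H"
  defines "e \<equiv> \<lambda>A B. m + Poly_Mapping.single A 1 + Poly_Mapping.single B 1"
  shows "of_bool (admissible C S (e F G)) + of_bool (admissible C S (e J J))
       = (of_bool (admissible C S (e F J)) + of_bool (admissible C S (e G J)) :: int)"
proof -
  have comm: "e A B = e B A" for A B by (simp add: e_def ac_simps)
  have cnt_e: "cnt (e A B) W = cnt m W + (if A \<le> W then 1 else 0) + (if B \<le> W then 1 else 0)"
    if "A \<in> V" "B \<in> V" for A B W
    using that by (simp add: e_def cnt_add cnt_single)
  \<comment> \<open>Either the chain separates \<open>F\<close> from \<open>G\<close>, and the four
    terms cancel in pairs by \<open>admissible_shift\<close>, or it treats \<open>F\<close>,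
    \<open>G\<close> and \<open>J\<close> alike.\<close>
  consider (1) Q where "Q \<in> C" "F \<le> Q" "\<not> G \<le> Q"
    | (2) Q where "Q \<in> C" "G \<le> Q" "\<not> F \<le> Q"
    | (3) "\<And>P. P \<in> C \<Longrightarrow> F \<le> P \<longleftrightarrow> G \<le> P"
    by blast
  then show ?thesis
  proof cases
    case 1
    note sh = admissible_shift[OF C 1 V J]
    have "admissible C S (e F G) \<longleftrightarrow> admissible C S (e F J)"
         "admissible C S (e J G) \<longleftrightarrow> admissible C S (e J J)"
      unfolding e_def by (rule sh; assumption)+
    then show ?thesis by (simp add: comm[of G J])
  next
    case 2
    note sh = admissible_shift[OF C 2 V(2,1,3) J(2,1)]
    have "admissible C S (e G F) \<longleftrightarrow> admissible C S (e G J)"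
         "admissible C S (e J F) \<longleftrightarrow> admissible C S (e J J)"
      unfolding e_def by (rule sh; (use J in blast))+
    then show ?thesis by (simp add: comm[of J F] comm[of F G])
  next
    case 3
    have CL: "P \<in> L" if "P \<in> C" for P using C that by (auto simp: chain_of_def)
    have GJ: "G \<le> P \<longleftrightarrow> J \<le> P" and FJ: "F \<le> P \<longleftrightarrow> J \<le> P" if "P \<in> C" for P
      using 3[OF that] J CL[OF that] by (meson order_trans)+
    \<comment> \<open>The aim in this case: \<open>e F G\<close> is admissible exactly if both
      \<open>e F J\<close> and \<open>e G J\<close> are, and \<open>e J J\<close> exactly if at
      least one is. The identity is then the one for the indicators of a conjunction and a
      disjunction.\<close>
    have a1: "admissible C S (e A F) \<Longrightarrow> admissible C S (e A J)" for A
      unfolding e_def using V J FJ by (blast intro: admissible_mono[where G = F])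
    have a2: "admissible C S (e A G) \<Longrightarrow> admissible C S (e A J)" for A
      unfolding e_def using V J GJ by (blast intro: admissible_mono[where G = G])
    have eq: "cnt (e A B) P = S P" if "admissible C S (e J J)" "A \<in> {F,G,J}" "B \<in> {F,G,J}" "P \<in> C" for A B P
    proof -
      have "cnt (e J J) P = S P" using that by (auto simp: admissible_def)
      then show ?thesis using that V GJ[of P] FJ[of P] by (auto simp: cnt_e)
    qed
    \<comment> \<open>If both fail, there are tight flats \<open>W\<close> above \<open>F\<close>
      and \<open>W'\<close> above \<open>G\<close>, neither above \<open>J\<close>, each exceeding
      its bound only because of the single extra factor. Their join lies above \<open>J\<close> and
      so counts both factors of \<open>e J J\<close>, which compensates the two extra
      factors.\<close>
    have b: "admissible C S (e F J) \<or> admissible C S (e G J)" if JJ: "admissible C S (e J J)"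
    proof (rule ccontr)
      assume no: "\<not> ?thesis"
      have viol: "\<exists>P\<in>C. \<exists>W\<in>L. P < W \<and> A \<le> W \<and> \<not> J \<le> W \<and> cnt m W + 1 + rk P \<ge> cnt m P + rk W
            \<and> S P = cnt m P"
        if A: "A \<in> {F,G}" "\<not> admissible C S (e A J)" for A
      proof -
        have AV: "A \<in> V" using A V by auto
        obtain P W where PW: "P \<in> C" "W \<in> L" "P < W" "\<not> cnt (e A J) W + rk P < S P + rk W"
          using A eq[OF JJ, of A J] by (auto simp: admissible_def)
        have lt: "cnt (e J J) W + rk P < S P + rk W"
          using JJ PW by (auto simp: admissible_def)
        have AJ: "A \<le> W" "\<not> J \<le> W"
          using PW lt AV V J A by (auto simp: cnt_e split: if_splits)
        then have "\<not> J \<le> P" using PW by (meson less_imp_le order_trans)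
        moreover from this have "\<not> A \<le> P" using A FJ GJ PW by auto
        ultimately have "S P = cnt m P" using eq[OF JJ, of J J P] PW V by (auto simp: cnt_e)
        then show ?thesis using PW AJ AV V by (intro bexI[of _ P] bexI[of _ W]) (auto simp: cnt_e)
      qed
      obtain P W where PW: "P \<in> C" "W \<in> L" "P < W" "F \<le> W" "\<not> J \<le> W"
        "cnt m W + 1 + rk P \<ge> cnt m P + rk W" "S P = cnt m P"
        using viol[of F] no by auto
      obtain P' W' where PW': "P' \<in> C" "W' \<in> L" "P' < W'" "G \<le> W'" "\<not> J \<le> W'"
        "cnt m W' + 1 + rk P' \<ge> cnt m P' + rk W'" "S P' = cnt m P'"
        using viol[of G] no by auto
      obtain J' M' where J'M': "J' \<in> L" "M' \<in> L" "W \<le> J'" "W' \<le> J'"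
        "M' \<le> W" "M' \<le> W'" "\<And>H. H \<in> L \<Longrightarrow> H \<le> W \<Longrightarrow> H \<le> W' \<Longrightarrow> H \<le> M'"
        "rk J' + rk M' \<le> rk W + rk W'"
        using obtain_join_meet[OF PW(2) PW'(2)] by metis
      have JJ': "J \<le> J'" using J J'M' PW PW' by (meson order_trans)
      have sup: "cnt m W + cnt m W' \<le> cnt m J' + cnt m M'"
        by (rule cnt_supermodular) (use J'M' in auto)
      have low: "cnt m M' + rk R \<le> cnt m R + rk M'"
        if R: "R \<in> C" "R \<le> W" "R \<le> W'" "S R = cnt m R" for R
      proof -
        have "R \<le> M'" using R J'M' CL by auto
        then have "R < M' \<or> R = M'" by (auto simp: order_less_le)
        moreover have "cnt m M' \<le> cnt (e J J) M'" using V by (simp add: cnt_e)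
        ultimately show ?thesis using JJ R J'M' by (force simp: admissible_def)
      qed
      have high: "cnt m J' + 2 + rk R < cnt m R + rk J'"
        if R: "R \<in> C" "R < J'" "S R = cnt m R" for R
      proof -
        have "cnt (e J J) J' + rk R < S R + rk J'"
          using JJ R J'M'(1) unfolding admissible_def by blast
        then show ?thesis using R JJ' V by (simp add: cnt_e)
      qed
      \<comment> \<open>The smaller of the two chain elements lies below both \<open>W\<close> and
        \<open>W'\<close> and bounds the meet; the larger one bounds the join.\<close>
      have "P \<le> P' \<or> P' \<le> P" using C PW PW' by (auto simp: chain_of_def)
      then show False
      proof
        assume "P \<le> P'"
        then have "P \<le> W'" "P < J'" "P' < J'" using PW PW' J'M' by (auto dest: order.strict_trans2)
        then show False
          using low[of P] high[of P'] PW PW' sup J'M'(8) by (simp add: less_imp_le)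
      next
        assume "P' \<le> P"
        then have "P' \<le> W" "P < J'" "P' < J'" using PW PW' J'M' by (auto dest: order.strict_trans2)
        then show False
          using low[of P'] high[of P] PW PW' sup J'M'(8) by (simp add: less_imp_le)
      qed
    qed
    \<comment> \<open>At every \<open>W\<close> the count of \<open>e F G\<close> agrees with that
      of one of \<open>e F J\<close>, \<open>e G J\<close>, \<open>e J J\<close>, depending on which
      of \<open>F\<close> and \<open>G\<close> lie below \<open>W\<close>.\<close>
    have c: "admissible C S (e F G)" if ad: "admissible C S (e F J)" "admissible C S (e G J)"
    proof -
      have JJ: "admissible C S (e J J)" using a1[of J] ad comm by metis
      have "cnt (e F G) W + rk P < S P + rk W" if PW: "P \<in> C" "W \<in> L" "P < W" for P W
      proof -
        have "cnt (e A J) W + rk P < S P + rk W" if "A \<in> {F,G,J}" for A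
          using that ad JJ PW by (auto simp: admissible_def)
        from this[of F] this[of G] this[of J] show ?thesis
          using V J PW by (cases "F \<le> W"; cases "G \<le> W") (auto simp: cnt_e split: if_splits)
      qed
      then show ?thesis using eq[OF JJ, of F G] by (auto simp: admissible_def)
    qed
    have "e G F = e F G" "e J F = e F J" "e J G = e G J" by (rule comm)+
    then have "admissible C S (e F G) \<Longrightarrow> admissible C S (e F J)"
      "admissible C S (e F G) \<Longrightarrow> admissible C S (e G J)"
      "admissible C S (e F J) \<Longrightarrow> admissible C S (e J J)"
      "admissible C S (e G J) \<Longrightarrow> admissible C S (e J J)"
      using a1[of G] a2[of F] a1[of J] a2[of J] by simp_all
    with b c show ?thesis
      by (cases "admissible C S (e F J)"; cases "admissible C S (e G J)") auto
  qed
qed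

end

section \<open>Linear independence\<close>

lemma obtain_maximizer:
  fixes f :: "'s \<Rightarrow> nat"
  assumes "finite N" "N \<noteq> {}"
  obtains x where "x \<in> N" "\<And>y. y \<in> N \<Longrightarrow> f y \<le> f x"
proof -
  have "Max (f ` N) \<in> f ` N" using assms by simp
  then obtain x where "x \<in> N" "f x = Max (f ` N)" by auto
  then show thesis using that[of x] assms by simp
qed

context geometric_lattice
begin

definition hpol :: "'b \<Rightarrow> 'b zpoly" where
  "hpol F = (\<Sum>G\<in>{G\<in>L. F \<le> G}. pvar G)"

text \<open>Feichtner--Yuzvinsky exponents; along a chain the condition for all \<open>G < F\<close> is equivalent to
  the one for the predecessor of \<open>F\<close>.\<close>
definition fy :: "('b \<Rightarrow>\<^sub>0 nat) set" where
  "fy = {m. Poly_Mapping.keys m \<subseteq> V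
      \<and> (\<forall>F\<in>Poly_Mapping.keys m. \<forall>G\<in>Poly_Mapping.keys m. F \<le> G \<or> G \<le> F)
      \<and> (\<forall>F\<in>Poly_Mapping.keys m. \<forall>G\<in>insert b0 (Poly_Mapping.keys m).
            G < F \<longrightarrow> rk G + Poly_Mapping.lookup m F < rk F)}"

lemma fy_chain: "m \<in> fy \<Longrightarrow> chain_of (insert b0 (Poly_Mapping.keys m))"
  using bot_in bot_le by (auto simp: fy_def chain_of_def)

lemma chain_of_max:
  assumes "chain_of C" "finite C" "P \<in> C" "Q P"
  obtains F where "F \<in> C" "Q F" "\<And>G. G \<in> C \<Longrightarrow> Q G \<Longrightarrow> G \<le> F"
proof -
  have "finite {F\<in>C. Q F}" "{F\<in>C. Q F} \<noteq> {}" using assms by auto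
  then obtain F where F: "F \<in> {F\<in>C. Q F}" "\<And>G. G \<in> {F\<in>C. Q F} \<Longrightarrow> F \<le> G \<Longrightarrow> F = G"
    using finite_has_maximal[of "{F\<in>C. Q F}"] by blast
  have "G \<le> F" if "G \<in> C" "Q G" for G
  proof -
    have "F \<le> G \<or> G \<le> F" using assms(1) F(1) that by (auto simp: chain_of_def)
    then show ?thesis using F(2)[of G] that by blast
  qed
  then show thesis using that[of F] F(1) by blast
qed

text \<open>The largest ideal inside the kernel of the functional. Being an ideal, it only has to be
  tested on the generators of the Chow ideal.\<close>

definition annihilator :: "(('b \<Rightarrow>\<^sub>0 nat) \<Rightarrow> int) \<Rightarrow> 'b zpoly set" where
  "annihilator w = {z. \<forall>p. lin_ext w (p * z) = 0}"

lemma annihilator_diff: "y \<in> annihilator w \<Longrightarrow> z \<in> annihilator w \<Longrightarrow> y - z \<in> annihilator w"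
  by (simp add: annihilator_def ring_distribs lin_ext_diff)

lemma annihilator_sum: "(\<And>i. i \<in> A \<Longrightarrow> f i \<in> annihilator w) \<Longrightarrow> (\<Sum>i\<in>A. f i) \<in> annihilator w"
  by (simp add: annihilator_def sum_distrib_left lin_ext_sum)

text \<open>In this lemma and in \<open>annihilator_quadratic\<close> the variable
  \<open>pvar F\<close> plays the role of the element h_F, not of x_F.\<close>

lemma annihilator_atom:
  assumes "b0 \<in> C" "a \<in> atoms L b0"
  shows "pvar a \<in> annihilator (\<lambda>m. of_bool (admissible C S m))"
  using not_admissible_atom[OF assms]
  unfolding annihilator_def mem_Collect_eq pvar_def lin_ext_mult_single
  by (simp add: lin_ext_def)

lemma annihilator_quadratic:
  assumes C: "chain_of C"
    and V: "F \<in> V" "G \<in> V" "J \<in> V"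
    and J: "F \<le> J" "G \<le> J" "\<And>H. H \<in> L \<Longrightarrow> F \<le> H \<Longrightarrow> G \<le> H \<Longrightarrow> J \<le> H"
  shows "(pvar F - pvar J) * (pvar G - pvar J) \<in> annihilator (\<lambda>m. of_bool (admissible C S m))"
proof -
  let ?w = "\<lambda>m. of_bool (admissible C S m) :: int"
  have pp: "pvar A * pvar B = Poly_Mapping.single (Poly_Mapping.single A 1 + Poly_Mapping.single B 1) 1"
    for A B :: 'b by (simp add: pvar_def mult_single)
  have "lin_ext ?w (p * ((pvar F - pvar J) * (pvar G - pvar J))) = 0" for p
  proof -
    have "p * ((pvar F - pvar J) * (pvar G - pvar J))
        = p * (pvar F * pvar G) - p * (pvar F * pvar J) - p * (pvar G * pvar J) + p * (pvar J * pvar J)"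
      by (simp add: algebra_simps)
    then have "lin_ext ?w (p * ((pvar F - pvar J) * (pvar G - pvar J)))
       = lin_ext ?w (p * (pvar F * pvar G)) - lin_ext ?w (p * (pvar F * pvar J))
         - lin_ext ?w (p * (pvar G * pvar J)) + lin_ext ?w (p * (pvar J * pvar J))"
      by (simp only: lin_ext_add lin_ext_diff)
    also have "\<dots> = (\<Sum>m\<in>Poly_Mapping.keys p. of_int (Poly_Mapping.lookup p m) *
        (?w (m + Poly_Mapping.single F 1 + Poly_Mapping.single G 1)
         - ?w (m + Poly_Mapping.single F 1 + Poly_Mapping.single J 1)
         - ?w (m + Poly_Mapping.single G 1 + Poly_Mapping.single J 1)
         + ?w (m + Poly_Mapping.single J 1 + Poly_Mapping.single J 1)))"
      unfolding pp lin_ext_mult_single add.assoc unfolding lin_ext_def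
      by (simp add: sum_subtractf sum.distrib algebra_simps)
    also have "\<dots> = 0"
    proof (rule sum.neutral, rule ballI)
      fix m
      show "of_int (Poly_Mapping.lookup p m) *
        (?w (m + Poly_Mapping.single F 1 + Poly_Mapping.single G 1)
         - ?w (m + Poly_Mapping.single F 1 + Poly_Mapping.single J 1)
         - ?w (m + Poly_Mapping.single G 1 + Poly_Mapping.single J 1)
         + ?w (m + Poly_Mapping.single J 1 + Poly_Mapping.single J 1)) = 0"
        using admissible_quadratic[OF C V J, of S m] by simp
    qed
    finally show ?thesis .
  qed
  then show ?thesis by (simp add: annihilator_def)
qed

text \<open>Substituting \<open>X\<close> for the variables sends \<open>h\<^sub>F\<close> to the variable of \<open>F\<close>, so that functionals can be
  prescribed on monomials in the \<open>h\<^sub>F\<close>.\<close>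
context
  fixes X :: "'b \<Rightarrow> 'b zpoly"
  assumes X: "F \<in> V \<Longrightarrow> (\<Sum>G\<in>{G\<in>V. F \<le> G}. X G) = pvar F"
begin

lemma psubst_hpol: "F \<in> V \<Longrightarrow> psubst X (hpol F) = pvar F"
proof -
  assume F: "F \<in> V"
  then have "{G\<in>L. F \<le> G} = {G\<in>V. F \<le> G}" using upper_in_V by blast
  then show ?thesis using X[OF F] by (simp add: hpol_def psubst_sum)
qed

text \<open>With \<open>J\<close> the join, h_F - h_J is the sum of x_H over \<open>H\<close> above
  \<open>F\<close> but not above \<open>G\<close>, and likewise for \<open>G\<close>. All pairs
  \<open>H\<close>, \<open>K\<close> in the product are again incomparable, since
  \<open>H <= K\<close> would put \<open>K\<close> above \<open>F\<close>. Only the pair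
  \<open>F\<close>, \<open>G\<close> itself has minimal total rank, so the remaining terms are
  covered by descending induction on \<open>rk F + rk G\<close>.\<close>

lemma annihilator_incomparable:
  assumes C: "chain_of C" and "F \<in> V" "G \<in> V" "\<not> F \<le> G" "\<not> G \<le> F"
  shows "X F * X G \<in> annihilator (\<lambda>m. of_bool (admissible C S m))"
proof -
  let ?K = "annihilator (\<lambda>m. of_bool (admissible C S m))"
  \<comment> \<open>An upper bound for all ranks, so that the truncated difference
    \<open>2 * B - (rk F + rk G)\<close> really drops when the total rank grows.\<close>
  define B where "B = Max (rk ` L)"
  have rkB: "rk F \<le> B" if "F \<in> L" for F using that finite_L by (simp add: B_def)
  show ?thesis using assms(2-)
  proof (induction "2 * B - (rk F + rk G)" arbitrary: F G rule: less_induct)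
    case less
    obtain J where J: "J \<in> L" "F \<le> J" "G \<le> J" "\<And>H. H \<in> L \<Longrightarrow> F \<le> H \<Longrightarrow> G \<le> H \<Longrightarrow> J \<le> H"
      using obtain_join_meet[of F G] less.prems by (metis DiffE)
    have JV: "J \<in> V" using upper_in_V less.prems J by blast
    have diff: "pvar F - pvar J = (\<Sum>H\<in>{H\<in>V. F \<le> H \<and> \<not> G \<le> H}. X H)"
      if "F \<in> V" "F \<le> J" "\<And>H. H \<in> L \<Longrightarrow> F \<le> H \<Longrightarrow> G \<le> H \<Longrightarrow> J \<le> H" "G \<le> J" for F G
    proof -
      have "{H\<in>V. F \<le> H} - {H\<in>V. J \<le> H} = {H\<in>V. F \<le> H \<and> \<not> G \<le> H}"
        using that by (auto intro: order_trans)
      moreover have "{H\<in>V. J \<le> H} \<subseteq> {H\<in>V. F \<le> H}" using that by (auto intro: order_trans)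
      ultimately show ?thesis
        using sum_diff[of "{H\<in>V. F \<le> H}" "{H\<in>V. J \<le> H}" X] finite_V X that JV by simp
    qed
    let ?A = "{H\<in>V. F \<le> H \<and> \<not> G \<le> H}" and ?B = "{H\<in>V. G \<le> H \<and> \<not> F \<le> H}"
    have "(\<Sum>(H,K)\<in>?A\<times>?B. X H * X K) = (pvar F - pvar J) * (pvar G - pvar J)"
      using diff[of F G] diff[of G F] less.prems J
      by (simp add: sum_product sum.cartesian_product)
    also have "\<dots> \<in> ?K" using annihilator_quadratic[OF C] less.prems JV J by blast
    finally have all: "(\<Sum>(H,K)\<in>?A\<times>?B. X H * X K) \<in> ?K" .
    have FG: "(F, G) \<in> ?A \<times> ?B" using less.prems by auto
    have "(\<Sum>(H,K)\<in>?A\<times>?B - {(F,G)}. X H * X K) \<in> ?K"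
    proof (rule annihilator_sum)
      fix i assume i: "i \<in> ?A\<times>?B - {(F,G)}"
      obtain H K where HK: "i = (H, K)" by fastforce
      have HK': "H \<in> V" "K \<in> V" "F \<le> H" "\<not> G \<le> H" "G \<le> K" "\<not> F \<le> K" "F < H \<or> G < K"
        using i HK by (auto simp: order_less_le)
      have "rk F \<le> rk H" "rk G \<le> rk K"
        using rk_less HK' less.prems by (auto simp: order_le_less)
      moreover have "rk F < rk H \<or> rk G < rk K" using rk_less HK' less.prems by blast
      ultimately have "2 * B - (rk H + rk K) < 2 * B - (rk F + rk G)"
        using rkB[of H] rkB[of K] HK' by auto
      moreover have "\<not> H \<le> K" "\<not> K \<le> H" using HK' by (meson order_trans)+
      ultimately show "(case i of (H, K) \<Rightarrow> X H * X K) \<in> ?K"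
        using less.hyps[of H K] HK HK' by simp
    qed
    from annihilator_diff[OF all this] show ?case
      using FG finite_V by (simp add: sum.remove[of _ "(F,G)"])
  qed
qed

lemma chow_ideal_functional:
  assumes C: "chain_of C" "b0 \<in> C" and z: "z \<in> chow_ideal L b0"
  shows "lin_ext (\<lambda>m. of_bool (admissible C S m) :: int) (psubst X z) = 0"
  using z unfolding chow_ideal_def
proof induction
  case zero
  then show ?case by (simp add: psubst_def)
next
  case (gen g p)
  have "psubst X g \<in> annihilator (\<lambda>m. of_bool (admissible C S m))"
    using gen(1)
  proof
    assume "g \<in> {pvar F * pvar G | F G. F \<in> V \<and> G \<in> V \<and> \<not> F \<le> G \<and> \<not> G \<le> F}"
    then show ?thesis using annihilator_incomparable[OF C(1)] by (auto simp: psubst_mult)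
  next
    assume "g \<in> {\<Sum>F\<in>{F\<in>L. a \<le> F}. pvar F | a. a \<in> atoms L b0}"
    then obtain a where "a \<in> atoms L b0" "g = hpol a" by (auto simp: hpol_def)
    then show ?thesis using annihilator_atom[OF C(2)] atom_in_V by (simp add: psubst_hpol)
  qed
  then show ?case by (simp add: psubst_mult annihilator_def)
next
  case (add a b)
  then show ?case by (simp add: psubst_def lin_ext_add)
qed

end

section \<open>Unitriangularity of the functionals on \<open>h\<close>-monomials\<close>

lemma cnt_eq_max:
  assumes "F \<le> W" "\<And>G. G \<in> Poly_Mapping.keys m \<Longrightarrow> G \<le> W \<Longrightarrow> G \<le> F"
  shows "cnt m W = cnt m F"
  unfolding cnt_def
  by (rule sum.mono_neutral_right)
     (use finite_V assms in \<open>auto intro: order_trans simp: in_keys_iff\<close>)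

lemma cnt_key:
  assumes "F \<in> V" "G < F" "\<And>H. H \<in> Poly_Mapping.keys m \<Longrightarrow> H < F \<Longrightarrow> H \<le> G"
  shows "cnt m F = Poly_Mapping.lookup m F + cnt m G"
proof -
  have "cnt m F = Poly_Mapping.lookup m F + (\<Sum>H\<in>{H\<in>V. H \<le> F} - {F}. Poly_Mapping.lookup m H)"
    unfolding cnt_def using finite_V assms by (intro sum.remove) auto
  also have "(\<Sum>H\<in>{H\<in>V. H \<le> F} - {F}. Poly_Mapping.lookup m H) = cnt m G"
    unfolding cnt_def
  proof (rule sum.mono_neutral_right)
    show "{H\<in>V. H \<le> G} \<subseteq> {H\<in>V. H \<le> F} - {F}" using assms(2) by auto
    show "\<forall>H\<in>{H\<in>V. H \<le> F} - {F} - {H\<in>V. H \<le> G}. Poly_Mapping.lookup m H = 0"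
    proof
      fix H assume "H \<in> {H\<in>V. H \<le> F} - {F} - {H\<in>V. H \<le> G}"
      then have "H < F" "\<not> H \<le> G" by (auto simp: order_less_le)
      then have "H \<notin> Poly_Mapping.keys m" using assms(3) by blast
      then show "Poly_Mapping.lookup m H = 0" by (simp add: in_keys_iff)
    qed
  qed (use finite_V in auto)
  finally show ?thesis .
qed

text \<open>The value of \<open>cnt m\<close> at \<open>W\<close> is its value at the largest chain
  element \<open>F <= W\<close>. Descending from \<open>F\<close> to its predecessor costs an
  exponent smaller than the rank jump, so the strict inequality propagates by induction on
  \<open>rk W\<close>; if \<open>F = P\<close>, it is just \<open>rk P < rk W\<close>.\<close>

lemma admissible_self:
  assumes m: "m \<in> fy"
  shows "admissible (insert b0 (Poly_Mapping.keys m)) (cnt m) m"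
proof -
  let ?C = "insert b0 (Poly_Mapping.keys m)"
  have fC: "finite ?C" by simp
  have CL: "F \<in> L" if "F \<in> ?C" for F using fy_chain[OF m] that by (auto simp: chain_of_def)
  have "cnt m W + rk P < cnt m P + rk W" if "P \<in> ?C" "W \<in> L" "P < W" for P W
    using that
  proof (induction "rk W" arbitrary: W rule: less_induct)
    case less
    obtain F where F: "F \<in> ?C" "F \<le> W" "\<And>G. G \<in> ?C \<Longrightarrow> G \<le> W \<Longrightarrow> G \<le> F"
      using chain_of_max[OF fy_chain[OF m] fC less.prems(1), of "\<lambda>G. G \<le> W"] less.prems(3)
      less_imp_le by blast
    have cW: "cnt m W = cnt m F" by (rule cnt_eq_max) (use F in auto)
    have PF: "P \<le> F" using F less.prems by (auto simp: less_imp_le)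
    have rkFW: "rk F \<le> rk W" using F CL rk_less less.prems by (auto simp: order_le_less)
    show ?case
    proof (cases "F = P")
      case True
      then show ?thesis using cW rk_less CL less.prems by simp
    next
      case False
      then have PF: "P < F" using PF by simp
      then have "F \<noteq> b0" using bot_le[OF CL[OF less.prems(1)]] by (auto simp: less_le_not_le)
      then have Fk: "F \<in> Poly_Mapping.keys m" using F by simp
      then have FV: "F \<in> V" using m by (auto simp: fy_def)
      obtain G where G: "G \<in> ?C" "G < F" "\<And>H. H \<in> ?C \<Longrightarrow> H < F \<Longrightarrow> H \<le> G"
        using chain_of_max[OF fy_chain[OF m] fC less.prems(1), of "\<lambda>G. G < F"] PF by blast
      have cF: "cnt m F = Poly_Mapping.lookup m F + cnt m G"
        by (rule cnt_key) (use FV G in auto)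
      have lk: "rk G + Poly_Mapping.lookup m F < rk F" using m Fk G by (auto simp: fy_def)
      have "P \<le> G" using G PF less.prems by auto
      then have "cnt m G + rk P \<le> cnt m P + rk G"
      proof (cases "P = G")
        case False
        then have "P < G" using \<open>P \<le> G\<close> by simp
        moreover have "rk G < rk W" using lk rkFW by simp
        ultimately show ?thesis using less.hyps[of G] less.prems CL G by (auto simp: less_imp_le)
      qed simp
      then show ?thesis using cW cF lk rkFW by simp
    qed
  qed
  then show ?thesis by (simp add: admissible_def)
qed

text \<open>This is the triangularity. \<open>cnt m\<close> is determined everywhere by its values
  on its own chain, where \<open>m'\<close> has the same counts, and between chain elements
  \<open>cnt m'\<close> can only grow.\<close>

lemma admissible_imp_cnt_le:
  assumes m: "m \<in> fy" and ad: "admissible (insert b0 (Poly_Mapping.keys m)) (cnt m) m'" and W: "W \<in> L"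
  shows "cnt m W \<le> cnt m' W"
proof -
  let ?C = "insert b0 (Poly_Mapping.keys m)"
  have fC: "finite ?C" by simp
  obtain F where F: "F \<in> ?C" "F \<le> W" "\<And>G. G \<in> ?C \<Longrightarrow> G \<le> W \<Longrightarrow> G \<le> F"
    using chain_of_max[where P = b0, OF fy_chain[OF m] fC, of "\<lambda>G. G \<le> W"] bot_le[OF W] by blast
  have "cnt m W = cnt m F" by (rule cnt_eq_max) (use F in auto)
  also have "\<dots> = cnt m' F" using ad F by (auto simp: admissible_def)
  also have "\<dots> \<le> cnt m' W" using F by (intro cnt_mono) auto
  finally show ?thesis .
qed

text \<open>At a minimal flat where the exponents differ, all smaller exponents cancel and the
  counts differ too.\<close>

lemma cnt_inject:
  assumes "Poly_Mapping.keys m \<subseteq> V" "Poly_Mapping.keys m' \<subseteq> V" "\<And>W. W \<in> L \<Longrightarrow> cnt m W = cnt m' W"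
  shows "m = m'"
proof (rule ccontr)
  assume "m \<noteq> m'"
  then obtain k where k: "Poly_Mapping.lookup m k \<noteq> Poly_Mapping.lookup m' k"
    using poly_mapping_eqI[of m m'] by auto
  let ?D = "{G\<in>V. Poly_Mapping.lookup m G \<noteq> Poly_Mapping.lookup m' G}"
  have "k \<in> Poly_Mapping.keys m \<union> Poly_Mapping.keys m'" using k by (auto simp: in_keys_iff)
  then have "k \<in> V" using assms(1,2) by blast
  then have "?D \<noteq> {}" "finite ?D" using k finite_V by auto
  then obtain F where F: "F \<in> ?D" "\<And>G. G \<in> ?D \<Longrightarrow> G \<le> F \<Longrightarrow> F = G"
    using finite_has_minimal[of ?D] by blast
  have split: "cnt m F = Poly_Mapping.lookup m F + (\<Sum>H\<in>{H\<in>V. H \<le> F} - {F}. Poly_Mapping.lookup m H)" for m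
    unfolding cnt_def using finite_V F by (intro sum.remove) auto
  have "(\<Sum>H\<in>{H\<in>V. H \<le> F} - {F}. Poly_Mapping.lookup m H) = (\<Sum>H\<in>{H\<in>V. H \<le> F} - {F}. Poly_Mapping.lookup m' H)"
    by (rule sum.cong) (use F in auto)
  then show False using split[of m] split[of m'] assms(3)[of F] F by simp
qed

text \<open>Among the exponent vectors with nonzero coefficient choose one, \<open>x\<close>, whose
  total count is maximal. The functional attached to \<open>x\<close> is 1 on \<open>x\<close>; any
  other vector on which it is nonzero would dominate \<open>x\<close> in every count, hence have the
  same counts and be equal to \<open>x\<close>. So the functional reads off the coefficient of
  \<open>x\<close> itself.\<close>

lemma fy_independent:
  assumes M: "finite M" "M \<subseteq> fy"
    and mem: "(\<Sum>m\<in>M. of_int (c m) * pmono hpol m) \<in> chow_ideal L b0"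
    and "m \<in> M"
  shows "c m = 0"
proof (rule ccontr)
  assume "c m \<noteq> 0"
  let ?N = "{m\<in>M. c m \<noteq> 0}" and ?f = "\<lambda>m. \<Sum>W\<in>L. cnt m W"
  have "finite ?N" "?N \<noteq> {}" using M \<open>c m \<noteq> 0\<close> \<open>m \<in> M\<close> by auto
  then obtain x where x: "x \<in> ?N" "\<And>y. y \<in> ?N \<Longrightarrow> ?f y \<le> ?f x"
    using obtain_maximizer[of ?N ?f] by blast
  let ?C = "insert b0 (Poly_Mapping.keys x)"
  let ?w = "\<lambda>m. of_bool (admissible ?C (cnt x) m) :: int"
  have xfy: "x \<in> fy" using x M by auto
  \<comment> \<open>The \<open>x\<close>-variables expressed through the \<open>h\<close>-variables:
    substituting \<open>X\<close> turns the \<open>h\<close>-monomial of \<open>y\<close> into the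
    bare monomial \<open>y\<close>.\<close>
  obtain X :: "'b \<Rightarrow> 'b zpoly" where X: "\<And>F. F \<in> V \<Longrightarrow> (\<Sum>G\<in>{G\<in>V. F \<le> G}. X G) = pvar F"
    using ex_upper_sum_inverse[OF finite_V, of pvar] by blast
  have sub: "psubst X (of_int (c y) * pmono hpol y) = of_int (c y) * Poly_Mapping.single y 1"
    if "y \<in> M" for y
  proof -
    have "Poly_Mapping.keys y \<subseteq> V" using that M by (auto simp: fy_def)
    then have "psubst X (hpol v) = pvar v" if "v \<in> Poly_Mapping.keys y" for v
      using psubst_hpol[OF X, of v] that by blast
    then have "pmono (\<lambda>v. psubst X (hpol v)) y = pmono pvar y"
      by (simp add: pmono_def)
    then show ?thesis
      unfolding psubst_def lin_ext_of_int_mult by (simp add: psubst_pmono pmono_pvar flip: psubst_def)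
  qed
  have zero: "?w y = 0" if "y \<in> ?N" "y \<noteq> x" for y
  proof (rule ccontr)
    assume "?w y \<noteq> 0"
    then have ad: "admissible ?C (cnt x) y" by simp
    have le: "cnt x W \<le> cnt y W" if "W \<in> L" for W
      using admissible_imp_cnt_le[OF xfy ad that] .
    have "?f y \<le> ?f x" using x that by blast
    then have "cnt x W = cnt y W" if "W \<in> L" for W
      using le sum_strict_mono_ex1[of L "cnt x" "cnt y"] finite_L that by (meson leD le_neq_implies_less)
    then have "x = y" using cnt_inject[of x y] xfy that M by (auto simp: fy_def)
    then show False using that by simp
  qed
  have "0 = lin_ext ?w (psubst X (\<Sum>m\<in>M. of_int (c m) * pmono hpol m))"
    using chow_ideal_functional[OF X fy_chain[OF xfy] _ mem] by simp
  also have "\<dots> = lin_ext ?w (\<Sum>y\<in>M. of_int (c y) * Poly_Mapping.single y 1)"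
    by (simp add: psubst_sum sub cong: sum.cong)
  also have "\<dots> = (\<Sum>y\<in>M. c y * ?w y)"
    by (simp add: lin_ext_sum lin_ext_of_int_mult lin_ext_single)
  also have "\<dots> = (\<Sum>y\<in>{x}. c y * ?w y)"
    by (rule sum.mono_neutral_right) (use M x zero in auto)
  also have "\<dots> = c x" using admissible_self[OF xfy] by simp
  finally show False using x by simp
qed

end

section \<open>Spanning and the Hilbert series\<close>

lemma monomial_split_le:
  fixes m :: "'b \<Rightarrow>\<^sub>0 nat"
  assumes "\<And>v. Poly_Mapping.lookup m' v \<le> Poly_Mapping.lookup m v"
  shows "m = m' + (m - m')"
  by (rule poly_mapping_eqI) (use assms in \<open>simp add: lookup_add lookup_minus\<close>)

lemma keys_minus_subset: "Poly_Mapping.keys (m - m') \<subseteq> Poly_Mapping.keys m"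
  for m :: "'b \<Rightarrow>\<^sub>0 nat"
  by (auto simp: in_keys_iff lookup_minus)

context geometric_lattice
begin

section \<open>Relations in the Chow ring\<close>

lemma chow_ideal_mult: "p \<in> polys_in V \<Longrightarrow> z \<in> chow_ideal L b0 \<Longrightarrow> p * z \<in> chow_ideal L b0"
  unfolding chow_ideal_def by (rule ideal_gen_mult) (auto intro: polys_in_mult)

lemma chow_ideal_add:
  "y \<in> chow_ideal L b0 \<Longrightarrow> z \<in> chow_ideal L b0 \<Longrightarrow> y + z \<in> chow_ideal L b0"
  unfolding chow_ideal_def by (rule ideal_gen.add)

lemma chow_ideal_zero: "0 \<in> chow_ideal L b0"
  unfolding chow_ideal_def by (rule ideal_gen.zero)

lemma chow_ideal_diff:
  "y \<in> chow_ideal L b0 \<Longrightarrow> z \<in> chow_ideal L b0 \<Longrightarrow> y - z \<in> chow_ideal L b0"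
  using chow_ideal_add[of y "-1 * z"] chow_ideal_mult[of "-1" z] polys_in_uminus[of 1 V] by simp

lemma chow_ideal_sum:
  "(\<And>i. i \<in> A \<Longrightarrow> f i \<in> chow_ideal L b0) \<Longrightarrow> (\<Sum>i\<in>A. f i) \<in> chow_ideal L b0"
  unfolding chow_ideal_def by (rule ideal_gen_sum)

lemma chow_ideal_incomparable:
  assumes "F \<in> V" "G \<in> V" "\<not> F \<le> G" "\<not> G \<le> F"
  shows "pvar F * pvar G \<in> chow_ideal L b0"
proof -
  have "1 * (pvar F * pvar G) \<in> chow_ideal L b0"
    unfolding chow_ideal_def by (rule ideal_gen.gen) (use assms in auto)
  then show ?thesis by simp
qed

lemma chow_ideal_atom:
  assumes "a \<in> atoms L b0"
  shows "hpol a \<in> chow_ideal L b0"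
proof -
  have "1 * hpol a \<in> chow_ideal L b0"
    unfolding chow_ideal_def hpol_def by (rule ideal_gen.gen) (use assms in auto)
  then show ?thesis by simp
qed

text \<open>The value 1 at the bottom lets the power relation for h_G alone be the case
  \<open>F = b0\<close> of the general one.\<close>

definition xvar :: "'b \<Rightarrow> 'b zpoly" where
  "xvar F = (if F = b0 then 1 else pvar F)"

lemma polys_in_xvar: "F \<in> L \<Longrightarrow> xvar F \<in> polys_in V"
  by (auto simp: xvar_def intro: polys_in_pvar)

lemma polys_in_hpol: "F \<in> V \<Longrightarrow> hpol F \<in> polys_in V"
  unfolding hpol_def by (rule polys_in_sum, rule polys_in_pvar) (use upper_in_V in blast)

lemma hpol_split:
  assumes "F \<le> G"
  shows "hpol F = hpol G + (\<Sum>H\<in>{H\<in>L. F \<le> H \<and> \<not> G \<le> H}. pvar H)"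
proof -
  have "{H\<in>L. F \<le> H} = {H\<in>L. G \<le> H} \<union> {H\<in>L. F \<le> H \<and> \<not> G \<le> H}"
    using assms by (auto intro: order_trans)
  then show ?thesis
    unfolding hpol_def using finite_L by (simp add: sum.union_disjoint[symmetric] disjoint_iff)
qed

text \<open>Multiplication by x_H kills every flat incomparable to \<open>H\<close>. A flat above
  \<open>G\<close> cannot lie below \<open>H\<close>, so those that survive lie above both
  \<open>G\<close> and \<open>H\<close>, hence above the join.\<close>

lemma pvar_hpol_join:
  assumes V: "H \<in> V" "G \<in> V" "\<not> G \<le> H"
    and J: "G \<le> J" "J \<in> L" "\<And>K. K \<in> L \<Longrightarrow> G \<le> K \<Longrightarrow> H \<le> K \<Longrightarrow> J \<le> K"
  shows "pvar H * hpol G - pvar H * hpol J \<in> chow_ideal L b0"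
proof -
  have "pvar H * hpol G - pvar H * hpol J = (\<Sum>K\<in>{K\<in>L. G \<le> K \<and> \<not> J \<le> K}. pvar H * pvar K)"
    by (simp add: hpol_split[OF J(1)] algebra_simps sum_distrib_left)
  also have "\<dots> \<in> chow_ideal L b0"
  proof (rule chow_ideal_sum)
    fix K assume K: "K \<in> {K\<in>L. G \<le> K \<and> \<not> J \<le> K}"
    then have "\<not> H \<le> K" using J by blast
    moreover have "\<not> K \<le> H" using K V by (blast intro: order_trans)
    moreover have "K \<in> V" using K V upper_in_V by blast
    ultimately show "pvar H * pvar K \<in> chow_ideal L b0"
      using V by (intro chow_ideal_incomparable) auto
  qed
  finally show ?thesis .
qed

lemma pvar_hpol_join_power:
  assumes V: "H \<in> V" "G \<in> V" "\<not> G \<le> H"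
    and J: "G \<le> J" "J \<in> L" "\<And>K. K \<in> L \<Longrightarrow> G \<le> K \<Longrightarrow> H \<le> K \<Longrightarrow> J \<le> K"
  shows "pvar H * hpol G ^ k - pvar H * hpol J ^ k \<in> chow_ideal L b0"
proof (induction k)
  case 0
  then show ?case by (simp add: chow_ideal_zero)
next
  case (Suc k)
  have JV: "J \<in> V" using upper_in_V J V by blast
  have "hpol G * (pvar H * hpol G ^ k - pvar H * hpol J ^ k)
      + hpol J ^ k * (pvar H * hpol G - pvar H * hpol J) \<in> chow_ideal L b0"
    using Suc pvar_hpol_join[OF assms] V JV
    by (intro chow_ideal_add chow_ideal_mult polys_in_power polys_in_hpol) auto
  then show ?case by (simp add: algebra_simps)
qed

text \<open>Take an atom \<open>a\<close> below \<open>G\<close> but not below \<open>F\<close>, and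
  multiply x_F h_G^(k-1) by h_a, which lies in the ideal. Since h_a is h_G plus the x_H with
  \<open>H\<close> above \<open>a\<close> but not above \<open>G\<close>, it remains to kill each
  x_F x_H h_G^(k-1). Either \<open>F\<close> and \<open>H\<close> are incomparable, or h_G may be
  replaced next to x_H by h_J with \<open>J\<close> the join of \<open>G\<close> and
  \<open>H\<close>, where the rank gap is smaller and induction applies.\<close>

lemma xvar_hpol_power:
  assumes "F \<in> L" "G \<in> L" "F < G" "rk G - rk F \<le> k"
  shows "xvar F * hpol G ^ k \<in> chow_ideal L b0"
  using assms
proof (induction "rk G - rk F" arbitrary: F G k rule: less_induct)
  case less
  obtain a where a: "a \<in> atoms L b0" "a \<le> G" "\<not> a \<le> F"
    using atom_below less.prems by blast
  have aV: "a \<in> V" using atom_in_V a by blast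
  have GV: "G \<in> V" using upper_in_V[OF aV] a less.prems by blast
  have "rk F < rk G" using rk_less less.prems by blast
  then obtain k' where k: "k = Suc k'" using less.prems by (cases k) auto
  have each: "xvar F * pvar H * hpol G ^ k' \<in> chow_ideal L b0"
    if H: "H \<in> L" "a \<le> H" "\<not> G \<le> H" for H
  proof -
    have HV: "H \<in> V" using upper_in_V aV H by blast
    show ?thesis
    proof (cases "F \<le> H")
      case False
      then have "F \<noteq> b0" using bot_le H by auto
      moreover have "\<not> H \<le> F" using H a by (blast intro: order_trans)
      ultimately have "xvar F * pvar H \<in> chow_ideal L b0"
        using False HV less.prems by (auto simp: xvar_def intro: chow_ideal_incomparable)
      then have "hpol G ^ k' * (xvar F * pvar H) \<in> chow_ideal L b0"
        by (rule chow_ideal_mult[OF polys_in_power[OF polys_in_hpol[OF GV]]])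
      then show ?thesis by (simp add: mult.commute)
    next
      case True
      obtain J M where JM: "J \<in> L" "M \<in> L" "G \<le> J" "H \<le> J" "\<And>K. K \<in> L \<Longrightarrow> G \<le> K \<Longrightarrow> H \<le> K \<Longrightarrow> J \<le> K"
        "M \<le> G" "M \<le> H" "\<And>K. K \<in> L \<Longrightarrow> K \<le> G \<Longrightarrow> K \<le> H \<Longrightarrow> K \<le> M"
        "rk J + rk M \<le> rk G + rk H"
        by (rule obtain_join_meet[OF less.prems(2) H(1)], rule that)
      \<comment> \<open>The meet \<open>M\<close> of \<open>G\<close> and \<open>H\<close> contains
        both \<open>F\<close> and \<open>a\<close>, hence is properly above \<open>F\<close>. By
        submodularity the gap \<open>rk J - rk H\<close> is then at least one less than
        \<open>rk G - rk F\<close>, matching the loss of one factor in the exponent.\<close>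
      have "a \<le> M" "F \<le> M" using JM(8) aV a H True less.prems by auto
      then have "F < M" using a by (auto simp: order_less_le)
      then have FM: "rk F < rk M" using rk_less JM less.prems by blast
      have HJ: "H < J" using JM H by (auto simp: order_less_le)
      have rkHJ: "rk H < rk J" using rk_less HJ JM H by blast
      have d: "rk J - rk H < rk G - rk F" "rk J - rk H \<le> k'"
        using JM(9) FM rkHJ k less.prems(4) by linarith+
      have "xvar H * hpol J ^ k' \<in> chow_ideal L b0"
        using less.hyps[OF d(1) H(1) JM(1) HJ d(2)] .
      then have 1: "pvar H * hpol J ^ k' \<in> chow_ideal L b0" using HV by (simp add: xvar_def)
      have "pvar H * hpol G ^ k' - pvar H * hpol J ^ k' \<in> chow_ideal L b0"
        by (rule pvar_hpol_join_power[OF HV GV H(3) JM(3,1,5)])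
      from chow_ideal_add[OF this 1] have "pvar H * hpol G ^ k' \<in> chow_ideal L b0" by simp
      from chow_ideal_mult[OF polys_in_xvar[OF less.prems(1)] this]
      show ?thesis by (simp add: mult.assoc)
    qed
  qed
  have "xvar F * hpol G ^ k' * hpol a
      = xvar F * hpol G ^ k + (\<Sum>H\<in>{H\<in>L. a \<le> H \<and> \<not> G \<le> H}. xvar F * pvar H * hpol G ^ k')"
    by (simp add: k hpol_split[OF a(2)] algebra_simps sum_distrib_left)
  then have "xvar F * hpol G ^ k
      = xvar F * hpol G ^ k' * hpol a - (\<Sum>H\<in>{H\<in>L. a \<le> H \<and> \<not> G \<le> H}. xvar F * pvar H * hpol G ^ k')"
    by simp
  also have "\<dots> \<in> chow_ideal L b0"
  proof (rule chow_ideal_diff)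
    show "xvar F * hpol G ^ k' * hpol a \<in> chow_ideal L b0"
      by (rule chow_ideal_mult[OF polys_in_mult[OF polys_in_xvar[OF less.prems(1)]
            polys_in_power[OF polys_in_hpol[OF GV]]] chow_ideal_atom[OF a(1)]])
    show "(\<Sum>H\<in>{H\<in>L. a \<le> H \<and> \<not> G \<le> H}. xvar F * pvar H * hpol G ^ k') \<in> chow_ideal L b0"
      by (rule chow_ideal_sum) (use each in blast)
  qed
  finally show ?case .
qed

text \<open>Rewriting with \<open>x\<^sub>G h\<^sub>F\<^sup>e\<close> strictly increases this weight, which is bounded in each degree.\<close>
definition wt :: "('b \<Rightarrow>\<^sub>0 nat) \<Rightarrow> nat" where
  "wt m = (\<Sum>v\<in>Poly_Mapping.keys m. Poly_Mapping.lookup m v * rk v)"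

lemma wt_superset:
  assumes "finite A" "Poly_Mapping.keys m \<subseteq> A"
  shows "wt m = (\<Sum>v\<in>A. Poly_Mapping.lookup m v * rk v)"
  unfolding wt_def using assms
  by (intro sum.mono_neutral_left) (auto simp: in_keys_iff)

lemma wt_add: "wt (m + m') = wt m + wt m'"
proof -
  let ?A = "Poly_Mapping.keys m \<union> Poly_Mapping.keys m'"
  have "Poly_Mapping.keys (m + m') \<subseteq> ?A" by (rule keys_add)
  then show ?thesis
    by (simp add: wt_superset[of ?A] lookup_add sum.distrib ring_distribs)
qed

lemma wt_single [simp]: "wt (Poly_Mapping.single v k) = k * rk v"
  by (simp add: wt_def)

definition homog_wt :: "nat \<Rightarrow> nat \<Rightarrow> 'b zpoly set" where
  "homog_wt d k = {p. \<forall>m\<in>Poly_Mapping.keys p. Poly_Mapping.keys m \<subseteq> V \<and> mon_deg m = d \<and> k \<le> wt m}"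

lemma homog_wt_zero [simp]: "0 \<in> homog_wt d k"
  by (simp add: homog_wt_def)

lemma homog_wt_single:
  "Poly_Mapping.keys m \<subseteq> V \<Longrightarrow> mon_deg m = d \<Longrightarrow> k \<le> wt m \<Longrightarrow> Poly_Mapping.single m c \<in> homog_wt d k"
  by (auto simp: homog_wt_def split: if_splits)

lemma homog_wt_add: "p \<in> homog_wt d k \<Longrightarrow> p' \<in> homog_wt d k \<Longrightarrow> p + p' \<in> homog_wt d k"
  using keys_add[of p p'] unfolding homog_wt_def by blast

lemma homog_wt_mult:
  assumes "p \<in> homog_wt d k" "p' \<in> homog_wt d' k'"
  shows "p * p' \<in> homog_wt (d + d') (k + k')"
proof -
  have "Poly_Mapping.keys m \<subseteq> V \<and> mon_deg m = d + d' \<and> k + k' \<le> wt m"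
    if m: "m \<in> Poly_Mapping.keys (p * p')" for m
  proof -
    obtain a b where ab: "m = a + b" "a \<in> Poly_Mapping.keys p" "b \<in> Poly_Mapping.keys p'"
      using subsetD[OF keys_mult m] by blast
    then have "Poly_Mapping.keys a \<subseteq> V \<and> mon_deg a = d \<and> k \<le> wt a"
      "Poly_Mapping.keys b \<subseteq> V \<and> mon_deg b = d' \<and> k' \<le> wt b"
      using assms by (auto simp: homog_wt_def)
    then show ?thesis using keys_add[of a b] ab(1) by (auto simp: mon_deg_add wt_add)
  qed
  then show ?thesis by (simp add: homog_wt_def)
qed

lemma homog_wt_sum: "(\<And>i. i \<in> A \<Longrightarrow> f i \<in> homog_wt d k) \<Longrightarrow> (\<Sum>i\<in>A. f i) \<in> homog_wt d k"
  by (induction A rule: infinite_finite_induct) (auto intro: homog_wt_add)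

lemma homog_wt_mono: "p \<in> homog_wt d k \<Longrightarrow> k' \<le> k \<Longrightarrow> p \<in> homog_wt d k'"
  by (auto simp: homog_wt_def)

lemma homog_wt_pvar: "F \<in> V \<Longrightarrow> k \<le> rk F \<Longrightarrow> pvar F \<in> homog_wt 1 k"
  unfolding pvar_def by (rule homog_wt_single) auto

lemma hpol_above: "F \<in> L \<Longrightarrow> hpol F = pvar F + (\<Sum>H\<in>{H\<in>L. F < H}. pvar H)"
proof -
  assume "F \<in> L"
  then have "{H\<in>L. F \<le> H} = insert F {H\<in>L. F < H}" by (auto simp: order_less_le)
  then show ?thesis unfolding hpol_def using finite_L by simp
qed

text \<open>x_F^e is the term of lowest weight in h_F^e: each other term uses some flat strictly
  above \<open>F\<close>, which gains at least one unit of rank.\<close>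

lemma homog_wt_hpol_power_diff:
  assumes F: "F \<in> V"
  shows "hpol F ^ e - pvar F ^ e \<in> homog_wt e (e * rk F + 1)"
proof (induction e)
  case 0
  then show ?case by (simp add: homog_wt_def)
next
  case (Suc e)
  let ?R = "\<Sum>H\<in>{H\<in>L. F < H}. pvar H"
  have R: "?R \<in> homog_wt 1 (rk F + 1)"
  proof (rule homog_wt_sum, rule homog_wt_pvar)
    fix H assume H: "H \<in> {H\<in>L. F < H}"
    show "H \<in> V" using upper_in_V[OF F, of H] H less_imp_le by blast
    show "rk F + 1 \<le> rk H" using rk_less[of F H] F H by auto
  qed
  have p: "pvar F \<in> homog_wt 1 (rk F)" using homog_wt_pvar F by simp
  have h: "hpol F \<in> homog_wt 1 (rk F)"
    using homog_wt_add[OF p homog_wt_mono[OF R, of "rk F"]] F by (simp add: hpol_above)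
  have pp: "pvar F ^ e \<in> homog_wt e (e * rk F)"
    unfolding pvar_power by (rule homog_wt_single) (use F in auto)
  have "hpol F ^ Suc e - pvar F ^ Suc e = hpol F * (hpol F ^ e - pvar F ^ e) + ?R * pvar F ^ e"
    using F by (simp add: hpol_above algebra_simps)
  also have "\<dots> \<in> homog_wt (Suc e) (Suc e * rk F + 1)"
    using homog_wt_mult[OF h Suc] homog_wt_mult[OF R pp]
    by (intro homog_wt_add) (simp_all add: algebra_simps)
  finally show ?case .
qed

section \<open>Straightening into Feichtner-Yuzvinsky monomials, and the rank\<close>

definition fy_deg :: "nat \<Rightarrow> ('b \<Rightarrow>\<^sub>0 nat) set" where
  "fy_deg d = {m\<in>fy. mon_deg m = d}"

text \<open>Because \<open>b0\<close> counts as a predecessor of every flat, each exponent is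
  bounded by the rank of its flat.\<close>

lemma finite_fy: "finite fy"
proof -
  let ?g = "\<lambda>m v. if v \<in> V then Poly_Mapping.lookup m v else undefined"
  define B where "B = Max (rk ` L)"
  have "?g ` fy \<subseteq> PiE V (\<lambda>_. {..B})"
  proof
    fix f assume "f \<in> ?g ` fy"
    then obtain m where m: "m \<in> fy" "f = ?g m" by auto
    have "Poly_Mapping.lookup m v \<le> B" if v: "v \<in> V" for v
    proof (cases "v \<in> Poly_Mapping.keys m")
      case True
      have "b0 < v" using bot_le v by (auto simp: order_less_le)
      then have "Poly_Mapping.lookup m v < rk v" using m True rk_bot by (force simp: fy_def)
      also have "rk v \<le> B" using v finite_L by (simp add: B_def)
      finally show ?thesis by simp
    qed (simp add: in_keys_iff)
    note bound = this
    show "f \<in> PiE V (\<lambda>_. {..B})"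
      unfolding m(2)
    proof (rule PiE_I)
      fix v assume "v \<in> V"
      then show "?g m v \<in> {..B}" using bound[of v] by simp
    next
      fix v assume "v \<notin> V"
      then show "?g m v = undefined" by (simp only: if_False)
    qed
  qed
  moreover have "finite (PiE V (\<lambda>_. {..B}))" using finite_V by (intro finite_PiE) auto
  ultimately have "finite (?g ` fy)" by (rule finite_subset)
  moreover have "inj_on ?g fy"
  proof (rule inj_onI)
    fix m m' assume m: "m \<in> fy" "m' \<in> fy" "?g m = ?g m'"
    show "m = m'"
    proof (rule poly_mapping_eqI)
      fix v
      have "Poly_Mapping.keys m \<subseteq> V" "Poly_Mapping.keys m' \<subseteq> V" using m by (auto simp: fy_def)
      then show "Poly_Mapping.lookup m v = Poly_Mapping.lookup m' v"
      proof (cases "v \<in> V")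
        case True
        then show ?thesis using fun_cong[OF m(3), of v] by simp
      next
        case False
        then have "v \<notin> Poly_Mapping.keys m" "v \<notin> Poly_Mapping.keys m'"
          using \<open>Poly_Mapping.keys m \<subseteq> V\<close> \<open>Poly_Mapping.keys m' \<subseteq> V\<close> by blast+
        then show ?thesis by (simp add: in_keys_iff)
      qed
    qed
  qed
  ultimately show ?thesis by (rule finite_imageD)
qed

lemma finite_fy_deg: "finite (fy_deg d)"
  using finite_fy by (simp add: fy_deg_def)

definition reducible :: "nat \<Rightarrow> 'b zpoly set" where
  "reducible d = {p. \<exists>c. p - (\<Sum>m\<in>fy_deg d. of_int (c m) * Poly_Mapping.single m 1) \<in> chow_ideal L b0}"

lemma reducible_ideal: "p \<in> chow_ideal L b0 \<Longrightarrow> p \<in> reducible d"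
  unfolding reducible_def by (auto intro!: exI[of _ "\<lambda>_. 0"])

lemma reducible_add:
  assumes "p \<in> reducible d" "p' \<in> reducible d"
  shows "p + p' \<in> reducible d"
proof -
  let ?s = "\<lambda>c. \<Sum>m\<in>fy_deg d. of_int (c m) * Poly_Mapping.single m 1"
  obtain c c' where "p - ?s c \<in> chow_ideal L b0" "p' - ?s c' \<in> chow_ideal L b0"
    using assms by (auto simp: reducible_def)
  then have "(p - ?s c) + (p' - ?s c') \<in> chow_ideal L b0" by (rule chow_ideal_add)
  moreover have "?s c + ?s c' = ?s (\<lambda>m. c m + c' m)"
    by (simp add: sum.distrib ring_distribs)
  then have "(p - ?s c) + (p' - ?s c') = p + p' - ?s (\<lambda>m. c m + c' m)"
    by (simp add: algebra_simps sum.distrib)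
  ultimately show ?thesis unfolding reducible_def by (auto intro!: exI[of _ "\<lambda>m. c m + c' m"])
qed

lemma reducible_of_int_mult:
  assumes "p \<in> reducible d"
  shows "of_int k * p \<in> reducible d"
proof -
  let ?s = "\<lambda>c. \<Sum>m\<in>fy_deg d. of_int (c m) * Poly_Mapping.single m 1"
  obtain c where "p - ?s c \<in> chow_ideal L b0"
    using assms by (auto simp: reducible_def)
  then have "of_int k * (p - ?s c) \<in> chow_ideal L b0"
    by (rule chow_ideal_mult[OF polys_in_of_int])
  moreover have "of_int k * (p - ?s c) = of_int k * p - ?s (\<lambda>m. k * c m)"
    by (simp add: right_diff_distrib sum_distrib_left mult.assoc)
  ultimately show ?thesis unfolding reducible_def by (auto intro!: exI[of _ "\<lambda>m. k * c m"])
qed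

lemma reducible_sum: "(\<And>i. i \<in> A \<Longrightarrow> f i \<in> reducible d) \<Longrightarrow> (\<Sum>i\<in>A. f i) \<in> reducible d"
  by (induction A rule: infinite_finite_induct)
     (auto intro: reducible_add reducible_ideal[OF chow_ideal_zero])

lemma reducible_fy: "m \<in> fy_deg d \<Longrightarrow> Poly_Mapping.single m 1 \<in> reducible d"
proof -
  assume m: "m \<in> fy_deg d"
  have "(\<Sum>m'\<in>fy_deg d. of_int (of_bool (m' = m)) * Poly_Mapping.single m' (1::int))
      = (\<Sum>m'\<in>fy_deg d. if m' = m then Poly_Mapping.single m' 1 else 0)"
    by (rule sum.cong) auto
  also have "\<dots> = Poly_Mapping.single m 1" using m finite_fy_deg by (simp add: sum.delta')
  finally show ?thesis
    unfolding reducible_def by (auto intro!: exI[of _ "\<lambda>m'. of_bool (m' = m)"] simp: chow_ideal_zero)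
qed

text \<open>A straightening argument. A monomial outside \<open>fy\<close> either contains an
  incomparable pair and lies in the ideal, or has too large an exponent at some \<open>F\<close>
  above \<open>G\<close>; then x_G h_F^e in the ideal rewrites it into monomials of the same degree
  and larger weight.\<close>

lemma homog_wt_reducible:
  assumes "p \<in> homog_wt d k"
  shows "p \<in> reducible d"
proof -
  define B where "B = Max (rk ` L)"
  have rkB: "rk F \<le> B" if "F \<in> L" for F using that finite_L by (simp add: B_def)
  show ?thesis using assms
  \<comment> \<open>Weights in degree \<open>d\<close> are at most \<open>d * B\<close>, so the
    rewriting stops. The successor makes the measure still drop in passing from
    \<open>k = d * B\<close> to \<open>Suc k\<close>.\<close>
  proof (induction "Suc (d * B) - k" arbitrary: k p rule: less_induct)
    case less
    have wtB: "wt m \<le> d * B" if "Poly_Mapping.keys m \<subseteq> V" "mon_deg m = d" for m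
    proof -
      have "wt m \<le> (\<Sum>v\<in>Poly_Mapping.keys m. Poly_Mapping.lookup m v * B)"
        unfolding wt_def using that rkB by (intro sum_mono mult_left_mono) auto
      also have "\<dots> = d * B" using that by (simp add: mon_deg_def flip: sum_distrib_right)
      finally show ?thesis .
    qed
    have mono: "Poly_Mapping.single m 1 \<in> reducible d"
      if m: "Poly_Mapping.keys m \<subseteq> V" "mon_deg m = d" "k \<le> wt m" for m
    proof (cases "m \<in> fy")
      case True
      then show ?thesis using m by (intro reducible_fy) (simp add: fy_deg_def)
    next
      case False
      then consider
        (inc) F G where "F \<in> Poly_Mapping.keys m" "G \<in> Poly_Mapping.keys m" "\<not> F \<le> G" "\<not> G \<le> F"
      | (big) F G where "F \<in> Poly_Mapping.keys m" "G \<in> insert b0 (Poly_Mapping.keys m)" "G < F"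
          "rk F \<le> rk G + Poly_Mapping.lookup m F"
        using m unfolding fy_def by (auto simp: not_less)
      then show ?thesis
      proof cases
        case inc
        let ?m' = "Poly_Mapping.single F 1 + Poly_Mapping.single G (1::nat)"
        have split: "m = ?m' + (m - ?m')"
          by (rule monomial_split_le)
             (use inc in \<open>auto simp: lookup_add lookup_single when_def in_keys_iff Suc_le_eq\<close>)
        have "Poly_Mapping.single m 1 = Poly_Mapping.single (m - ?m') 1 * (pvar F * pvar G)"
          by (subst split) (simp add: pvar_def mult_single ac_simps)
        also have "\<dots> \<in> chow_ideal L b0"
        proof (rule chow_ideal_mult)
          show "Poly_Mapping.single (m - ?m') 1 \<in> polys_in V"
            by (rule polys_in_single[OF subset_trans[OF keys_minus_subset m(1)]])
          show "pvar F * pvar G \<in> chow_ideal L b0"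
            using inc m(1) by (intro chow_ideal_incomparable) blast+
        qed
        finally show ?thesis by (rule reducible_ideal)
      next
        case big
        \<comment> \<open>Exactly the power of x_F that the relation with x_G consumes; the rest of
          the monomial is carried along as \<open>?r\<close>. For \<open>G = b0\<close> there is no
          variable to split off, hence the exponent vector 0 in \<open>g\<close>.\<close>
        define e where "e = rk F - rk G"
        define g where "g = (if G = b0 then 0 else Poly_Mapping.single G (1::nat))"
        let ?m' = "Poly_Mapping.single F e + g"
        let ?r = "m - ?m'"
        have FV: "F \<in> V" and GL: "G \<in> L" using big m bot_in by auto
        have e: "e \<le> Poly_Mapping.lookup m F" using big by (simp add: e_def)
        have split: "m = ?m' + ?r"
          by (rule monomial_split_le)
             (use big e in \<open>auto simp: g_def lookup_add lookup_single when_def in_keys_iff Suc_le_eq\<close>)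
        have xg: "xvar G = Poly_Mapping.single g 1"
          by (simp add: xvar_def g_def pvar_def)
        let ?s = "Poly_Mapping.single ?r (1::int)"
        have rV: "Poly_Mapping.keys ?r \<subseteq> V" by (rule subset_trans[OF keys_minus_subset m(1)])
        have "Poly_Mapping.single m 1 = ?s * xvar G * pvar F ^ e"
          by (subst split) (simp add: xg pvar_power mult_single ac_simps)
        also have "\<dots> = ?s * (xvar G * hpol F ^ e) + of_int (- 1) * ((hpol F ^ e - pvar F ^ e) * (?s * xvar G))"
          by (simp add: algebra_simps)
        also have "\<dots> \<in> reducible d"
        proof (rule reducible_add)
          have "xvar G * hpol F ^ e \<in> chow_ideal L b0"
            by (rule xvar_hpol_power) (use FV GL big in \<open>auto simp: e_def\<close>)
          then show "?s * (xvar G * hpol F ^ e) \<in> reducible d"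
            by (rule reducible_ideal[OF chow_ideal_mult[OF polys_in_single[OF rV]]])
          have gr: "Poly_Mapping.keys (?r + g) \<subseteq> V"
            using rV keys_add[of ?r g] GL by (auto simp: g_def split: if_splits)
          have m_eq: "m = Poly_Mapping.single F e + (?r + g)"
            using split by (simp add: ac_simps)
          have "mon_deg m = e + mon_deg (?r + g)" "wt m = e * rk F + wt (?r + g)"
            by (subst m_eq, simp add: mon_deg_add wt_add)+
          note dw = this
          have "?s * xvar G \<in> homog_wt (mon_deg (?r + g)) (wt (?r + g))"
            unfolding xg mult_single using gr by (intro homog_wt_single) auto
          from homog_wt_mult[OF homog_wt_hpol_power_diff[OF FV, of e] this]
          have "(hpol F ^ e - pvar F ^ e) * (?s * xvar G) \<in> homog_wt d (e * rk F + 1 + wt (?r + g))"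
            using dw(1) m(2) by simp
          then have hw: "(hpol F ^ e - pvar F ^ e) * (?s * xvar G) \<in> homog_wt d (Suc k)"
            by (rule homog_wt_mono) (use dw(2) m(3) in simp)
          have "k < Suc (d * B)" using wtB[OF m(1,2)] m(3) by simp
          then have "Suc (d * B) - Suc k < Suc (d * B) - k" by simp
          from less.hyps[OF this hw]
          show "of_int (- 1) * ((hpol F ^ e - pvar F ^ e) * (?s * xvar G)) \<in> reducible d"
            by (rule reducible_of_int_mult)
        qed
        finally show ?thesis .
      qed
    qed
    have "p = (\<Sum>m\<in>Poly_Mapping.keys p. of_int (Poly_Mapping.lookup p m) * Poly_Mapping.single m 1)"
      by (subst poly_mapping_as_sum) (simp only: of_int_mult_single mult_1_right)
    also have "\<dots> \<in> reducible d"
      using less.prems by (intro reducible_sum reducible_of_int_mult mono) (auto simp: homog_wt_def)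
    finally show ?case .
  qed
qed

lemma homog_in_reducible: "p \<in> homog_in V d \<Longrightarrow> p \<in> reducible d"
  by (rule homog_wt_reducible[of _ _ 0]) (auto simp: homog_in_def homog_wt_def)

lemma homog_in_hmono:
  assumes "Poly_Mapping.keys m \<subseteq> V"
  shows "pmono hpol m \<in> homog_in V (mon_deg m)"
proof -
  have eq: "homog_in V d = homog_wt d 0" for d by (simp add: homog_in_def homog_wt_def)
  have one: "1 \<in> homog_wt 0 0"
    using homog_wt_single[of 0 0 0 1] by simp
  have h: "hpol v \<in> homog_wt 1 0" if "v \<in> V" for v
    unfolding hpol_def by (rule homog_wt_sum, rule homog_wt_pvar) (use upper_in_V that in auto)
  have pow: "hpol v ^ k \<in> homog_wt k 0" if "v \<in> V" for v k
  proof (induction k)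
    case (Suc k)
    then show ?case using homog_wt_mult[OF h[OF that] Suc] by simp
  qed (simp add: one)
  have "(\<Prod>v\<in>A. hpol v ^ f v) \<in> homog_wt (\<Sum>v\<in>A. f v) 0" if "finite A" "A \<subseteq> V" for f A
    using that
  proof (induction A rule: finite_induct)
    case (insert x F)
    then have "(\<Prod>v\<in>F. hpol v ^ f v) \<in> homog_wt (\<Sum>v\<in>F. f v) 0" "x \<in> V" by auto
    from homog_wt_mult[OF pow[OF this(2), of "f x"] this(1)] show ?case using insert by simp
  qed (use one in simp)
  then show ?thesis unfolding eq pmono_def mon_deg_def using assms by simp
qed

text \<open>The lower bound uses the \<open>h\<close>-monomials, the upper bound the
  \<open>x\<close>-monomials: a larger family, written modulo the ideal in the latter, would have a
  nontrivial integer relation between its coefficient vectors.\<close>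

theorem chow_rank_eq: "chow_rank L b0 d = card (fy_deg d)"
proof -
  let ?indep = "\<lambda>S. \<forall>c :: 'b zpoly \<Rightarrow> int. (\<Sum>s\<in>S. of_int (c s) * s) \<in> chow_ideal L b0 \<longrightarrow> (\<forall>s\<in>S. c s = 0)"
  let ?F = "{S. finite S \<and> S \<subseteq> homog_in V d \<and> ?indep S}"
  let ?H = "pmono hpol ` fy_deg d"
  have fyV: "Poly_Mapping.keys m \<subseteq> V" if "m \<in> fy_deg d" for m using that by (auto simp: fy_deg_def fy_def)
  have sub: "fy_deg d \<subseteq> fy" by (auto simp: fy_deg_def)
  \<comment> \<open>\<open>chow_rank\<close> measures sets, so the \<open>h\<close>-monomials must
    be distinct as polynomials. Two equal ones would give a relation with coefficients 1 and
    -1.\<close>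
  have inj: "inj_on (pmono hpol) (fy_deg d)"
  proof (rule inj_onI, rule ccontr)
    fix m m' assume m: "m \<in> fy_deg d" "m' \<in> fy_deg d" "pmono hpol m = pmono hpol m'" "m \<noteq> m'"
    have "(\<Sum>x\<in>{m,m'}. of_int (if x = m then 1 else - 1) * pmono hpol x) = 0"
      using m by simp
    then show False
      using fy_independent[of "{m,m'}" "\<lambda>x. if x = m then 1 else - 1" m] m sub chow_ideal_zero by auto
  qed
  have "?H \<in> ?F"
  proof (intro CollectI conjI allI impI)
    show "finite ?H" using finite_fy_deg by simp
    show "?H \<subseteq> homog_in V d" using homog_in_hmono fyV by (auto simp: fy_deg_def)
    fix c :: "'b zpoly \<Rightarrow> int"
    assume "(\<Sum>s\<in>?H. of_int (c s) * s) \<in> chow_ideal L b0"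
    then have "(\<Sum>m\<in>fy_deg d. of_int (c (pmono hpol m)) * pmono hpol m) \<in> chow_ideal L b0"
      using inj by (simp add: sum.reindex)
    from fy_independent[OF finite_fy_deg sub this]
    show "\<forall>s\<in>?H. c s = 0" by blast
  qed
  then have mem: "card (fy_deg d) \<in> card ` ?F"
    using card_image[OF inj] by (metis (no_types, lifting) imageI)
  have "card S \<le> card (fy_deg d)" if S: "S \<in> ?F" for S
  proof (rule ccontr)
    assume "\<not> ?thesis"
    then have less: "card (fy_deg d) < card S" by simp
    have fin: "finite S" using S by simp
    let ?s = "\<lambda>c. \<Sum>m\<in>fy_deg d. of_int (c m) * Poly_Mapping.single m (1::int)"
    have "\<forall>s\<in>S. \<exists>c. s - ?s c \<in> chow_ideal L b0"
      using S homog_in_reducible[of _ d] by (auto simp: reducible_def)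
    from bchoice[OF this] obtain a where a: "\<And>s. s \<in> S \<Longrightarrow> s - ?s (a s) \<in> chow_ideal L b0"
      by blast
    obtain c where c: "\<exists>s\<in>S. c s \<noteq> 0" "\<And>m. m \<in> fy_deg d \<Longrightarrow> (\<Sum>s\<in>S. c s * a s m) = 0"
      using int_linear_dependence[OF finite_fy_deg fin less, of a] by blast
    have "(\<Sum>s\<in>S. of_int (c s) * (s - ?s (a s))) \<in> chow_ideal L b0"
      by (intro chow_ideal_sum chow_ideal_mult polys_in_of_int a)
    moreover have "(\<Sum>s\<in>S. of_int (c s) * ?s (a s))
        = (\<Sum>m\<in>fy_deg d. of_int (\<Sum>s\<in>S. c s * a s m) * Poly_Mapping.single m 1)"
      by (simp add: sum_distrib_left sum_distrib_right mult.assoc) (rule sum.swap)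
    then have "(\<Sum>s\<in>S. of_int (c s) * ?s (a s)) = 0" using c(2) by simp
    ultimately have "(\<Sum>s\<in>S. of_int (c s) * s) \<in> chow_ideal L b0"
      by (simp add: right_diff_distrib sum_subtractf)
    then show False using S c(1) by blast
  qed
  then have "Sup (card ` ?F) = card (fy_deg d)"
    using mem by (intro cSup_eq_maximum) auto
  then show ?thesis unfolding chow_rank_def .
qed

theorem chow_hilbert_eq: "chow_hilbert L b0 t = (\<Sum>m\<in>fy. t ^ mon_deg m)"
proof -
  have zero: "card (fy_deg d) = 0" if "d \<notin> mon_deg ` fy" for d
  proof -
    have "fy_deg d = {}" using that by (auto simp: fy_deg_def)
    then show ?thesis by simp
  qed
  have "chow_hilbert L b0 t = (\<Sum>d\<in>mon_deg ` fy. real (card (fy_deg d)) * t ^ d)"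
    unfolding chow_hilbert_def chow_rank_eq
    by (rule suminf_finite) (use finite_fy zero in auto)
  also have "\<dots> = (\<Sum>d\<in>mon_deg ` fy. \<Sum>m\<in>{m\<in>fy. mon_deg m = d}. t ^ mon_deg m)"
    by (rule sum.cong) (auto simp: fy_deg_def)
  also have "\<dots> = (\<Sum>m\<in>fy. t ^ mon_deg m)"
    by (rule sum.image_gen[OF finite_fy, symmetric])
  finally show ?thesis .
qed

end

section \<open>The Hilbert series at -1\<close>

lemma alternating_sum_neg_one:
  "n \<ge> 1 \<Longrightarrow> (\<Sum>d\<in>{1..<n}. (-1) ^ d) = - (of_bool (even n) :: real)"
  by (induction n rule: nat_induct_at_least) (auto simp: sum.atLeastLessThan_Suc)

context geometric_lattice
begin

text \<open>The empty chain is assigned to \<open>b0\<close>, so that these sets partition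
  \<open>fy\<close> over all of \<open>L\<close>.\<close>

definition fy_top :: "'b \<Rightarrow> ('b \<Rightarrow>\<^sub>0 nat) set" where
  "fy_top F = {m\<in>fy. if F = b0 then m = 0 else F \<in> Poly_Mapping.keys m \<and> (\<forall>G\<in>Poly_Mapping.keys m. G \<le> F)}"

definition altsum :: "'b \<Rightarrow> real" where
  "altsum F = (\<Sum>m\<in>fy_top F. (-1) ^ mon_deg m)"

lemma zero_fy: "0 \<in> fy"
  by (simp add: fy_def)

lemma altsum_bot: "altsum b0 = 1"
proof -
  have "fy_top b0 = {0}" using zero_fy by (auto simp: fy_top_def)
  then show ?thesis by (simp add: altsum_def)
qed

lemma finite_fy_top: "finite (fy_top F)"
  using finite_fy by (simp add: fy_top_def)

lemma fy_top_keys_le: "m \<in> fy_top F \<Longrightarrow> G \<in> Poly_Mapping.keys m \<Longrightarrow> G \<le> F"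
  by (auto simp: fy_top_def split: if_splits)

lemma fy_top_unique: "m \<in> fy_top F \<Longrightarrow> m \<in> fy_top G \<Longrightarrow> F = G"
  by (auto simp: fy_top_def split: if_splits intro: antisym)

lemma ex_fy_top:
  assumes "m \<in> fy"
  shows "\<exists>F\<in>insert b0 (Poly_Mapping.keys m). m \<in> fy_top F"
proof -
  have fC: "finite (insert b0 (Poly_Mapping.keys m))" by simp
  obtain F where F: "F \<in> insert b0 (Poly_Mapping.keys m)"
    "\<And>G. G \<in> insert b0 (Poly_Mapping.keys m) \<Longrightarrow> G \<le> F"
  proof (rule chain_of_max[OF fy_chain[OF assms] fC insertI1, of "\<lambda>_. True"])
    fix F assume F: "F \<in> insert b0 (Poly_Mapping.keys m)"
      "\<And>G. G \<in> insert b0 (Poly_Mapping.keys m) \<Longrightarrow> True \<Longrightarrow> G \<le> F"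
    show thesis by (rule that[OF F(1) F(2)[OF _ TrueI]])
  qed (rule TrueI)
  have "m \<in> fy_top F"
  proof (cases "F = b0")
    case True
    have "v \<notin> Poly_Mapping.keys m" for v
    proof
      assume v: "v \<in> Poly_Mapping.keys m"
      then have "v \<in> V" using assms by (auto simp: fy_def)
      moreover have "v \<le> b0" using F(2)[of v] v True by simp
      ultimately show False using bot_le[of v] by auto
    qed
    then have "Poly_Mapping.keys m = {}" by blast
    then show ?thesis using assms True by (simp add: fy_top_def)
  next
    case False
    then show ?thesis using assms F by (auto simp: fy_top_def)
  qed
  with F(1) show ?thesis by blast
qed

lemma sum_fy_altsum: "(\<Sum>m\<in>fy. (-1) ^ mon_deg m) = (\<Sum>F\<in>L. altsum F)"
proof -
  have "fy = (\<Union>F\<in>L. fy_top F)"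
  proof
    show "fy \<subseteq> (\<Union>F\<in>L. fy_top F)"
    proof
      fix m assume m: "m \<in> fy"
      then obtain F where F: "F \<in> insert b0 (Poly_Mapping.keys m)" "m \<in> fy_top F" using ex_fy_top by blast
      have "F \<in> L" using fy_chain[OF m] F(1) by (auto simp: chain_of_def)
      then show "m \<in> (\<Union>F\<in>L. fy_top F)" using F(2) by blast
    qed
  qed (auto simp: fy_top_def)
  then have "(\<Sum>m\<in>fy. (-1) ^ mon_deg m) = (\<Sum>m\<in>(\<Union>F\<in>L. fy_top F). (-1) ^ mon_deg m :: real)"
    by simp
  also have "\<dots> = (\<Sum>F\<in>L. altsum F)"
    unfolding altsum_def using finite_L finite_fy_top fy_top_unique
    by (intro sum.UNION_disjoint) blast+
  finally show ?thesis .
qed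

text \<open>The only new constraint is the one against \<open>G\<close>, the top of the old chain;
  the smaller chain elements have smaller rank and impose less.\<close>

lemma fy_top_extend:
  assumes F: "F \<in> V" and G: "G \<in> L" "G < F" and m: "m \<in> fy_top G" and d: "1 \<le> d" "rk G + d < rk F"
  shows "m + Poly_Mapping.single F d \<in> fy_top F"
proof -
  let ?m = "m + Poly_Mapping.single F d"
  have mfy: "m \<in> fy" using m by (simp add: fy_top_def)
  then have kV: "Poly_Mapping.keys m \<subseteq> V" by (simp add: fy_def)
  have le: "H \<le> G" if "H \<in> Poly_Mapping.keys m" for H using fy_top_keys_le[OF m that] .
  have lt: "H < F" if "H \<in> Poly_Mapping.keys m" for H by (rule order.strict_trans1[OF le[OF that] G(2)])
  have Fm: "F \<notin> Poly_Mapping.keys m" using lt by blast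
  have keys: "Poly_Mapping.keys ?m = insert F (Poly_Mapping.keys m)"
    using d Fm by (auto simp: in_keys_iff lookup_add lookup_single when_def split: if_splits)
  have lk: "Poly_Mapping.lookup ?m H = (if H = F then d else Poly_Mapping.lookup m H)" for H
    using Fm by (auto simp: lookup_add lookup_single when_def in_keys_iff)
  have "?m \<in> fy"
    unfolding fy_def
  proof (intro CollectI conjI ballI impI)
    show "Poly_Mapping.keys ?m \<subseteq> V" using keys kV F by simp
  next
    fix A B assume "A \<in> Poly_Mapping.keys ?m" "B \<in> Poly_Mapping.keys ?m"
    then show "A \<le> B \<or> B \<le> A"
      using mfy lt unfolding keys fy_def by (auto simp: less_imp_le)
  next
    fix A B assume AB: "A \<in> Poly_Mapping.keys ?m" "B \<in> insert b0 (Poly_Mapping.keys ?m)" "B < A"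
    show "rk B + Poly_Mapping.lookup ?m A < rk A"
    proof (cases "A = F")
      case True
      then have "B \<in> insert b0 (Poly_Mapping.keys m)" using AB keys by auto
      then have "B \<le> G" "B \<in> L" using le bot_le G bot_in kV by auto
      then have "rk B \<le> rk G" using rk_less[of B G] G by (auto simp: order_le_less)
      then show ?thesis using True d lk by simp
    next
      case False
      then have A: "A \<in> Poly_Mapping.keys m" using AB keys by simp
      then have "B \<noteq> F" using AB(3) lt[OF A] by auto
      then have "B \<in> insert b0 (Poly_Mapping.keys m)" using AB keys by auto
      then show ?thesis using mfy A AB(3) False lk by (auto simp: fy_def)
    qed
  qed
  moreover have "\<forall>H\<in>Poly_Mapping.keys ?m. H \<le> F" using keys lt by (auto simp: less_imp_le)
  ultimately show ?thesis using F keys by (simp add: fy_top_def)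
qed

lemma fy_top_decompose:
  assumes F: "F \<in> V" and m: "m \<in> fy_top F"
  obtains G m' d where "G \<in> L" "G < F" "m' \<in> fy_top G" "1 \<le> d" "rk G + d < rk F"
    "m = m' + Poly_Mapping.single F d"
proof -
  define d where "d = Poly_Mapping.lookup m F"
  define m' where "m' = m - Poly_Mapping.single F d"
  have mfy: "m \<in> fy" using m by (simp add: fy_top_def)
  have Fm: "F \<in> Poly_Mapping.keys m" using m F by (auto simp: fy_top_def)
  have lk: "Poly_Mapping.lookup m' H = (if H = F then 0 else Poly_Mapping.lookup m H)" for H
    by (auto simp: m'_def d_def lookup_minus lookup_single when_def)
  have keys: "Poly_Mapping.keys m' = Poly_Mapping.keys m - {F}"
    by (auto simp: in_keys_iff lk split: if_splits)
  have "m' \<in> fy" using mfy by (auto simp: fy_def keys lk)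
  then obtain G where G: "G \<in> insert b0 (Poly_Mapping.keys m')" "m' \<in> fy_top G" using ex_fy_top by blast
  have Gm: "G \<in> insert b0 (Poly_Mapping.keys m)" using G keys by auto
  have GL: "G \<in> L" using fy_chain[OF mfy] Gm by (auto simp: chain_of_def)
  have "G \<le> F" using Gm fy_top_keys_le[OF m] bot_le F by auto
  moreover have "G \<noteq> F" using G(1) keys F by auto
  ultimately have GF: "G < F" by simp
  have "m = m' + Poly_Mapping.single F d"
    by (rule poly_mapping_eqI) (simp add: lookup_add lk lookup_single when_def d_def)
  moreover have "1 \<le> d" using Fm by (simp add: d_def in_keys_iff Suc_le_eq)
  moreover have "rk G + d < rk F" using mfy Fm Gm GF by (auto simp: fy_def d_def)
  ultimately show thesis using that GL GF G(2) by blast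
qed

text \<open>Removing the top flat \<open>F\<close> with its exponent is a bijection onto triples of
  the next flat \<open>G\<close>, a vector with top \<open>G\<close>, and an exponent
  \<open>d\<close> with \<open>1 <= d < rk F - rk G\<close>. The sign factors over this
  decomposition.\<close>

lemma altsum_rec:
  assumes F: "F \<in> V"
  shows "altsum F = - (\<Sum>G\<in>{G\<in>L. G < F \<and> even (rk F - rk G)}. altsum G)"
proof -
  let ?D = "{G\<in>L. G < F}"
  let ?S = "SIGMA G:?D. fy_top G \<times> {1..<rk F - rk G}"
  let ?h = "\<lambda>(G, m, d). m + Poly_Mapping.single F d"
  have notin: "Poly_Mapping.lookup m F = 0" if "m \<in> fy_top G" "G < F" for m G
  proof -
    have "F \<notin> Poly_Mapping.keys m" using fy_top_keys_le[OF that(1), of F] that(2) by auto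
    then show ?thesis by (simp add: in_keys_iff)
  qed
  have inj: "inj_on ?h ?S"
  proof (rule inj_onI)
    fix x y assume xy: "x \<in> ?S" "y \<in> ?S" "?h x = ?h y"
    obtain G m d G' m' d' where eq: "x = (G, m, d)" "y = (G', m', d')"
      by (metis surj_pair)
    from xy have *: "G \<in> L" "G < F" "m \<in> fy_top G" "d \<in> {1..<rk F - rk G}"
      "G' \<in> L" "G' < F" "m' \<in> fy_top G'" "d' \<in> {1..<rk F - rk G'}"
      "m + Poly_Mapping.single F d = m' + Poly_Mapping.single F d'"
      unfolding eq by auto
    from *(9) have "Poly_Mapping.lookup (m + Poly_Mapping.single F d) F
        = Poly_Mapping.lookup (m' + Poly_Mapping.single F d') F" by simp
    then have d: "d = d'" using notin[OF *(3,2)] notin[OF *(7,6)] by (simp add: lookup_add)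
    then have m: "m = m'" using *(9) by simp
    then have "G = G'" using fy_top_unique[of m G G'] *(3,7) by simp
    with d m show "x = y" by (simp add: eq)
  qed
  have img: "?h ` ?S = fy_top F"
  proof
    show "?h ` ?S \<subseteq> fy_top F"
    proof clarify
      fix G m d assume *: "G \<in> L" "G < F" "m \<in> fy_top G" "d \<in> {1..<rk F - rk G}"
      then show "m + Poly_Mapping.single F d \<in> fy_top F"
        by (intro fy_top_extend[OF F *(1-3)]) auto
    qed
    show "fy_top F \<subseteq> ?h ` ?S"
    proof
      fix m assume "m \<in> fy_top F"
      then obtain G m' d where *: "G \<in> L" "G < F" "m' \<in> fy_top G" "1 \<le> d" "rk G + d < rk F"
        "m = m' + Poly_Mapping.single F d"
        by (rule fy_top_decompose[OF F])
      then have "(G, m', d) \<in> ?S" by auto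
      then show "m \<in> ?h ` ?S" by (rule rev_image_eqI) (simp add: *(6))
    qed
  qed
  have fin: "finite ?D" using finite_L by simp
  have "altsum F = (\<Sum>x\<in>?S. (-1) ^ mon_deg (?h x))"
    unfolding altsum_def img[symmetric] using inj by (simp add: sum.reindex)
  also have "\<dots> = (\<Sum>G\<in>?D. \<Sum>(m,d)\<in>fy_top G \<times> {1..<rk F - rk G}. (-1) ^ (mon_deg m + d))"
    using fin finite_fy_top by (subst sum.Sigma) (auto simp: mon_deg_add split_def)
  also have "\<dots> = (\<Sum>G\<in>?D. altsum G * (\<Sum>d\<in>{1..<rk F - rk G}. (-1) ^ d))"
    by (simp add: altsum_def sum_product sum.cartesian_product power_add)
  also have "\<dots> = (\<Sum>G\<in>?D. if even (rk F - rk G) then - altsum G else 0)"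
  proof (rule sum.cong)
    fix G assume "G \<in> ?D"
    then have "1 \<le> rk F - rk G" using rk_less[of G F] F by auto
    from alternating_sum_neg_one[OF this]
    show "altsum G * (\<Sum>d\<in>{1..<rk F - rk G}. (-1) ^ d) = (if even (rk F - rk G) then - altsum G else 0)"
      by simp
  qed simp
  also have "\<dots> = (\<Sum>G\<in>{G\<in>?D. even (rk F - rk G)}. - altsum G)"
    by (rule sum.inter_filter[OF fin, symmetric])
  finally show ?thesis by (simp add: sum_negf conj_assoc)
qed

text \<open>The recursion has only one solution, found by induction on rank. For odd
  \<open>rk F\<close> it refers only to flats of odd rank, whose sums vanish already; for even
  \<open>rk F\<close> it is the hypothesis on \<open>\<epsilon>\<close>. Keeping
  \<open>\<epsilon>\<close> abstract separates the lattice argument from the q-series.\<close>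

lemma altsum_rank:
  assumes e0: "\<epsilon> 0 = 1"
    and e: "\<And>F. F \<in> V \<Longrightarrow> even (rk F) \<Longrightarrow> (\<Sum>G\<in>{G\<in>L. G \<le> F \<and> even (rk G)}. \<epsilon> (rk G)) = 0"
    and "F \<in> L"
  shows "altsum F = (if even (rk F) then \<epsilon> (rk F) else 0)"
  using \<open>F \<in> L\<close>
proof (induction "rk F" arbitrary: F rule: less_induct)
  case less
  show ?case
  proof (cases "F = b0")
    case True
    then show ?thesis by (simp add: altsum_bot rk_bot e0)
  next
    case False
    then have F: "F \<in> V" using less.prems by simp
    have IH: "altsum G = (if even (rk G) then \<epsilon> (rk G) else 0)" if "G \<in> L" "G < F" for G
      using less.hyps rk_less that less.prems by blast
    have par: "even (rk F - rk G) \<longleftrightarrow> (even (rk F) \<longleftrightarrow> even (rk G))" if "G \<in> L" "G < F" for G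
      using rk_less[OF that(1) less.prems that(2)] by auto
    show ?thesis
    proof (cases "even (rk F)")
      case True
      have "altsum F = - (\<Sum>G\<in>{G\<in>L. G < F \<and> even (rk G)}. \<epsilon> (rk G))"
        unfolding altsum_rec[OF F] using IH par True
        by (intro arg_cong[where f = uminus] sum.cong) auto
      moreover have "{G\<in>L. G \<le> F \<and> even (rk G)} = insert F {G\<in>L. G < F \<and> even (rk G)}"
        using True F by (auto simp: order_less_le)
      then have "\<epsilon> (rk F) + (\<Sum>G\<in>{G\<in>L. G < F \<and> even (rk G)}. \<epsilon> (rk G)) = 0"
        using e[OF F True] finite_L by simp
      ultimately show ?thesis using True by simp
    next
      case False
      have "altsum F = - (\<Sum>G\<in>{G\<in>L. G < F \<and> even (rk F - rk G)}. 0)"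
        unfolding altsum_rec[OF F] using IH par False
        by (intro arg_cong[where f = uminus] sum.cong) auto
      then show ?thesis using False by simp
    qed
  qed
qed

theorem chow_hilbert_neg_one:
  assumes "\<epsilon> 0 = 1"
    and "\<And>F. F \<in> V \<Longrightarrow> even (rk F) \<Longrightarrow> (\<Sum>G\<in>{G\<in>L. G \<le> F \<and> even (rk G)}. \<epsilon> (rk G)) = 0"
  shows "chow_hilbert L b0 (-1) = (\<Sum>F\<in>{F\<in>L. even (rk F)}. \<epsilon> (rk F))"
proof -
  have "chow_hilbert L b0 (-1) = (\<Sum>F\<in>L. if even (rk F) then \<epsilon> (rk F) else 0)"
    unfolding chow_hilbert_eq sum_fy_altsum by (rule sum.cong[OF refl]) (rule altsum_rank[OF assms])
  also have "\<dots> = (\<Sum>F\<in>{F\<in>L. even (rk F)}. \<epsilon> (rk F))"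
    by (rule sum.inter_filter[OF finite_L, symmetric])
  finally show ?thesis .
qed

end

section \<open>q-Euler numbers and Hessenberg determinants\<close>

lemma qint_pos: "q > 0 \<Longrightarrow> k > 0 \<Longrightarrow> qint q k > 0"
  unfolding qint_def by (intro sum_pos) auto

lemma qfact_pos: "q > 0 \<Longrightarrow> qfact q k > 0"
  unfolding qfact_def by (intro prod_pos ballI qint_pos) auto

lemma qfact_0 [simp]: "qfact q 0 = 1"
  by (simp add: qfact_def)

lemma qfact_Suc: "qfact q (Suc k) = qint q (Suc k) * qfact q k"
  by (simp add: qfact_def mult.commute)

lemma one_minus_power_qint: "1 - q ^ k = (1 - q) * qint q k"
  by (simp add: qint_def one_diff_power_eq)

lemma qpoch_qfact: "qpoch q m = (1 - q) ^ m * qfact q m"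
proof (induction m)
  case 0
  then show ?case by (simp add: qpoch_def)
next
  case (Suc m)
  have "qpoch q (Suc m) = qpoch q m * (1 - q ^ Suc m)" by (simp add: qpoch_def)
  also have "\<dots> = (1 - q) ^ m * qfact q m * ((1 - q) * qint q (Suc m))"
    by (simp only: Suc one_minus_power_qint)
  finally show ?case by (simp add: qfact_Suc)
qed

lemma qbinom_qpoch:
  assumes "q > 1" "j \<le> k"
  shows "qbinom q k j = qpoch q k / (qpoch q j * qpoch q (k - j))"
proof -
  have "(1 - q) ^ k = (1 - q) ^ j * (1 - q) ^ (k - j)"
    using assms by (simp flip: power_add)
  then show ?thesis
    using assms qfact_pos[of q] by (simp add: qbinom_def qpoch_qfact)
qed

lemma cosh_q_inverse: "cosh_q q * inverse (cosh_q q) = 1"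
  by (rule inverse_mult_eq_1') (simp add: cosh_q_def qpoch_def)

text \<open>In the coefficient at an odd \<open>n\<close> of the product with \<open>cosh_q\<close>,
  an even index \<open>j > 0\<close> leaves a smaller odd index for the inverse, so only
  \<open>j = 0\<close> remains.\<close>

lemma inverse_cosh_q_odd: "odd n \<Longrightarrow> fps_nth (inverse (cosh_q q)) n = 0"
proof (induction n rule: less_induct)
  case (less n)
  let ?i = "fps_nth (inverse (cosh_q q))"
  have "0 = fps_nth (cosh_q q * inverse (cosh_q q)) n"
    using less.prems by (simp add: cosh_q_inverse odd_pos)
  also have "\<dots> = (\<Sum>j=0..n. fps_nth (cosh_q q) j * ?i (n - j))"
    by (simp add: fps_mult_nth)
  also have "\<dots> = (\<Sum>j\<in>{0}. fps_nth (cosh_q q) j * ?i (n - j))"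
  proof (rule sum.mono_neutral_right)
    show "\<forall>j\<in>{0..n} - {0}. fps_nth (cosh_q q) j * ?i (n - j) = 0"
    proof
      fix j assume j: "j \<in> {0..n} - {0}"
      show "fps_nth (cosh_q q) j * ?i (n - j) = 0"
        using less.IH[of "n - j"] less.prems j by (cases "even j") (auto simp: cosh_q_def)
    qed
  qed auto
  also have "\<dots> = ?i n" by (simp add: cosh_q_def qpoch_def)
  finally show ?case by simp
qed

text \<open>The product of the odd series \<open>sinh_q\<close> with an even series has no even
  coefficients, so the tangent part disappears.\<close>

lemma qEuler_even: "even m \<Longrightarrow> qEuler q m = qpoch q m * fps_nth (inverse (cosh_q q)) m"
proof -
  assume m: "even m"
  have "fps_nth (sinh_q q * inverse (cosh_q q)) m = 0"
    unfolding fps_mult_nth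
  proof (rule sum.neutral, rule ballI)
    fix j assume "j \<in> {0..m}"
    then show "fps_nth (sinh_q q) j * fps_nth (inverse (cosh_q q)) (m - j) = 0"
      using m inverse_cosh_q_odd[of "m - j" q] by (cases "even j") (auto simp: sinh_q_def)
  qed
  then show ?thesis by (simp add: qEuler_def)
qed

lemma qEuler_0: "qEuler q 0 = 1"
  by (simp add: qEuler_even qpoch_def cosh_q_def)

text \<open>The coefficient at \<open>m\<close> of the hyperbolic secant times the hyperbolic
  cosine, multiplied by \<open>qpoch q m\<close>.\<close>

lemma qEuler_recurrence:
  assumes q: "q > 1" and m: "even m" "m > 0"
  shows "(\<Sum>j\<in>{j\<in>{..m}. even j}. qbinom q m j * qEuler q j) = 0"
proof -
  let ?i = "fps_nth (inverse (cosh_q q))"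
  have nz: "qpoch q k \<noteq> 0" for k
    using q qfact_pos[of q k] by (simp add: qpoch_qfact)
  have "(\<Sum>j\<in>{j\<in>{..m}. even j}. qbinom q m j * qEuler q j)
      = (\<Sum>j\<in>{j\<in>{..m}. even j}. qpoch q m * (?i j * fps_nth (cosh_q q) (m - j)))"
    using m nz by (intro sum.cong) (auto simp: qbinom_qpoch[OF q] qEuler_even cosh_q_def)
  also have "\<dots> = (\<Sum>j=0..m. qpoch q m * (?i j * fps_nth (cosh_q q) (m - j)))"
    by (rule sum.mono_neutral_left) (auto simp: inverse_cosh_q_odd)
  also have "\<dots> = qpoch q m * fps_nth (inverse (cosh_q q) * cosh_q q) m"
    by (simp add: fps_mult_nth sum_distrib_left)
  also have "\<dots> = 0" using m cosh_q_inverse[of q] by (simp add: mult.commute)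
  finally show ?thesis .
qed

text \<open>A lower Hessenberg Toeplitz matrix whose first column is left free, so that expansion along the
  first row stays within the family.\<close>
definition hess :: "(nat \<Rightarrow> 'a::comm_ring_1) \<Rightarrow> (nat \<Rightarrow> 'a) \<Rightarrow> nat \<Rightarrow> 'a mat" where
  "hess f g a = mat a a (\<lambda>(i, j). if j = 0 then g (i + 1) else if j \<le> i + 1 then f (i + 1 - j) else 0)"

text \<open>The first row is \<open>g 1\<close>, then \<open>f 0 = 1\<close>, then zeros. Deleting
  the first column leaves the Toeplitz matrix of \<open>f\<close>; deleting the second leaves the
  free column, shifted by one.\<close>

lemma det_hess_Suc_Suc:
  assumes "f 0 = 1"
  shows "det (hess f g (Suc (Suc a))) = g 1 * det (hess f f (Suc a)) - det (hess f (\<lambda>k. g (Suc k)) (Suc a))"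
proof -
  let ?A = "hess f g (Suc (Suc a))"
  have car: "?A \<in> carrier_mat (Suc (Suc a)) (Suc (Suc a))" by (simp add: hess_def)
  have d0: "mat_delete ?A 0 0 = hess f f (Suc a)"
    by (rule eq_matI) (auto simp: mat_delete_def hess_def)
  have d1: "mat_delete ?A 0 1 = hess f (\<lambda>k. g (Suc k)) (Suc a)"
    by (rule eq_matI) (auto simp: mat_delete_def hess_def)
  have "det ?A = (\<Sum>j<Suc (Suc a). ?A $$ (0, j) * cofactor ?A 0 j)"
    by (rule laplace_expansion_row[OF car]) simp
  also have "\<dots> = (\<Sum>j\<in>{0,1}. ?A $$ (0, j) * cofactor ?A 0 j)"
    by (rule sum.mono_neutral_right) (auto simp: hess_def)
  also have "\<dots> = g 1 * det (hess f f (Suc a)) - det (hess f (\<lambda>k. g (Suc k)) (Suc a))"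
    using d0 d1 assms by (simp add: cofactor_def) (simp add: hess_def)
  finally show ?thesis .
qed

lemma det_hess_0: "det (hess f g 0) = 1"
  by (rule det_dim_zero) (simp add: hess_def)

lemma det_hess:
  assumes "f 0 = 1"
  shows "det (hess f g (Suc a)) = (\<Sum>k\<le>a. (-1) ^ k * g (Suc k) * det (hess f f (a - k)))"
proof (induction a arbitrary: g)
  case 0
  have "det (hess f g (Suc 0)) = g 1"
    by (subst det_single) (auto simp: hess_def)
  then show ?case by (simp add: det_hess_0)
next
  case (Suc a)
  have "(\<Sum>k\<le>Suc a. (-1) ^ k * g (Suc k) * det (hess f f (Suc a - k)))
      = g 1 * det (hess f f (Suc a)) - (\<Sum>k\<le>a. (-1) ^ k * g (Suc (Suc k)) * det (hess f f (a - k)))"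
    by (subst sum.atMost_Suc_shift) (simp add: sum_negf)
  then show ?case using Suc[of "\<lambda>k. g (Suc k)"] det_hess_Suc_Suc[of f g a] assms by simp
qed

text \<open>The iterated expansion with \<open>g = f\<close>, read backwards: the determinant of
  size \<open>a\<close> is the missing term \<open>k = a\<close> of the alternating sum.\<close>

lemma det_hess_recurrence:
  assumes "f 0 = 1" "a > 0"
  shows "(\<Sum>k\<le>a. (-1) ^ k * det (hess f f k) * f (a - k)) = 0"
proof -
  obtain b where a: "a = Suc b" using assms by (cases a) auto
  have "(\<Sum>k\<le>b. (-1) ^ k * det (hess f f k) * f (a - k))
      = (\<Sum>k\<le>b. (-1) ^ (b - k) * det (hess f f (b - k)) * f (Suc k))"
    by (rule sum.reindex_bij_witness[of _ "\<lambda>k. b - k" "\<lambda>k. b - k"]) (auto simp: a Suc_diff_le)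
  also have "\<dots> = (-1) ^ b * (\<Sum>k\<le>b. (-1) ^ k * f (Suc k) * det (hess f f (b - k)))"
    unfolding sum_distrib_left
  proof (rule sum.cong)
    fix k assume "k \<in> {..b}"
    then have "(-1 :: 'a) ^ (b - k) = (-1) ^ b * (-1) ^ k"
      by (metis atMost_iff minus_one_power_iff even_diff_nat even_add linorder_not_less
          mult_minus1 mult_minus1_right mult_1 minus_minus)
    then show "(-1) ^ (b - k) * det (hess f f (b - k)) * f (Suc k)
        = (-1) ^ b * ((-1) ^ k * f (Suc k) * det (hess f f (b - k)))"
      by (simp add: mult_ac)
  qed simp
  also have "\<dots> = (-1) ^ b * det (hess f f a)"
    using det_hess[of f f b] assms a by simp
  finally show ?thesis using assms a by (simp add: algebra_simps)
qed

lemma qDelta_hess: "qDelta q a = det (hess (\<lambda>k. 1 / qfact q (2 * k)) (\<lambda>k. 1 / qfact q (2 * k)) a)"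
  unfolding qDelta_def hess_def
  by (intro arg_cong[where f = det] cong_mat) auto

lemma qDelta_recurrence:
  "a > 0 \<Longrightarrow> (\<Sum>k\<le>a. (-1) ^ k * qDelta q k / qfact q (2 * (a - k))) = 0"
  using det_hess_recurrence[of "\<lambda>k. 1 / qfact q (2 * k)" a] by (simp add: qDelta_hess)

lemma sum_even_atMost: "(\<Sum>j\<in>{j\<in>{..2 * a}. even j}. h j) = (\<Sum>k\<le>a. h (2 * k))" for a :: nat
proof -
  have "{j\<in>{..2 * a}. even j} = (\<lambda>k. 2 * k) ` {..a}" by (auto elim!: evenE)
  then show ?thesis by (simp only:) (simp add: sum.reindex inj_on_def)
qed

text \<open>After division by the q-factorial, both sides satisfy the same recurrence with the same
  initial value. The term \<open>k = a\<close> occurs with coefficient 1, so strong induction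
  determines it.\<close>

lemma qEuler_qDelta:
  assumes q: "q > 1"
  shows "qEuler q (2 * a) = (-1) ^ a * qfact q (2 * a) * qDelta q a"
proof (induction a rule: less_induct)
  case (less a)
  have pos: "qfact q k > 0" for k using q qfact_pos[of q k] by simp
  show ?case
  proof (cases "a = 0")
    case True
    then show ?thesis by (simp add: qEuler_0 qDelta_hess det_hess_0)
  next
    case False
    have "0 = (\<Sum>k\<le>a. qbinom q (2 * a) (2 * k) * qEuler q (2 * k)) / qfact q (2 * a)"
      using qEuler_recurrence[OF q, of "2 * a"] False unfolding sum_even_atMost by simp
    also have "\<dots> = (\<Sum>k\<le>a. qEuler q (2 * k) / (qfact q (2 * k) * qfact q (2 * (a - k))))"
      unfolding sum_divide_distrib
      by (rule sum.cong) (use pos[of "2 * a"] in \<open>auto simp: qbinom_def diff_mult_distrib2\<close>)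
    also have "\<dots> = (\<Sum>k<a. qEuler q (2 * k) / (qfact q (2 * k) * qfact q (2 * (a - k))))
        + qEuler q (2 * a) / qfact q (2 * a)"
      by (simp flip: lessThan_Suc_atMost)
    also have "(\<Sum>k<a. qEuler q (2 * k) / (qfact q (2 * k) * qfact q (2 * (a - k))))
        = (\<Sum>k<a. (-1) ^ k * qDelta q k / qfact q (2 * (a - k)))"
    proof (rule sum.cong)
      fix k assume "k \<in> {..<a}"
      then show "qEuler q (2 * k) / (qfact q (2 * k) * qfact q (2 * (a - k)))
          = (-1) ^ k * qDelta q k / qfact q (2 * (a - k))"
        using less.IH[of k] pos[of "2 * k"] by simp
    qed simp
    also have "\<dots> = - ((-1) ^ a * qDelta q a)"
      using qDelta_recurrence[of a q] False by (simp flip: lessThan_Suc_atMost)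
    finally show ?thesis using pos[of "2 * a"] by (simp add: field_simps)
  qed
qed

section \<open>Counting subspaces over a finite field\<close>

text \<open>Scalar multiplication as a constant, so that the elementary spans and independence of
  the definitions can be identified with those of \<open>vector_space\<close>.\<close>

definition fscale :: "'a::field \<Rightarrow> (nat \<Rightarrow> 'a) \<Rightarrow> nat \<Rightarrow> 'a" where
  "fscale c v = (\<lambda>i. c * v i)"

interpretation fv: vector_space "fscale :: 'a::field \<Rightarrow> (nat \<Rightarrow> 'a) \<Rightarrow> nat \<Rightarrow> 'a"
  by standard (auto simp: fscale_def fun_eq_iff algebra_simps)

lemma sum_fun_apply: "(\<Sum>v\<in>B. f v) i = (\<Sum>v\<in>B. f v i)"
  by (induction B rule: infinite_finite_induct) auto

lemma fscale_sum_apply: "(\<Sum>v\<in>B. fscale (c v) v) = (\<lambda>i. \<Sum>v\<in>B. c v * v i)"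
  by (rule ext) (simp add: sum_fun_apply fscale_def)

lemma lin_indep_iff: "lin_indep B \<longleftrightarrow> finite B \<and> fv.independent B"
proof -
  have "(\<forall>i. (\<Sum>v\<in>B. c v * v i) = 0) \<longleftrightarrow> (\<Sum>v\<in>B. fscale (c v) v) = 0" for c
    by (auto simp: fscale_sum_apply fun_eq_iff)
  then show ?thesis
    by (cases "finite B") (auto simp: lin_indep_def fv.dependent_finite)
qed

lemma lin_span_eq: "finite B \<Longrightarrow> lin_span B = fv.span B"
  by (auto simp: lin_span_def fv.span_finite fscale_sum_apply)

lemma subspace_fvecs: "fv.subspace (fvecs n)"
  by (auto simp: fv.subspace_def fvecs_def fscale_def)

lemma card_fvecs: "card (fvecs n :: (nat \<Rightarrow> 'a::{field,finite}) set) = card (UNIV :: 'a set) ^ n"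
  and finite_fvecs: "finite (fvecs n :: (nat \<Rightarrow> 'a::{field,finite}) set)"
proof -
  let ?h = "\<lambda>v :: nat \<Rightarrow> 'a. restrict v {..<n}"
  have "bij_betw ?h (fvecs n) (PiE {..<n} (\<lambda>_. UNIV))"
  proof (rule bij_betwI[where g = "\<lambda>f i. if i < n then f i else 0"])
    fix y :: "nat \<Rightarrow> 'a" assume "y \<in> PiE {..<n} (\<lambda>_. UNIV)"
    then show "?h (\<lambda>i. if i < n then y i else 0) = y"
      by (auto simp: fun_eq_iff PiE_def extensional_def)
  qed (auto simp: fvecs_def fun_eq_iff)
  then have "card (fvecs n :: (nat \<Rightarrow> 'a) set) = card (PiE {..<n} (\<lambda>_. UNIV :: 'a set))"
    "finite (fvecs n :: (nat \<Rightarrow> 'a) set) \<longleftrightarrow> finite (PiE {..<n} (\<lambda>_. UNIV :: 'a set))"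
    by (rule bij_betw_same_card, rule bij_betw_finite)
  moreover have "finite (PiE {..<n} (\<lambda>_. UNIV :: 'a set))" by (rule finite_PiE) auto
  ultimately show "card (fvecs n :: (nat \<Rightarrow> 'a) set) = card (UNIV :: 'a set) ^ n" "finite (fvecs n :: (nat \<Rightarrow> 'a) set)"
    by (auto simp: card_PiE)
qed

lemma card_field_gt_1: "card (UNIV :: 'a::{field,finite} set) > 1"
proof -
  have "card {0, 1 :: 'a} \<le> card (UNIV :: 'a set)" by (rule card_mono) auto
  then show ?thesis by simp
qed

context
  fixes q :: nat
  assumes q_def: "card (UNIV :: 'a::{field,finite} set) = q"
begin

text \<open>Every vector of the larger span is \<open>x + fscale k v\<close> for exactly one scalar
  \<open>k\<close> and one \<open>x\<close> of the smaller span.\<close>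

lemma card_span_insert:
  fixes v :: "nat \<Rightarrow> 'a"
  assumes "finite (fv.span S)" "v \<notin> fv.span S"
  shows "finite (fv.span (insert v S)) \<and> card (fv.span (insert v S)) = q * card (fv.span S)"
proof -
  let ?h = "\<lambda>(k, x). x + fscale k v"
  have "bij_betw ?h (UNIV \<times> fv.span S) (fv.span (insert v S))"
    unfolding bij_betw_def
  proof
    show "inj_on ?h (UNIV \<times> fv.span S)"
    proof (rule inj_onI)
      fix a b assume ab: "a \<in> UNIV \<times> fv.span S" "b \<in> UNIV \<times> fv.span S" "?h a = ?h b"
      obtain k x k' x' where eq: "a = (k, x)" "b = (k', x')" by (metis surj_pair)
      have x: "x \<in> fv.span S" "x' \<in> fv.span S" "x + fscale k v = x' + fscale k' v"
        using ab eq by auto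
      then have "fscale (k - k') v = x' - x"
        by (simp add: fv.scale_left_diff_distrib algebra_simps)
      then have mem: "fscale (k - k') v \<in> fv.span S" using x fv.span_diff by metis
      have "k = k'"
      proof (rule ccontr)
        assume "k \<noteq> k'"
        then have "v = fscale (inverse (k - k')) (fscale (k - k') v)" by simp
        then show False using fv.span_scale[OF mem] assms(2) by metis
      qed
      then show "a = b" using x eq by simp
    qed
    show "?h ` (UNIV \<times> fv.span S) = fv.span (insert v S)"
    proof
      show "?h ` (UNIV \<times> fv.span S) \<subseteq> fv.span (insert v S)"
      proof clarify
        fix k x assume "x \<in> fv.span S"
        then have "x \<in> fv.span (insert v S)" using fv.span_mono[of S "insert v S"] by blast
        moreover have "fscale k v \<in> fv.span (insert v S)"
          by (intro fv.span_scale fv.span_base) simp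
        ultimately show "x + fscale k v \<in> fv.span (insert v S)" by (rule fv.span_add)
      qed
      show "fv.span (insert v S) \<subseteq> ?h ` (UNIV \<times> fv.span S)"
      proof
        fix x assume "x \<in> fv.span (insert v S)"
        then obtain k where "x - fscale k v \<in> fv.span S" by (auto simp: fv.span_insert)
        then show "x \<in> ?h ` (UNIV \<times> fv.span S)"
          by (intro rev_image_eqI[of "(k, x - fscale k v)"]) auto
      qed
    qed
  qed
  from bij_betw_same_card[OF this] bij_betw_finite[OF this] show ?thesis
    using assms q_def by (simp add: card_cartesian_product)
qed

lemma card_span_independent:
  fixes B :: "(nat \<Rightarrow> 'a) set"
  assumes "finite B" "fv.independent B"
  shows "finite (fv.span B) \<and> card (fv.span B) = q ^ card B"
  using assms
proof (induction B rule: finite_induct)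
  case empty
  then show ?case by simp
next
  case (insert v B)
  then have "fv.independent B" using fv.independent_mono[OF insert.prems, of B] by blast
  moreover have "v \<notin> fv.span B" using insert by (simp add: fv.independent_insert)
  ultimately show ?case using insert card_span_insert[of B v] by simp
qed

text \<open>Since powers of \<open>q\<close> determine their exponents, dimensions of finite
  subspaces can be found by counting; the dimension formula and monotonicity below are obtained this
  way.\<close>

lemma card_subspace:
  fixes U :: "(nat \<Rightarrow> 'a) set"
  assumes "fv.subspace U" "finite U"
  shows "card U = q ^ fv.dim U"
proof -
  obtain B where B: "B \<subseteq> U" "fv.independent B" "U \<subseteq> fv.span B" "card B = fv.dim U"
    using fv.basis_exists[of U] by metis
  then have "finite B" using assms finite_subset by blast
  moreover have "fv.span B = U" using fv.span_subspace B assms by blast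
  ultimately show ?thesis using card_span_independent[of B] B by simp
qed

lemma q_gt_1: "q > 1"
  using card_field_gt_1[where 'a = 'a] q_def by simp

lemma q_power_inject: "q ^ a = q ^ b \<longleftrightarrow> a = b"
  using q_gt_1 by simp

lemma dim_unique: "fv.subspace U \<Longrightarrow> finite U \<Longrightarrow> card U = q ^ k \<Longrightarrow> fv.dim U = k"
  for U :: "(nat \<Rightarrow> 'a) set"
  using card_subspace[of U] by (simp add: q_power_inject)

lemma subspaces_dim_iff:
  "subspaces_dim n k = {U. fv.subspace U \<and> U \<subseteq> (fvecs n :: (nat \<Rightarrow> 'a) set) \<and> fv.dim U = k}"
proof (rule subset_antisym; rule subsetI)
  fix U :: "(nat \<Rightarrow> 'a) set" assume "U \<in> subspaces_dim n k"
  then obtain B where B: "U = fv.span B" "B \<subseteq> fvecs n" "finite B" "fv.independent B" "card B = k"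
    by (auto simp: subspaces_dim_def lin_indep_iff lin_span_eq)
  moreover have "fv.span B \<subseteq> fvecs n" using B(2) subspace_fvecs by (rule fv.span_minimal)
  ultimately show "U \<in> {U. fv.subspace U \<and> U \<subseteq> fvecs n \<and> fv.dim U = k}"
    using fv.dim_span_eq_card_independent[OF B(4)] by simp
next
  fix U :: "(nat \<Rightarrow> 'a) set" assume U: "U \<in> {U. fv.subspace U \<and> U \<subseteq> fvecs n \<and> fv.dim U = k}"
  obtain B where B: "B \<subseteq> U" "fv.independent B" "U \<subseteq> fv.span B" "card B = fv.dim U"
    using fv.basis_exists[of U] by metis
  have "finite U" using finite_subset[OF _ finite_fvecs, of U n] U by simp
  then have fin: "finite B" by (rule finite_subset[OF B(1)])
  then have "lin_span B = U"
    using fv.span_subspace[OF B(1,3)] U by (simp add: lin_span_eq)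
  moreover have "B \<subseteq> fvecs n" "lin_indep B" "card B = k"
    using B U fin by (auto simp: lin_indep_iff)
  ultimately show "U \<in> subspaces_dim n k"
    unfolding subspaces_dim_def by blast
qed

text \<open>Addition from \<open>U \<times> W\<close> onto the sum has fibres that are translates of
  the intersection. The chosen decomposition \<open>p s\<close> fixes a base point in each
  fibre.\<close>

lemma card_sum_inter:
  fixes U W :: "(nat \<Rightarrow> 'a) set"
  assumes U: "fv.subspace U" "finite U" and W: "fv.subspace W" "finite W"
  defines "S \<equiv> {u + w | u w. u \<in> U \<and> w \<in> W}"
  shows "card S * card (U \<inter> W) = card U * card W"
proof -
  have "\<forall>s\<in>S. \<exists>p. fst p \<in> U \<and> snd p \<in> W \<and> s = fst p + snd p" by (auto simp: S_def)
  from bchoice[OF this] obtain p where p: "\<And>s. s \<in> S \<Longrightarrow> fst (p s) \<in> U"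
    "\<And>s. s \<in> S \<Longrightarrow> snd (p s) \<in> W" "\<And>s. s \<in> S \<Longrightarrow> s = fst (p s) + snd (p s)" by blast
  have "bij_betw (\<lambda>(s, t). (fst (p s) + t, snd (p s) - t)) (S \<times> (U \<inter> W)) (U \<times> W)"
  proof (rule bij_betwI[where g = "\<lambda>(u, w). (u + w, u - fst (p (u + w)))"])
    show "(\<lambda>(s, t). (fst (p s) + t, snd (p s) - t)) \<in> S \<times> (U \<inter> W) \<rightarrow> U \<times> W"
      using p U W by (auto intro: fv.subspace_add fv.subspace_diff)
    show "(\<lambda>(u, w). (u + w, u - fst (p (u + w)))) \<in> U \<times> W \<rightarrow> S \<times> (U \<inter> W)"
    proof clarify
      fix u w assume uw: "u \<in> U" "w \<in> W"
      then have s: "u + w \<in> S" by (auto simp: S_def)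
      have "u - fst (p (u + w)) = snd (p (u + w)) - w"
        using p(3)[OF s] by (simp add: algebra_simps)
      then have "u - fst (p (u + w)) \<in> W"
        using fv.subspace_diff[OF W(1) p(2)[OF s] uw(2)] by simp
      moreover have "u - fst (p (u + w)) \<in> U" by (rule fv.subspace_diff[OF U(1) uw(1) p(1)[OF s]])
      ultimately show "u + w \<in> S \<and> u - fst (p (u + w)) \<in> U \<inter> W" using s by simp
    qed
  next
    fix x assume "x \<in> S \<times> (U \<inter> W)"
    then obtain s t where x: "x = (s, t)" "s \<in> S" by auto
    have "fst (p s) + t + (snd (p s) - t) = s" using p(3)[OF x(2)] by (simp add: algebra_simps)
    then show "(\<lambda>(u, w). (u + w, u - fst (p (u + w)))) ((\<lambda>(s, t). (fst (p s) + t, snd (p s) - t)) x) = x"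
      by (simp add: x)
  next
    fix y assume "y \<in> U \<times> W"
    then obtain u w where y: "y = (u, w)" "u + w \<in> S" by (auto simp: S_def)
    have "snd (p (u + w)) - (u - fst (p (u + w))) = w"
      using p(3)[OF y(2)] by (simp add: algebra_simps)
    then show "(\<lambda>(s, t). (fst (p s) + t, snd (p s) - t)) ((\<lambda>(u, w). (u + w, u - fst (p (u + w)))) y) = y"
      by (simp add: y)
  qed
  from bij_betw_same_card[OF this] show ?thesis by (simp add: card_cartesian_product)
qed

lemma dim_sum_inter:
  fixes U W :: "(nat \<Rightarrow> 'a) set"
  assumes U: "fv.subspace U" "finite U" and W: "fv.subspace W" "finite W"
  shows "fv.dim {u + w | u w. u \<in> U \<and> w \<in> W} + fv.dim (U \<inter> W) = fv.dim U + fv.dim W"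
proof -
  let ?S = "{u + w | u w. u \<in> U \<and> w \<in> W}"
  have "?S = (\<lambda>(u, w). u + w) ` (U \<times> W)" by auto
  then have "finite ?S" using U W by simp
  moreover have "fv.subspace ?S" using fv.subspace_sums U W by blast
  moreover have "fv.subspace (U \<inter> W)" using fv.subspace_inter U W by blast
  ultimately have "q ^ (fv.dim ?S + fv.dim (U \<inter> W)) = q ^ (fv.dim U + fv.dim W)"
    using card_sum_inter[OF U W] assms by (simp add: card_subspace power_add)
  then show ?thesis by (simp only: q_power_inject)
qed

text \<open>Ordered independent tuples, built so that each new head avoids the span of the tail. The
  number of choices for the head then depends on the length alone.\<close>

fun indep_list :: "(nat \<Rightarrow> 'a) list \<Rightarrow> bool" where
  "indep_list [] \<longleftrightarrow> True"
| "indep_list (v # vs) \<longleftrightarrow> v \<notin> fv.span (set vs) \<and> indep_list vs"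

lemma card_span_indep_list:
  "indep_list vs \<Longrightarrow> finite (fv.span (set vs)) \<and> card (fv.span (set vs)) = q ^ length vs"
proof (induction vs)
  case Nil
  then show ?case by simp
next
  case (Cons v vs)
  then show ?case using card_span_insert[of "set vs" v] by simp
qed

definition indep_lists :: "(nat \<Rightarrow> 'a) set \<Rightarrow> nat \<Rightarrow> (nat \<Rightarrow> 'a) list set" where
  "indep_lists U j = {vs. set vs \<subseteq> U \<and> length vs = j \<and> indep_list vs}"

lemma finite_indep_lists: "finite U \<Longrightarrow> finite (indep_lists U j)"
  by (rule finite_subset[OF _ finite_lists_length_eq[of U j]]) (auto simp: indep_lists_def)

lemma card_indep_lists:
  assumes U: "fv.subspace U" "finite U"
  shows "card (indep_lists U j) = (\<Prod>i<j. q ^ fv.dim U - q ^ i)"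
proof (induction j)
  case 0
  have "indep_lists U 0 = {[]}" by (auto simp: indep_lists_def)
  then show ?case by simp
next
  case (Suc j)
  let ?S = "SIGMA vs:indep_lists U j. U - fv.span (set vs)"
  have "indep_lists U (Suc j) = (\<lambda>(vs, v). v # vs) ` ?S"
  proof
    show "indep_lists U (Suc j) \<subseteq> (\<lambda>(vs, v). v # vs) ` ?S"
    proof
      fix ws assume ws: "ws \<in> indep_lists U (Suc j)"
      then obtain v vs where "ws = v # vs" by (cases ws) (auto simp: indep_lists_def)
      with ws show "ws \<in> (\<lambda>(vs, v). v # vs) ` ?S"
        by (intro rev_image_eqI[of "(vs, v)"]) (auto simp: indep_lists_def)
    qed
  qed (auto simp: indep_lists_def)
  moreover have "inj_on (\<lambda>(vs, v). v # vs) ?S" by (auto simp: inj_on_def)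
  ultimately have "card (indep_lists U (Suc j)) = card ?S" by (simp add: card_image)
  also have "\<dots> = (\<Sum>vs\<in>indep_lists U j. card (U - fv.span (set vs)))"
    using U finite_indep_lists by (intro card_SigmaI) auto
  also have "\<dots> = (\<Sum>vs\<in>indep_lists U j. q ^ fv.dim U - q ^ j)"
  proof (rule sum.cong)
    fix vs assume vs: "vs \<in> indep_lists U j"
    have "fv.span (set vs) \<subseteq> U" using vs U by (intro fv.span_minimal) (auto simp: indep_lists_def)
    then show "card (U - fv.span (set vs)) = q ^ fv.dim U - q ^ j"
      using vs card_span_indep_list[of vs] card_subspace[OF U]
      by (simp add: card_Diff_subset indep_lists_def)
  qed simp
  finally show ?case using Suc by simp
qed

text \<open>Double counting: each independent list of length \<open>j\<close> in \<open>U\<close> is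
  an ordered basis of exactly one \<open>j\<close>-dimensional subspace, its span. The product form
  avoids division of natural numbers.\<close>

lemma card_subspaces_indep_lists:
  fixes U :: "(nat \<Rightarrow> 'a) set"
  assumes U: "fv.subspace U" "finite U"
  shows "card {W. fv.subspace W \<and> W \<subseteq> U \<and> fv.dim W = j} * (\<Prod>i<j. q ^ j - q ^ i)
       = (\<Prod>i<j. q ^ fv.dim U - q ^ i)"
proof -
  let ?N = "{W. fv.subspace W \<and> W \<subseteq> U \<and> fv.dim W = j}"
  have finN: "finite ?N" by (rule finite_subset[of _ "Pow U"]) (use U in auto)
  have fW: "finite W" if "W \<in> ?N" for W using that U finite_subset by blast
  have span: "fv.span (set vs) = W" if "W \<in> ?N" "vs \<in> indep_lists W j" for W vs
  proof -
    have sub: "fv.span (set vs) \<subseteq> W"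
      using that by (intro fv.span_minimal) (auto simp: indep_lists_def)
    moreover have "card (fv.span (set vs)) = card W"
      using that card_span_indep_list[of vs] card_subspace[of W] fW by (auto simp: indep_lists_def)
    ultimately show ?thesis using fW[OF that(1)] by (intro card_subset_eq) auto
  qed
  have "indep_lists U j = (\<Union>W\<in>?N. indep_lists W j)"
  proof
    show "indep_lists U j \<subseteq> (\<Union>W\<in>?N. indep_lists W j)"
    proof
      fix vs assume vs: "vs \<in> indep_lists U j"
      let ?W = "fv.span (set vs)"
      have "?W \<subseteq> U" using vs U by (intro fv.span_minimal) (auto simp: indep_lists_def)
      moreover have "fv.dim ?W = j"
        using vs card_span_indep_list[of vs] by (intro dim_unique) (auto simp: indep_lists_def)
      ultimately have "?W \<in> ?N" by simp
      moreover have "vs \<in> indep_lists ?W j" using vs fv.span_superset by (auto simp: indep_lists_def)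
      ultimately show "vs \<in> (\<Union>W\<in>?N. indep_lists W j)" by blast
    qed
  qed (auto simp: indep_lists_def)
  moreover have "indep_lists W j \<inter> indep_lists W' j = {}" if "W \<in> ?N" "W' \<in> ?N" "W \<noteq> W'" for W W'
  proof (rule ccontr)
    assume "indep_lists W j \<inter> indep_lists W' j \<noteq> {}"
    then obtain vs where "vs \<in> indep_lists W j" "vs \<in> indep_lists W' j" by blast
    then show False using span[OF that(1)] span[OF that(2)] that(3) by metis
  qed
  ultimately have "card (indep_lists U j) = (\<Sum>W\<in>?N. card (indep_lists W j))"
    using card_UN_disjoint[OF finN, of "\<lambda>W. indep_lists W j"] fW finite_indep_lists by simp
  also have "\<dots> = (\<Sum>W\<in>?N. \<Prod>i<j. q ^ j - q ^ i)"
    using fW by (intro sum.cong) (auto simp: card_indep_lists)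
  finally show ?thesis using card_indep_lists[OF U] by simp
qed

text \<open>The powers of \<open>q\<close> and of \<open>q - 1\<close> on the right depend only on
  \<open>j\<close>. They therefore cancel when the counts for dimensions \<open>k\<close> and
  \<open>j\<close> are compared, leaving a quotient of q-factorials.\<close>

lemma prod_power_diff_qfact:
  "j \<le> k \<Longrightarrow> real (\<Prod>i<j. q ^ k - q ^ i) * qfact (real q) (k - j)
    = (\<Prod>i<j. real q ^ i * (real q - 1)) * qfact (real q) k"
proof (induction j)
  case 0
  then show ?case by simp
next
  case (Suc j)
  have k: "k - j = Suc (k - Suc j)" using Suc.prems by simp
  have "real (q ^ k - q ^ j) = real q ^ k - real q ^ j"
    using q_gt_1 Suc.prems by (simp add: of_nat_diff power_increasing)
  also have "\<dots> = real q ^ j * (real q ^ (k - j) - 1)"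
    using Suc.prems by (simp add: algebra_simps flip: power_add)
  also have "\<dots> = real q ^ j * ((real q - 1) * qint (real q) (k - j))"
  proof -
    have "real q ^ (k - j) - 1 = (real q - 1) * qint (real q) (k - j)"
      using one_minus_power_qint[of "real q" "k - j"] by (simp add: algebra_simps)
    then show ?thesis by simp
  qed
  finally have "real (q ^ k - q ^ j) * qfact (real q) (k - Suc j)
      = real q ^ j * (real q - 1) * qfact (real q) (k - j)"
    by (simp add: k qfact_Suc)
  then have "real (\<Prod>i<Suc j. q ^ k - q ^ i) * qfact (real q) (k - Suc j)
      = real q ^ j * (real q - 1) * (real (\<Prod>i<j. q ^ k - q ^ i) * qfact (real q) (k - j))"
    by (simp add: mult_ac)
  also have "\<dots> = real q ^ j * (real q - 1) * ((\<Prod>i<j. real q ^ i * (real q - 1)) * qfact (real q) k)"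
    using Suc by (simp only: Suc_leD)
  finally show ?case by (simp add: mult_ac)
qed

lemma card_subspaces_qbinom:
  fixes U :: "(nat \<Rightarrow> 'a) set"
  assumes U: "fv.subspace U" "finite U" and j: "j \<le> fv.dim U"
  shows "real (card {W. fv.subspace W \<and> W \<subseteq> U \<and> fv.dim W = j}) = qbinom (real q) (fv.dim U) j"
proof -
  let ?N = "card {W. fv.subspace W \<and> W \<subseteq> U \<and> fv.dim W = j}" and ?k = "fv.dim U"
  let ?c = "\<Prod>i<j. real q ^ i * (real q - 1)"
  have c: "?c \<noteq> 0" using q_gt_1 by simp
  have pos: "qfact (real q) m > 0" for m using qfact_pos[of "real q" m] q_gt_1 by simp
  have jj: "real (\<Prod>i<j. q ^ j - q ^ i) = ?c * qfact (real q) j"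
    using prod_power_diff_qfact[of j j] by simp
  have "real ?N * real (\<Prod>i<j. q ^ j - q ^ i) = real (\<Prod>i<j. q ^ ?k - q ^ i)"
    unfolding of_nat_mult[symmetric] card_subspaces_indep_lists[OF U] ..
  then have "real ?N * real (\<Prod>i<j. q ^ j - q ^ i) * qfact (real q) (?k - j) = ?c * qfact (real q) ?k"
    by (simp only: prod_power_diff_qfact[OF j])
  then have "?c * (real ?N * (qfact (real q) j * qfact (real q) (?k - j))) = ?c * qfact (real q) ?k"
    unfolding jj by (simp only: mult_ac)
  then have "real ?N * (qfact (real q) j * qfact (real q) (?k - j)) = qfact (real q) ?k"
    by (rule mult_left_cancel[OF c, THEN iffD1])
  then show ?thesis using pos[of j] pos[of "?k - j"] by (simp add: qbinom_def field_simps)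
qed

end

section \<open>The lattice of flats\<close>

context
  fixes q :: nat
  assumes q_def: "card (UNIV :: 'a::{field,finite} set) = q"
begin

lemma sum_subspaces_dim:
  fixes U :: "(nat \<Rightarrow> 'a) set" and h :: "nat \<Rightarrow> real"
  assumes U: "fv.subspace U" "finite U" and A: "A \<subseteq> {..fv.dim U}"
  shows "(\<Sum>W\<in>{W. fv.subspace W \<and> W \<subseteq> U \<and> fv.dim W \<in> A}. h (fv.dim W))
       = (\<Sum>j\<in>A. qbinom (real q) (fv.dim U) j * h j)"
proof -
  let ?N = "{W. fv.subspace W \<and> W \<subseteq> U \<and> fv.dim W \<in> A}"
  have fin: "finite ?N" by (rule finite_subset[of _ "Pow U"]) (use U in auto)
  have finA: "finite A" using A finite_subset by blast
  have "(\<Sum>W\<in>?N. h (fv.dim W)) = (\<Sum>j\<in>A. \<Sum>W\<in>{W\<in>?N. fv.dim W = j}. h (fv.dim W))"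
    by (rule sum.group[OF fin finA, symmetric]) auto
  also have "\<dots> = (\<Sum>j\<in>A. qbinom (real q) (fv.dim U) j * h j)"
  proof (rule sum.cong)
    fix j assume j: "j \<in> A"
    then have eq: "{W\<in>?N. fv.dim W = j} = {W. fv.subspace W \<and> W \<subseteq> U \<and> fv.dim W = j}" by auto
    have "(\<Sum>W\<in>{W\<in>?N. fv.dim W = j}. h (fv.dim W)) = (\<Sum>W\<in>{W\<in>?N. fv.dim W = j}. h j)"
      by (rule sum.cong) auto
    also have "\<dots> = qbinom (real q) (fv.dim U) j * h j"
      unfolding eq using card_subspaces_qbinom[OF q_def U] j A by auto
    finally show "(\<Sum>W\<in>{W\<in>?N. fv.dim W = j}. h (fv.dim W)) = qbinom (real q) (fv.dim U) j * h j" .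
  qed simp
  finally show ?thesis .
qed

lemma dim_mono:
  fixes U W :: "(nat \<Rightarrow> 'a) set"
  assumes "fv.subspace U" "fv.subspace W" "finite W" "U \<subseteq> W"
  shows "fv.dim U \<le> fv.dim W"
proof -
  have "finite U" using finite_subset assms by blast
  then have "q ^ fv.dim U \<le> q ^ fv.dim W"
    using card_mono[OF assms(3,4)] card_subspace[OF q_def] assms by simp
  then show ?thesis using q_gt_1[OF q_def] by simp
qed

lemma dim_strict_mono:
  fixes U W :: "(nat \<Rightarrow> 'a) set"
  assumes "fv.subspace U" "fv.subspace W" "finite W" "U \<subset> W"
  shows "fv.dim U < fv.dim W"
proof -
  have "finite U" using finite_subset assms by blast
  then have "q ^ fv.dim U < q ^ fv.dim W"
    using psubset_card_mono[OF assms(3,4)] card_subspace[OF q_def] assms by simp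
  then show ?thesis using q_gt_1[OF q_def] by simp
qed

lemma dim_fvecs: "fv.dim (fvecs n :: (nat \<Rightarrow> 'a) set) = n"
  by (rule dim_unique[OF q_def subspace_fvecs finite_fvecs]) (simp add: card_fvecs q_def)

lemma dim_zero_subspace: "fv.dim (zero_subspace :: (nat \<Rightarrow> 'a) set) = 0"
  and subspace_zero_subspace: "fv.subspace (zero_subspace :: (nat \<Rightarrow> 'a) set)"
proof -
  have eq: "(zero_subspace :: (nat \<Rightarrow> 'a) set) = {0}" by (simp add: zero_subspace_def zero_fun_def)
  show *: "fv.subspace (zero_subspace :: (nat \<Rightarrow> 'a) set)" unfolding eq by (rule fv.subspace_single_0)
  show "fv.dim (zero_subspace :: (nat \<Rightarrow> 'a) set) = 0"
    by (rule dim_unique[OF q_def *]) (simp_all add: eq)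
qed

lemma in_zero_subspace: "v \<in> zero_subspace \<longleftrightarrow> v = 0"
  by (simp add: zero_subspace_def zero_fun_def)

context
  fixes r n :: nat
  assumes r: "1 \<le> r" "r \<le> n"
begin

abbreviation (input) flats :: "(nat \<Rightarrow> 'a) set set" where "flats \<equiv> flats_Mr r n"

abbreviation (input) top_flat :: "(nat \<Rightarrow> 'a) set" where "top_flat \<equiv> fvecs n"

lemma flats_eq:
  "flats = {U. fv.subspace U \<and> U \<subseteq> top_flat \<and> (fv.dim U < r \<or> U = top_flat)}"
  unfolding flats_Mr_def subspaces_dim_iff[OF q_def] using subspace_fvecs by auto

lemma flat_subspace: "F \<in> flats \<Longrightarrow> fv.subspace F"
  and flat_subset: "F \<in> flats \<Longrightarrow> F \<subseteq> top_flat"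
  by (auto simp: flats_eq)

lemma finite_flat: "F \<in> flats \<Longrightarrow> finite F"
  using flat_subset finite_fvecs finite_subset by blast

lemma flat_dim: "F \<in> flats \<Longrightarrow> fv.dim F < r \<or> F = top_flat"
  by (auto simp: flats_eq)

lemma flatI: "fv.subspace F \<Longrightarrow> F \<subseteq> top_flat \<Longrightarrow> fv.dim F < r \<Longrightarrow> F \<in> flats"
  by (auto simp: flats_eq)

lemma top_flat_in: "top_flat \<in> flats"
  using subspace_fvecs by (auto simp: flats_eq)

lemma zero_subspace_in: "zero_subspace \<in> flats"
  by (rule flatI)
    (use subspace_zero_subspace dim_zero_subspace r in \<open>auto simp: zero_subspace_def fvecs_def\<close>)

lemma zero_subspace_le: "F \<in> flats \<Longrightarrow> zero_subspace \<subseteq> F"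
  using fv.subspace_0[OF flat_subspace] by (auto simp: in_zero_subspace)

text \<open>Truncation at \<open>r\<close> affects only the top flat, of dimension \<open>n\<close>;
  every other flat has dimension below \<open>r\<close>.\<close>

definition rank_of :: "(nat \<Rightarrow> 'a) set \<Rightarrow> nat" where
  "rank_of U = min r (fv.dim U)"

lemma rank_less: "F \<in> flats \<Longrightarrow> G \<in> flats \<Longrightarrow> F \<subset> G \<Longrightarrow> rank_of F < rank_of G"
proof -
  assume *: "F \<in> flats" "G \<in> flats" "F \<subset> G"
  then have "F \<noteq> top_flat" using flat_subset by blast
  then have "fv.dim F < r" using flat_dim * by blast
  moreover have "fv.dim F < fv.dim G"
    using dim_strict_mono[OF flat_subspace flat_subspace finite_flat] * by blast
  ultimately show ?thesis by (simp add: rank_of_def)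
qed

text \<open>The meet is the intersection. The join is the sum of subspaces as long as its dimension
  stays below \<open>r\<close>, and otherwise jumps to the top flat. In both cases its rank is the
  truncated dimension of the sum, so submodularity reduces to the dimension formula.\<close>

lemma flats_join_meet:
  assumes F: "F \<in> flats" and G: "G \<in> flats"
  shows "\<exists>J\<in>flats. \<exists>M\<in>flats.
        F \<le> J \<and> G \<le> J \<and> (\<forall>H\<in>flats. F \<le> H \<longrightarrow> G \<le> H \<longrightarrow> J \<le> H) \<and>
        M \<le> F \<and> M \<le> G \<and> (\<forall>H\<in>flats. H \<le> F \<longrightarrow> H \<le> G \<longrightarrow> H \<le> M) \<and>
        rank_of J + rank_of M \<le> rank_of F + rank_of G"
proof -
  let ?S = "{u + w | u w. u \<in> F \<and> w \<in> G}" and ?M = "F \<inter> G"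
  note sF = flat_subspace[OF F] and sG = flat_subspace[OF G]
  have S: "fv.subspace ?S" by (rule fv.subspace_sums[OF sF sG])
  have Sle: "?S \<subseteq> H" if "fv.subspace H" "F \<subseteq> H" "G \<subseteq> H" for H
    using that by (auto intro: fv.subspace_add)
  have Stop: "?S \<subseteq> top_flat" by (rule Sle[OF subspace_fvecs flat_subset[OF F] flat_subset[OF G]])
  have FS: "F \<subseteq> ?S"
  proof
    fix x assume "x \<in> F"
    moreover have "x = x + 0" by simp
    ultimately show "x \<in> ?S" using fv.subspace_0[OF sG] by blast
  qed
  have GS: "G \<subseteq> ?S"
  proof
    fix x assume "x \<in> G"
    moreover have "x = 0 + x" by simp
    ultimately show "x \<in> ?S" using fv.subspace_0[OF sF] by blast
  qed
  have dim: "fv.dim ?S + fv.dim ?M = fv.dim F + fv.dim G"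
    by (rule dim_sum_inter[OF q_def sF finite_flat[OF F] sG finite_flat[OF G]])
  have sM: "fv.subspace ?M" by (rule fv.subspace_inter[OF sF sG])
  have dM: "fv.dim ?M \<le> fv.dim F" "fv.dim ?M \<le> fv.dim G"
    by (rule dim_mono[OF sM sF finite_flat[OF F]], blast) (rule dim_mono[OF sM sG finite_flat[OF G]], blast)
  have M: "?M \<in> flats"
  proof (cases "fv.dim ?M < r")
    case True
    then show ?thesis using sM flat_subset[OF F] by (intro flatI) auto
  next
    \<comment> \<open>An intersection of dimension at least \<open>r\<close> is possible only if
      both flats are the top flat.\<close>
    case False
    then have "F = top_flat" "G = top_flat" using dM flat_dim[OF F] flat_dim[OF G] by auto
    then show ?thesis using top_flat_in by simp
  qed
  define J where "J = (if fv.dim ?S < r then ?S else top_flat)"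
  have J: "J \<in> flats" using flatI[OF S Stop] top_flat_in by (simp add: J_def)
  have FJ: "F \<subseteq> J" "G \<subseteq> J" using FS GS flat_subset F G by (auto simp: J_def)
  have least: "J \<subseteq> H" if H: "H \<in> flats" "F \<subseteq> H" "G \<subseteq> H" for H
  proof -
    have SH: "?S \<subseteq> H" by (rule Sle[OF flat_subspace[OF H(1)] H(2,3)])
    have "fv.dim ?S \<le> fv.dim H" by (rule dim_mono[OF S flat_subspace[OF H(1)] finite_flat[OF H(1)] SH])
    then show ?thesis using SH flat_dim[OF H(1)] by (auto simp: J_def)
  qed
  have "rank_of J = min r (fv.dim ?S)" using r by (simp add: rank_of_def J_def dim_fvecs)
  then have "rank_of J + rank_of ?M \<le> rank_of F + rank_of G"
    using dim dM by (auto simp: rank_of_def min_def)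
  then show ?thesis using J M FJ least
    by (intro bexI[of _ J] bexI[of _ ?M] conjI ballI impI) auto
qed

text \<open>Usually this is the line through \<open>v\<close>. For \<open>r = 1\<close> the line
  need not be a flat: the only flats are zero and the whole space, and the latter is the
  atom.\<close>

lemma ex_atom_through:
  assumes v: "v \<in> top_flat" "v \<noteq> 0"
  obtains a where "a \<in> flats" "rank_of a = 1" "v \<in> a" "\<And>G. G \<in> flats \<Longrightarrow> v \<in> G \<Longrightarrow> a \<subseteq> G"
proof -
  let ?l = "fv.span {v}"
  have dl: "fv.dim ?l = 1"
    using fv.dim_span_eq_card_independent[of "{v}"] v by (simp add: fv.dependent_single)
  have le: "?l \<subseteq> G" if "fv.subspace G" "v \<in> G" for G
    using that by (intro fv.span_minimal) auto
  show thesis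
  proof (cases "r = 1")
    case True
    show thesis
    proof (rule that[of top_flat])
      show "rank_of top_flat = 1" unfolding rank_of_def dim_fvecs using True r by simp
      fix G assume G: "G \<in> flats" "v \<in> G"
      have "fv.dim ?l \<le> fv.dim G"
        by (rule dim_mono[OF fv.subspace_span flat_subspace[OF G(1)] finite_flat[OF G(1)]
              le[OF flat_subspace[OF G(1)] G(2)]])
      then show "top_flat \<subseteq> G" using dl True flat_dim[OF G(1)] by auto
    qed (use v top_flat_in in auto)
  next
    case False
    show thesis
    proof (rule that[of ?l])
      show "?l \<in> flats" using le[OF subspace_fvecs v(1)] dl False r by (intro flatI) auto
      show "rank_of ?l = 1" using dl r by (simp add: rank_of_def)
      show "v \<in> ?l" by (rule fv.span_base) simp
      show "\<And>G. G \<in> flats \<Longrightarrow> v \<in> G \<Longrightarrow> ?l \<subseteq> G" using le flat_subspace by blast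
    qed
  qed
qed

lemma rank_one_atom:
  assumes a: "a \<in> flats" "rank_of a = 1"
  shows "a \<in> atoms flats zero_subspace"
proof -
  have z: "rank_of zero_subspace = 0" by (simp add: rank_of_def dim_zero_subspace)
  have "c = zero_subspace \<or> c = a" if c: "c \<in> flats" "c \<subseteq> a" for c
  proof (rule ccontr)
    assume no: "\<not> ?thesis"
    then have "c \<subset> a" "zero_subspace \<subset> c" using c(2) zero_subspace_le[OF c(1)] by blast+
    from rank_less[OF c(1) a(1) this(1)] rank_less[OF zero_subspace_in c(1) this(2)]
    show False using a(2) by simp
  qed
  moreover have "a \<noteq> zero_subspace" using a z by auto
  ultimately show ?thesis using a by (auto simp: atoms_def)
qed

lemma geometric_lattice_flats: "geometric_lattice flats zero_subspace rank_of"
proof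
  show "finite flats"
    by (rule finite_subset[of _ "Pow top_flat"]) (use flat_subset finite_fvecs in auto)
  show "zero_subspace \<in> flats" by (rule zero_subspace_in)
  show "\<And>F. F \<in> flats \<Longrightarrow> zero_subspace \<le> F" by (rule zero_subspace_le)
  show "rank_of zero_subspace = 0" by (simp add: rank_of_def dim_zero_subspace)
  show "\<And>F G. F \<in> flats \<Longrightarrow> G \<in> flats \<Longrightarrow> F < G \<Longrightarrow> rank_of F < rank_of G" by (rule rank_less)
  show "\<And>F G. F \<in> flats \<Longrightarrow> G \<in> flats \<Longrightarrow> \<exists>J\<in>flats. \<exists>M\<in>flats.
        F \<le> J \<and> G \<le> J \<and> (\<forall>H\<in>flats. F \<le> H \<longrightarrow> G \<le> H \<longrightarrow> J \<le> H) \<and>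
        M \<le> F \<and> M \<le> G \<and> (\<forall>H\<in>flats. H \<le> F \<longrightarrow> H \<le> G \<longrightarrow> H \<le> M) \<and>
        rank_of J + rank_of M \<le> rank_of F + rank_of G"
    by (rule flats_join_meet)
next
  fix a assume a: "a \<in> atoms flats zero_subspace"
  then have aL: "a \<in> flats" and "a \<noteq> zero_subspace"
    and min: "\<And>c. c \<in> flats \<Longrightarrow> c \<subseteq> a \<Longrightarrow> c = zero_subspace \<or> c = a"
    by (auto simp: atoms_def)
  then obtain v where "v \<in> a" "v \<notin> zero_subspace" using zero_subspace_le[OF aL] by blast
  then have v: "v \<in> a" "v \<noteq> 0" by (simp_all add: in_zero_subspace)
  then have "v \<in> top_flat" using flat_subset[OF aL] by blast
  then obtain l where l: "l \<in> flats" "rank_of l = 1" "v \<in> l" "\<And>G. G \<in> flats \<Longrightarrow> v \<in> G \<Longrightarrow> l \<subseteq> G"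
    using ex_atom_through[OF _ v(2)] by blast
  have "l \<noteq> zero_subspace" using l(3) v(2) in_zero_subspace by blast
  then have "l = a" using min[OF l(1) l(4)[OF aL v(1)]] by blast
  then show "rank_of a = 1" using l(2) by simp
next
  fix F G assume FG: "F \<in> flats" "G \<in> flats" "F < G"
  then obtain v where v: "v \<in> G" "v \<notin> F" by auto
  then have "v \<noteq> 0" using fv.subspace_0[OF flat_subspace[OF FG(1)]] by metis
  moreover have "v \<in> top_flat" using flat_subset[OF FG(2)] v by blast
  ultimately obtain l where l: "l \<in> flats" "rank_of l = 1" "v \<in> l" "\<And>G. G \<in> flats \<Longrightarrow> v \<in> G \<Longrightarrow> l \<subseteq> G"
    using ex_atom_through by blast
  then show "\<exists>a\<in>atoms flats zero_subspace. a \<le> G \<and> \<not> a \<le> F"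
    using rank_one_atom[OF l(1,2)] FG v by blast
qed

text \<open>As \<open>r\<close> is odd, the top flat has odd rank and drops out. Every flat of even
  rank then has rank equal to its dimension, and all subspaces of it are flats, so the condition on
  \<open>\<epsilon>\<close> is the recurrence of the q-Euler numbers with subspaces counted by
  q-binomials.\<close>

lemma chow_hilbert_flats_neg_one:
  assumes odd: "odd r"
  shows "chow_hilbert flats zero_subspace (-1)
       = (\<Sum>k\<le>(r - 1) div 2. qbinom (real q) n (2 * k) * qEuler (real q) (2 * k))"
proof -
  interpret geometric_lattice flats zero_subspace rank_of by (rule geometric_lattice_flats)
  have q: "real q > 1" using q_gt_1[OF q_def] by simp
  have r': "r - 1 = 2 * ((r - 1) div 2)" using odd by simp
  have even_rank: "rank_of F = fv.dim F \<and> fv.dim F < r" if "F \<in> flats" "even (rank_of F)" for F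
    using that odd flat_dim[OF that(1)] r by (auto simp: rank_of_def dim_fvecs min_def split: if_splits)
  have "(\<Sum>G\<in>{G\<in>flats. G \<le> F \<and> even (rank_of G)}. qEuler q (rank_of G)) = 0"
    if F: "F \<in> V" "even (rank_of F)" for F
  proof -
    have FL: "F \<in> flats" using F by simp
    note rF = even_rank[OF FL F(2)]
    let ?A = "{j\<in>{..fv.dim F}. even j}"
    have dimG: "fv.dim G < r" if "fv.subspace G" "G \<subseteq> F" for G
      using dim_mono[OF that(1) flat_subspace[OF FL] finite_flat[OF FL] that(2)] rF by simp
    have set: "{G\<in>flats. G \<le> F \<and> even (rank_of G)} = {G. fv.subspace G \<and> G \<subseteq> F \<and> fv.dim G \<in> ?A}"
    proof (intro subset_antisym subsetI)
      fix G assume G: "G \<in> {G\<in>flats. G \<le> F \<and> even (rank_of G)}"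
      then show "G \<in> {G. fv.subspace G \<and> G \<subseteq> F \<and> fv.dim G \<in> ?A}"
        using even_rank[of G] flat_subspace dim_mono[OF _ flat_subspace[OF FL] finite_flat[OF FL]] by auto
    next
      fix G assume G: "G \<in> {G. fv.subspace G \<and> G \<subseteq> F \<and> fv.dim G \<in> ?A}"
      then show "G \<in> {G\<in>flats. G \<le> F \<and> even (rank_of G)}"
        using dimG[of G] flat_subset[OF FL] by (auto intro!: flatI simp: rank_of_def)
    qed
    have "(\<Sum>G\<in>{G\<in>flats. G \<le> F \<and> even (rank_of G)}. qEuler q (rank_of G))
        = (\<Sum>G\<in>{G\<in>flats. G \<le> F \<and> even (rank_of G)}. qEuler q (fv.dim G))"
      by (rule sum.cong) (use even_rank in auto)
    also have "\<dots> = (\<Sum>j\<in>?A. qbinom (real q) (fv.dim F) j * qEuler q j)"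
      unfolding set by (rule sum_subspaces_dim[OF flat_subspace[OF FL] finite_flat[OF FL]]) auto
    also have "\<dots> = 0"
    proof (rule qEuler_recurrence[OF q])
      show "even (fv.dim F)" using rF F by simp
      have "zero_subspace \<subset> F" using zero_subspace_le[OF FL] F by auto
      from rank_less[OF zero_subspace_in FL this] show "0 < fv.dim F" using rF by simp
    qed
    finally show ?thesis .
  qed
  from chow_hilbert_neg_one[of "qEuler q", OF qEuler_0 this]
  have "chow_hilbert flats zero_subspace (-1) = (\<Sum>F\<in>{F\<in>flats. even (rank_of F)}. qEuler q (rank_of F))"
    by simp
  also have "\<dots> = (\<Sum>F\<in>{F\<in>flats. even (rank_of F)}. qEuler q (fv.dim F))"
    by (rule sum.cong) (use even_rank in auto)
  \<comment> \<open>All subspaces of even dimension up to \<open>r - 1\<close> appear, so the final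
    count is made in the full space of dimension \<open>n\<close>.\<close>
  also have "{F\<in>flats. even (rank_of F)} = {F. fv.subspace F \<and> F \<subseteq> top_flat \<and> fv.dim F \<in> {j\<in>{..r - 1}. even j}}"
  proof (intro subset_antisym subsetI)
    fix F assume "F \<in> {F\<in>flats. even (rank_of F)}"
    then show "F \<in> {F. fv.subspace F \<and> F \<subseteq> top_flat \<and> fv.dim F \<in> {j\<in>{..r - 1}. even j}}"
      using even_rank[of F] flat_subspace flat_subset by auto
  next
    fix F assume "F \<in> {F. fv.subspace F \<and> F \<subseteq> top_flat \<and> fv.dim F \<in> {j\<in>{..r - 1}. even j}}"
    then show "F \<in> {F\<in>flats. even (rank_of F)}"
      using r by (auto intro!: flatI simp: rank_of_def)
  qed
  also have "(\<Sum>F\<in>\<dots>. qEuler q (fv.dim F))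
      = (\<Sum>j\<in>{j\<in>{..r - 1}. even j}. qbinom (real q) (fv.dim top_flat) j * qEuler q j)"
    by (rule sum_subspaces_dim[OF subspace_fvecs finite_fvecs]) (use r in \<open>auto simp: dim_fvecs\<close>)
  also have "\<dots> = (\<Sum>k\<le>(r - 1) div 2. qbinom (real q) n (2 * k) * qEuler (real q) (2 * k))"
    unfolding dim_fvecs by (subst r') (rule sum_even_atMost)
  finally show ?thesis .
qed

end

end

theorem theorem1p2:
  fixes n r :: nat
  assumes "card (UNIV :: 'a::{field,finite} set) = q"
    and "1 \<le> r" and "r \<le> n" and "odd r"
  shows "((-1) ^ ((r - 1) div 2) *
           chow_hilbert (flats_Mr r n :: (nat \<Rightarrow> 'a) set set) zero_subspace (-1)
         = (-1) ^ ((r - 1) div 2) *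
           (\<Sum>k = 0..(r - 1) div 2. qbinom (real q) n (2 * k) * qEuler (real q) (2 * k))) \<and>
         ((-1) ^ ((r - 1) div 2) *
           chow_hilbert (flats_Mr r n :: (nat \<Rightarrow> 'a) set set) zero_subspace (-1)
         = (-1) ^ ((r - 1) div 2) *
           (1 + qfact (real q) n *
              (\<Sum>a = 1..(r - 1) div 2. (-1) ^ a / qfact (real q) (n - 2 * a) * qDelta (real q) a)))"
proof -
  let ?h = "(r - 1) div 2"
  have q: "real q > 1" using q_gt_1[OF assms(1)] by simp
  have pos: "qfact (real q) m > 0" for m using qfact_pos[of "real q" m] q by simp
  have H: "chow_hilbert (flats_Mr r n :: (nat \<Rightarrow> 'a) set set) zero_subspace (-1)
      = (\<Sum>k = 0..?h. qbinom (real q) n (2 * k) * qEuler (real q) (2 * k))"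
    using chow_hilbert_flats_neg_one[OF assms] by (simp add: atLeast0AtMost)
  \<comment> \<open>The term \<open>k = 0\<close> is the isolated 1 of the determinant
    formula.\<close>
  also have "\<dots> = qbinom (real q) n 0 * qEuler (real q) 0
      + (\<Sum>a = 1..?h. qbinom (real q) n (2 * a) * qEuler (real q) (2 * a))"
    by (simp add: sum.atLeast_Suc_atMost)
  also have "(\<Sum>a = 1..?h. qbinom (real q) n (2 * a) * qEuler (real q) (2 * a))
      = (\<Sum>a = 1..?h. qfact (real q) n * ((-1) ^ a / qfact (real q) (n - 2 * a) * qDelta (real q) a))"
  proof (rule sum.cong)
    fix a
    show "qbinom (real q) n (2 * a) * qEuler (real q) (2 * a)
        = qfact (real q) n * ((-1) ^ a / qfact (real q) (n - 2 * a) * qDelta (real q) a)"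
      unfolding qEuler_qDelta[OF q] qbinom_def using pos[of "2 * a"] by simp
  qed simp
  also have "qbinom (real q) n 0 * qEuler (real q) 0 = 1"
    using pos[of n] by (simp add: qbinom_def qEuler_0)
  finally show ?thesis using H by (simp add: sum_distrib_left)
qed

end
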